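(* Denote $C=\min\left\{\frac{1}{2C_2C_3},\frac{1}{8C_2(C_3)^3}\right\}$, where $C_2=4\nu^2$, $L=4\nu+1$ and $C_3=3Le^{L^2+1}$. Let $\alpha=\nu$ and, for each natural $k>1$, let $Y^{(k)}_\tau=k^{-\nu/2}\sum_{t\in G_k^{-1}(\tau)}Q_t$ $(\tau\in\mathbb{Z}^\nu)$ be the renormalization group transform of the field $\{Q_t\mid t\in\mathbb{Z}^\nu\}$. Then for any real $\lambda$ with $|\lambda|<C$ and any $\tau\in\mathbb{Z}^\nu$: $$\lim_{k\to\infty}\langle Y^{(k)}_\tau,Y^{(k)}_\tau\rangle_\lambda=1+\sum_{n=1}^\infty\lambda^nV_n,$$ where the series on the right-hand side converges and $$V_n=\sum_{\substack{\gamma\in R^*,\ |\gamma|=n,\\ \gamma\text{ connects }(\bar 0)}}\ \sum_{\substack{t\in\tilde\gamma,\ t\neq\bar 0,\\ \gamma\text{ connects }(\bar 0,t)}}\frac{1}{\gamma!}\langle Q_{\bar 0},Q_t,\Phi^\backprime_\gamma\rangle_0 .$$ The limiting variances are positive and do not depend on $\tau$.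
   Context: Fix a natural number $\nu\ge 1$. On $\mathbb{Z}^\nu$ use the distance $\rho(s,t)=\sum_{i=1}^\nu|s_i-t_i|$; $\bar 0=(0,\ldots,0)$. $R=\{\{s,t\}\mid s,t\in\mathbb{Z}^\nu,\ \rho(s,t)=1\}$. $\Omega$ is the set of all functions $\omega:\mathbb{Z}^\nu\to\{-1,1\}$, and $Q_t(\omega)=\omega(t)$ for $t\in\mathbb{Z}^\nu$. For finite $T\subset\mathbb{Z}^\nu$, $Q_T=\prod_{t\in T}Q_t$. Gibbs measure on a cube: for $N\ge1$ let $\Lambda_N=\{t\in\mathbb{Z}^\nu\mid |t_i|\le N\text{ for all }i\}$ and $R_N=\{\{r,s\}\in R\mid r,s\in\Lambda_N\}$. For $\delta:\Lambda_N\to\{-1,1\}$ let $A_\delta=\{\omega\in\Omega\mid\omega(t)=\delta(t)\ \forall t\in\Lambda_N\}$. For real $\lambda$, $P_{\lambda,N}$ is the probability measure on the finite unions of sets $A_\delta$ with $P_{\lambda,N}(A_\delta)=\Xi^{-1}\exp\big(\lambda\sum_{\{r,s\}\in R_N}\delta(r)\delta(s)\big)$, where $\Xi=\sum_{\delta'}\exp\big(\lambda\sum_{\{r,s\}\in R_N}\delta'(r)\delta'(s)\big)$. Semi-invariants (cumulants): for random variables $X_1,\ldots,X_m$ on one probability space, $\langle X_1,\ldots,X_m\rangle=\sum_{\{S_1,\ldots,S_j\}}(-1)^{j-1}(j-1)!\,E(X_{S_1})\cdots E(X_{S_j})$, the sum over all partitions of $\{1,\ldots,m\}$ into non-empty disjoint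 sets, with $X_S=\prod_{i\in S}X_i$; in particular $\langle X\rangle=E(X)$ and $\langle X,X\rangle$ is the variance. $\langle\cdot\rangle_{\lambda,N}$ and $\langle\cdot\rangle_\lambda$ denote semi-invariants with respect to $P_{\lambda,N}$ and to the limiting measure $P_\lambda$ below. For $\lambda=0$ the variables $Q_t$, $t\in\Lambda_N$, are independent and uniform on $\{-1,1\}$ under $P_{0,N}$, so semi-invariants with respect to $P_{0,N}$ do not depend on $N$ (for $N$ large enough to contain the points involved) and are denoted $\langle\cdot\rangle_0$. Limiting Gibbs measure: for $|\lambda|<C_\nu=\frac{1}{2C_2C_3}$ the limit $f(Q_T)=\lim_{N\to\infty}\langle Q_T\rangle_{\lambda,N}$ exists for every finite $T\subset\mathbb{Z}^\nu$, and $P_\lambda$ is the probability measure on $\Omega$ (on the sigma-algebra generated by the sets below) determined by $$P_\lambda(\omega(t_1)=a_1,\ldots,\omega(t_m)=a_m)=\frac{(-1)^{q}}{2^m}\sum_{T'\subseteq T}f(Q_{T'})\prod_{\{i:\,t_i\in T\setminus T'\}}a_i$$ for $T=\{t_1,\ldots,t_m\}$ (distinct points) and $a_1,\ldots,a_m\in\{-1,1\}$, where $q$ is the number of indices $i$ with $a_i=-1$. $G_k(t_1,\ldots,t_\nu)=([t_1/k],\ldots,[t_\nu/k])$ with $[x]$ the integer part (floor) of $x$. Families: a family of elements of a set $\mathfrak A$ is a set of pairs $\gamma=\{(T_1,n_1),\ldots,(T_m,n_m)\}$ with $T_1,\ldots,T_m$ distinct elements of $\mathfrak A$ and integers $n_i\ge1$;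 $|\gamma|=n_1+\cdots+n_m$, $\gamma!=n_1!\cdots n_m!$, and (if the $T_i$ are sets) $\tilde\gamma=\bigcup_iT_i$. The associated sequence $\widehat\gamma$ lists each $T_i$ exactly $n_i$ times. $R^*$ is the set of families of elements of $R$. For a sequence $b=(t_1,\ldots,t_m)$ of points of $\mathbb{Z}^\nu$ and $\gamma\in R^*$ with $\widehat\gamma=(A_1,\ldots,A_n)$, the associated graph of $b$ and $\gamma$ has edges $A_1,\ldots,A_n$ and vertex set $\{t_1,\ldots,t_m\}\cup\bigcup_iA_i$; $\gamma$ connects $b$ if this graph is connected. For $A=\{r,s\}\in R$, $\Phi_A=Q_rQ_s$, and $\langle Q_s,Q_t,\Phi^\backprime_\gamma\rangle_0=\langle Q_s,Q_t,\Phi_{A_1},\ldots,\Phi_{A_n}\rangle_0$. *)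

theory Defs
  imports "HOL-Probability.Probability" "HOL-Library.Disjoint_Sets" "HOL-Library.Multiset"
begin

text \<open>
  The lattice is the type \<open>int ^ 'n\<close>; its dimension is \<open>CARD('n)\<close>, which is at least 1.
  A finite family is represented by a multiset: the pair (T, n) of the family says that T has
  multiplicity n. Its size, its factorial and its union are \<open>size\<close>, \<open>family_fact\<close> and
  \<open>\<Union> (set_mset \<gamma>)\<close>.
\<close>

definition rho :: "int ^ 'n::finite \<Rightarrow> int ^ 'n \<Rightarrow> int" where
  "rho s t = (\<Sum>i\<in>UNIV. \<bar>s $ i - t $ i\<bar>)"

definition bonds :: "(int ^ 'n::finite) set set" where
  "bonds = {{s, t} | s t. rho s t = 1}"

type_synonym 'n config = "int ^ 'n \<Rightarrow> real"

definition Omega :: "('n::finite) config set" where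
  "Omega = {\<omega>. \<forall>t. \<omega> t \<in> {-1, 1}}"

definition Q :: "int ^ 'n::finite \<Rightarrow> 'n config \<Rightarrow> real" where
  "Q t \<omega> = \<omega> t"

definition Qset :: "(int ^ 'n::finite) set \<Rightarrow> 'n config \<Rightarrow> real" where
  "Qset T \<omega> = (\<Prod>t\<in>T. Q t \<omega>)"


section \<open>Semi-invariants\<close>

definition semi_invariant :: "'a measure \<Rightarrow> ('a \<Rightarrow> real) list \<Rightarrow> real" where
  "semi_invariant M Xs =
     (\<Sum>\<pi> | partition_on {..<length Xs} \<pi>.
        (-1) ^ (card \<pi> - 1) * fact (card \<pi> - 1) *
        (\<Prod>S\<in>\<pi>. integral\<^sup>L M (\<lambda>\<omega>. \<Prod>i\<in>S. (Xs ! i) \<omega>)))"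


section \<open>Gibbs measures\<close>

definition cube :: "nat \<Rightarrow> (int ^ 'n::finite) set" where
  "cube N = {t. \<forall>i. \<bar>t $ i\<bar> \<le> int N}"

definition cube_bonds :: "nat \<Rightarrow> (int ^ 'n::finite) set set" where
  "cube_bonds N = {A \<in> bonds. A \<subseteq> cube N}"

definition cube_configs :: "nat \<Rightarrow> ('n::finite) config set" where
  "cube_configs N = (cube N \<rightarrow>\<^sub>E {-1, 1})"

definition cube_cylinder :: "nat \<Rightarrow> ('n::finite) config \<Rightarrow> 'n config set" where
  "cube_cylinder N \<delta> = {\<omega> \<in> Omega. \<forall>t\<in>cube N. \<omega> t = \<delta> t}"

definition boltzmann :: "real \<Rightarrow> nat \<Rightarrow> ('n::finite) config \<Rightarrow> real" where
  "boltzmann lam N \<delta> = exp (lam * (\<Sum>A\<in>cube_bonds N. \<Prod>t\<in>A. \<delta> t))"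

definition gibbs_weight :: "real \<Rightarrow> nat \<Rightarrow> ('n::finite) config \<Rightarrow> real" where
  "gibbs_weight lam N \<delta> =
     boltzmann lam N \<delta> / (\<Sum>\<delta>'\<in>(cube_configs N :: 'n config set). boltzmann lam N \<delta>')"

text \<open>
  The cylinders of the finitely many cube configurations are non-empty and partition \<open>Omega\<close>, so
  the generated sigma-algebra consists of their finite unions, and the value on such a union is the
  sum of the weights of the cylinders it contains.
\<close>

definition gibbs_cube :: "real \<Rightarrow> nat \<Rightarrow> ('n::finite) config measure" where
  "gibbs_cube lam N =
     measure_of Omega (cube_cylinder N ` cube_configs N)
       (\<lambda>E. ennreal (\<Sum>\<delta> | \<delta> \<in> cube_configs N \<and> cube_cylinder N \<delta> \<subseteq> E. gibbs_weight lam N \<delta>))"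

text \<open>
  At \<open>lam = 0\<close> the value for the cube of size \<open>N\<close> is the same for all sufficiently large \<open>N\<close>.
\<close>

definition semi_invariant_0 :: "(('n::finite) config \<Rightarrow> real) list \<Rightarrow> real" where
  "semi_invariant_0 Xs =
     (THE c. \<forall>\<^sub>F N in sequentially. semi_invariant (gibbs_cube 0 N) Xs = c)"

definition limit_corr :: "real \<Rightarrow> (int ^ 'n::finite) set \<Rightarrow> real" where
  "limit_corr lam T = lim (\<lambda>N. semi_invariant (gibbs_cube lam N) [Qset T])"

definition cylinder :: "(int ^ 'n::finite) set \<Rightarrow> 'n config \<Rightarrow> 'n config set" where
  "cylinder T a = {\<omega> \<in> Omega. \<forall>t\<in>T. \<omega> t = a t}"

definition is_limit_gibbs :: "real \<Rightarrow> ('n::finite) config measure \<Rightarrow> bool" where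
  "is_limit_gibbs lam M \<longleftrightarrow>
     prob_space M \<and> space M = Omega \<and>
     sets M = sigma_sets Omega {cylinder T a | T a. finite T \<and> a \<in> T \<rightarrow> {-1, 1}} \<and>
     (\<forall>T a. finite T \<longrightarrow> a \<in> T \<rightarrow> {-1, 1} \<longrightarrow>
        measure M (cylinder T a) =
          (-1) ^ card {t \<in> T. a t = -1} / 2 ^ card T *
          (\<Sum>T'\<in>Pow T. limit_corr lam T' * (\<Prod>t\<in>T - T'. a t)))"

definition limit_gibbs :: "real \<Rightarrow> ('n::finite) config measure" where
  "limit_gibbs lam = (THE M. is_limit_gibbs lam M)"


section \<open>Renormalization\<close>

definition G :: "nat \<Rightarrow> int ^ 'n::finite \<Rightarrow> int ^ 'n" where
  "G k t = (\<chi> i. \<lfloor>real_of_int (t $ i) / real k\<rfloor>)"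

definition Y :: "nat \<Rightarrow> int ^ 'n::finite \<Rightarrow> 'n config \<Rightarrow> real" where
  "Y k \<tau> \<omega> = real k powr (- real CARD('n) / 2) * (\<Sum>t \<in> G k -` {\<tau>}. Q t \<omega>)"


section \<open>Families and the coefficients of the series\<close>

definition family_fact :: "'a multiset \<Rightarrow> real" where
  "family_fact \<gamma> = (\<Prod>A\<in>set_mset \<gamma>. fact (count \<gamma> A))"

definition connected_graph :: "'v set \<Rightarrow> 'v set set \<Rightarrow> bool" where
  "connected_graph V E \<longleftrightarrow>
     (\<forall>u\<in>V. \<forall>v\<in>V. (u, v) \<in> {(x, y). x \<in> V \<and> y \<in> V \<and> {x, y} \<in> E}\<^sup>*)"

text \<open>Edge multiplicities do not affect connectedness, so only the set of edges enters.\<close>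

definition connects :: "'v set multiset \<Rightarrow> 'v list \<Rightarrow> bool" where
  "connects \<gamma> b \<longleftrightarrow> connected_graph (set b \<union> \<Union> (set_mset \<gamma>)) (set_mset \<gamma>)"

text \<open>Semi-invariants are symmetric, so any enumeration of the family serves.\<close>

definition family_seq :: "'a multiset \<Rightarrow> 'a list" where
  "family_seq \<gamma> = (SOME As. mset As = \<gamma>)"

definition Phi :: "(int ^ 'n::finite) set \<Rightarrow> 'n config \<Rightarrow> real" where
  "Phi A \<omega> = (\<Prod>t\<in>A. Q t \<omega>)"

text \<open>The \<open>itself\<close> argument carries the dimension. Both index sets are finite.\<close>

definition V :: "'n::finite itself \<Rightarrow> nat \<Rightarrow> real" where
  "V _ n =
     (\<Sum>\<gamma> | set_mset \<gamma> \<subseteq> bonds \<and> size \<gamma> = n \<and> connects \<gamma> [0 :: int ^ 'n].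
        \<Sum>t | t \<in> \<Union> (set_mset \<gamma>) \<and> t \<noteq> 0 \<and> connects \<gamma> [0, t].
          1 / family_fact \<gamma> * semi_invariant_0 ([Q 0, Q t] @ map Phi (family_seq \<gamma>)))"


section \<open>Constants\<close>

definition C2 :: "nat \<Rightarrow> real" where
  "C2 \<nu> = 4 * real \<nu> ^ 2"

definition L :: "nat \<Rightarrow> real" where
  "L \<nu> = 4 * real \<nu> + 1"

definition C3 :: "nat \<Rightarrow> real" where
  "C3 \<nu> = 3 * L \<nu> * exp (L \<nu> ^ 2 + 1)"

definition C :: "nat \<Rightarrow> real" where
  "C \<nu> = min (1 / (2 * C2 \<nu> * C3 \<nu>)) (1 / (8 * C2 \<nu> * C3 \<nu> ^ 3))"

end

theory Submission
  imports Defs "HOL-Combinatorics.Multiset_Permutations" "HOL-Complex_Analysis.Cauchy_Integral_Formula"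
begin

text \<open>
  The variance of a block spin is \<open>k\<^sup>-\<^sup>\<nu>\<close> times the sum of \<open>\<langle>Q s, Q t\<rangle>\<close> over all pairs of points of a
  block. Translation invariance turns it into \<open>1\<close> plus the sum over \<open>u \<noteq> 0\<close> of
  \<open>\<langle>Q 0, Q u\<rangle>\<close> times \<open>overlap k \<tau> u\<close>, the fraction of the block that stays in the block when
  shifted by \<open>u\<close>. These fractions are at most \<open>1\<close> and tend to \<open>1\<close>, so the limit should be the sum of
  all correlations with the origin. Two things remain: uniform summability, and the identification
  of the Taylor coefficients in the coupling with the \<open>V n\<close>.

  Both come from analyticity in a complex coupling \<open>z\<close>. In a finite volume a correlation is a
  quotient of two entire functions of \<open>z\<close>. On a disc that does not depend on the volume, the
  denominator has no zero and the quotient is bounded by \<open>1\<close>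
  (\<open>gibbs_ex_nonzero_and_bound\<close>). To see this, remove all bonds at one site \<open>t\<close>. The product of their Boltzmann
  factors is \<open>1\<close> plus an error. By induction on the number of bonds, the error contributes at most half
  of the modulus of the partition function without these bonds. The term \<open>1\<close> dominates the denominator but contributes
  nothing to a numerator that contains the spin at \<open>t\<close>, because \<open>t\<close> is now isolated. Cauchy's inequality then bounds the
  \<open>n\<close>-th Taylor coefficient by \<open>r\<^sup>-\<^sup>n\<close>, where \<open>r\<close> is the radius of the disc.

  The coefficients are cumulants at coupling zero, because differentiating a cumulant in the
  coupling appends the interaction to its list of variables (\<open>cumulant_gibbs_deriv\<close>). Such a
  cumulant vanishes unless its bonds hang together with the given points (\<open>cumulant_odd\<close>,
  \<open>cumulant_outside_cluster\<close>): the same differentiation, read backwards, reduces this to symmetry and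
  independence of plain expectations. Along \<open>n\<close> connected bonds no coordinate
  changes by more than \<open>2 * n\<close>. Hence the \<open>n\<close>-th coefficient does not depend on the volume once this is large, is
  translation invariant, and vanishes for the pair \<open>0, u\<close> when \<open>u\<close> is not in \<open>cube (2 * n)\<close>. So the \<open>n\<close>-th term of
  the variance is a sum of at most \<open>(4 * n + 1)\<^sup>\<nu>\<close> coefficients of size at most \<open>r\<^sup>-\<^sup>n\<close>, weighted with
  overlaps. This bound is uniform in \<open>k\<close>, and
  Tannery's theorem gives the limit. Grouping sequences of bonds by their multiset gives \<open>V n\<close>
  (\<open>V_eq\<close>). The hypothesis on the coupling bounds the terms by those of a geometric series
  of ratio below \<open>1/2\<close> (\<open>coupling_small\<close>), so the series cannot cancel the leading \<open>1\<close>, and the limit is positive.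

  The limiting Gibbs measure is the Kolmogorov extension of the limits of the finite-volume
  marginals.
\<close>

section \<open>Set partitions and cumulants\<close>

lemma partition_on_block_subset: "partition_on A \<pi> \<Longrightarrow> S \<in> \<pi> \<Longrightarrow> S \<subseteq> A"
  using partition_onD1 by blast

text \<open>
  A partition of \<open>insert a A\<close> arises from a partition \<open>\<pi>\<close> of \<open>A\<close> by putting \<open>a\<close> into one of its blocks \<open>S\<close>
  or by making \<open>{a}\<close> a new block; the choice \<open>S = {}\<close> encodes the latter.
\<close>
lemma bij_betw_partitions_insert:
  assumes "a \<notin> A"
  shows "bij_betw (\<lambda>(\<pi>, S). insert (insert a S) (\<pi> - {S}))
           (SIGMA \<pi> : {\<pi>. partition_on A \<pi>}. insert {} \<pi>)
           {\<pi>. partition_on (insert a A) \<pi>}"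
proof (rule bij_betw_byWitness[where f' = "\<lambda>\<pi>. let B = (THE B. B \<in> \<pi> \<and> a \<in> B) in
    ((\<pi> - {B}) \<union> ({B - {a}} - {{}}), B - {a})"])
  have THE1: "(THE B. B \<in> insert (insert a S) (\<pi> - {S}) \<and> a \<in> B) = insert a S"
    if "partition_on A \<pi>" for \<pi> S
  proof (rule the_equality)
    fix B assume "B \<in> insert (insert a S) (\<pi> - {S}) \<and> a \<in> B"
    then show "B = insert a S" using partition_on_block_subset[OF that, of B] assms by blast
  qed simp
  show "\<forall>p\<in>SIGMA \<pi> : {\<pi>. partition_on A \<pi>}. insert {} \<pi>.
    (\<lambda>\<pi>. let B = (THE B. B \<in> \<pi> \<and> a \<in> B) in ((\<pi> - {B}) \<union> ({B - {a}} - {{}}), B - {a}))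
      ((\<lambda>(\<pi>, S). insert (insert a S) (\<pi> - {S})) p) = p"
  proof (rule ballI, elim SigmaE, simp only: mem_Collect_eq prod.case)
    fix \<pi> S assume \<pi>: "partition_on A \<pi>" and S: "S \<in> insert {} \<pi>"
    have aS: "a \<notin> S" using S assms partition_on_block_subset[OF \<pi>, of S] by blast
    have aP: "insert a S \<notin> \<pi>" using assms partition_on_block_subset[OF \<pi>, of "insert a S"] by blast
    have e: "{} \<notin> \<pi>" by (rule partition_onD3[OF \<pi>])
    have r1: "insert (insert a S) (\<pi> - {S}) - {insert a S} = \<pi> - {S}" using aP by blast
    have r2: "insert a S - {a} = S" using aS by blast
    have r3: "\<pi> - {S} \<union> ({S} - {{}}) = \<pi>" using S e by blast
    show "(let B = (THE B. B \<in> insert (insert a S) (\<pi> - {S}) \<and> a \<in> B) in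
        ((insert (insert a S) (\<pi> - {S}) - {B}) \<union> ({B - {a}} - {{}}), B - {a})) = (\<pi>, S)"
      unfolding THE1[OF \<pi>] Let_def r1 r2 r3 ..
  qed
  have ex1: "\<exists>B. B \<in> \<pi> \<and> a \<in> B \<and> (THE B. B \<in> \<pi> \<and> a \<in> B) = B"
    if \<pi>: "partition_on (insert a A) \<pi>" for \<pi>
  proof -
    obtain B where B: "B \<in> \<pi>" "a \<in> B" using \<pi> by (auto simp: partition_on_def)
    have "(THE B. B \<in> \<pi> \<and> a \<in> B) = B"
    proof (rule the_equality)
      fix C assume "C \<in> \<pi> \<and> a \<in> C"
      then show "C = B" using B disjointD[OF partition_onD2[OF \<pi>], of B C] by blast
    qed (use B in auto)
    then show ?thesis using B by auto
  qed
  show "\<forall>\<pi>\<in>{\<pi>. partition_on (insert a A) \<pi>}.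
      (\<lambda>(\<pi>, S). insert (insert a S) (\<pi> - {S}))
        (let B = (THE B. B \<in> \<pi> \<and> a \<in> B) in ((\<pi> - {B}) \<union> ({B - {a}} - {{}}), B - {a})) = \<pi>"
  proof clarify
    fix \<pi> assume \<pi>: "partition_on (insert a A) \<pi>"
    obtain B where B: "B \<in> \<pi>" "a \<in> B" "(THE B. B \<in> \<pi> \<and> a \<in> B) = B" using ex1[OF \<pi>] by blast
    have "B - {a} \<notin> \<pi>" 
    proof
      assume "B - {a} \<in> \<pi>"
      moreover have "B - {a} \<noteq> B" using B by auto
      ultimately have "(B - {a}) \<inter> B = {}"
        using disjointD[OF partition_onD2[OF \<pi>]] B(1) by blast
      then have "B - {a} = {}" by auto
      then show False using \<open>B - {a} \<in> \<pi>\<close> partition_onD3[OF \<pi>] by metis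
    qed
    then have r1: "(\<pi> - {B} \<union> ({B - {a}} - {{}})) - {B - {a}} = \<pi> - {B}" by blast
    have r2: "insert a (B - {a}) = B" using B(2) by blast
    have r3: "insert B (\<pi> - {B}) = \<pi>" using B(1) by blast
    show "(\<lambda>(\<pi>, S). insert (insert a S) (\<pi> - {S}))
        (let B = (THE B. B \<in> \<pi> \<and> a \<in> B) in ((\<pi> - {B}) \<union> ({B - {a}} - {{}}), B - {a})) = \<pi>"
      unfolding B(3) Let_def prod.case r1 r2 r3 ..
  qed
  show "(\<lambda>(\<pi>, S). insert (insert a S) (\<pi> - {S})) ` (SIGMA \<pi> : {\<pi>. partition_on A \<pi>}. insert {} \<pi>)
    \<subseteq> {\<pi>. partition_on (insert a A) \<pi>}"
  proof (rule image_subsetI, elim SigmaE, simp only: mem_Collect_eq prod.case)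
    fix \<pi> S assume \<pi>: "partition_on A \<pi>" and S: "S \<in> insert {} \<pi>"
    have SA: "S \<subseteq> A" using S partition_on_block_subset[OF \<pi>, of S] by blast
    have dis: "\<And>B D. B \<in> \<pi> \<Longrightarrow> D \<in> \<pi> \<Longrightarrow> B \<noteq> D \<Longrightarrow> B \<inter> D = {}"
      using disjointD[OF partition_onD2[OF \<pi>]] .
    have "B \<inter> S = {}" if "B \<in> \<pi> - {S}" for B using that dis[of B S] S by blast
    then have U: "\<Union>(\<pi> - {S}) = A - S" using S partition_onD1[OF \<pi>] by blast
    have d: "disjnt (insert a S) (\<Union>(\<pi> - {S}))" using U assms by (auto simp: disjnt_def)
    have "partition_on (insert a A - insert a S) (\<pi> - {S})"
    proof (rule partition_onI)
      show "\<Union>(\<pi> - {S}) = insert a A - insert a S" using U assms by blast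
      show "disjnt p q" if "p \<in> \<pi> - {S}" "q \<in> \<pi> - {S}" "p \<noteq> q" for p q
        using dis[of p q] that unfolding disjnt_def by blast
      show "{} \<notin> \<pi> - {S}" using partition_onD3[OF \<pi>] by blast
    qed
    then show "partition_on (insert a A) (insert (insert a S) (\<pi> - {S}))"
      using partition_on_insert[OF d, of "insert a A"] SA by auto
  qed
  show "(\<lambda>\<pi>. let B = (THE B. B \<in> \<pi> \<and> a \<in> B) in ((\<pi> - {B}) \<union> ({B - {a}} - {{}}), B - {a}))
    ` {\<pi>. partition_on (insert a A) \<pi>} \<subseteq> (SIGMA \<pi> : {\<pi>. partition_on A \<pi>}. insert {} \<pi>)"
  proof (rule image_subsetI, simp only: mem_Collect_eq)
    fix \<pi> assume \<pi>: "partition_on (insert a A) \<pi>"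
    obtain B where B: "B \<in> \<pi>" "a \<in> B" "(THE B. B \<in> \<pi> \<and> a \<in> B) = B" using ex1[OF \<pi>] by blast
    have dis: "\<And>C D. C \<in> \<pi> \<Longrightarrow> D \<in> \<pi> \<Longrightarrow> C \<noteq> D \<Longrightarrow> C \<inter> D = {}"
      using disjointD[OF partition_onD2[OF \<pi>]] .
    have U: "\<Union>\<pi> = insert a A" using partition_onD1[OF \<pi>] by simp
    have "partition_on A ((\<pi> - {B}) \<union> ({B - {a}} - {{}}))"
    proof (rule partition_onI)
      have "\<Union>(\<pi> - {B}) = \<Union>\<pi> - B" using dis B by blast
      then show "\<Union>((\<pi> - {B}) \<union> ({B - {a}} - {{}})) = A" using U B assms by auto
    next
      fix p q assume "p \<in> (\<pi> - {B}) \<union> ({B - {a}} - {{}})" "q \<in> (\<pi> - {B}) \<union> ({B - {a}} - {{}})" "p \<noteq> q"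
      moreover have "p \<inter> B = {}" if "p \<in> \<pi> - {B}" for p using that dis[of p B] B(1) by blast
      ultimately show "disjnt p q" using dis[of p q] unfolding disjnt_def by blast
    next
      show "{} \<notin> (\<pi> - {B}) \<union> ({B - {a}} - {{}})" using partition_onD3[OF \<pi>] by blast
    qed
    then show "(let B = (THE B. B \<in> \<pi> \<and> a \<in> B) in ((\<pi> - {B}) \<union> ({B - {a}} - {{}}), B - {a}))
      \<in> (SIGMA \<pi> : {\<pi>. partition_on A \<pi>}. insert {} \<pi>)"
      unfolding B(3) Let_def by auto
  qed
qed

text \<open>
  The semi-invariant for an arbitrary expectation functional. Complex values are admitted so that
  the functional may be a Gibbs expectation at a complex coupling.
\<close>
definition cumulant :: "(('a \<Rightarrow> real) \<Rightarrow> 'b::field_char_0) \<Rightarrow> ('a \<Rightarrow> real) list \<Rightarrow> 'b" where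
  "cumulant E Xs = (\<Sum>\<pi> | partition_on {..<length Xs} \<pi>.
     (-1) ^ (card \<pi> - 1) * fact (card \<pi> - 1) * (\<Prod>S\<in>\<pi>. E (\<lambda>\<omega>. \<Prod>i\<in>S. (Xs ! i) \<omega>)))"

lemma semi_invariant_eq_cumulant: "semi_invariant M = cumulant (integral\<^sup>L M)"
  by (intro ext) (simp add: semi_invariant_def cumulant_def)

lemma of_real_cumulant:
  "(of_real (cumulant E Xs) :: 'b::{real_algebra_1, field_char_0}) = cumulant (\<lambda>f. of_real (E f)) Xs"
  by (simp add: cumulant_def)

lemma cumulant_cong:
  assumes "\<And>S. S \<noteq> {} \<Longrightarrow> S \<subseteq> {..<length Xs} \<Longrightarrow>
    E (\<lambda>\<omega>. \<Prod>i\<in>S. (Xs ! i) \<omega>) = E' (\<lambda>\<omega>. \<Prod>i\<in>S. (Xs ! i) \<omega>)"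
  shows "cumulant E Xs = cumulant E' Xs"
  unfolding cumulant_def
  by (intro sum.cong refl arg_cong2[where f="(*)"] prod.cong assms)
     (auto simp: partition_on_def)

lemma partition_on_length_singleton: "{\<pi>. partition_on {..<length [X]} \<pi>} = {{{0}}}"
proof -
  have "\<pi> = {{0}}" if "partition_on {0::nat} \<pi>" for \<pi>
  proof -
    have "S = {0}" if "S \<in> \<pi>" for S
      using that \<open>partition_on {0} \<pi>\<close> by (metis Union_upper partition_onD1 partition_onD3 subset_singletonD)
    moreover have "\<pi> \<noteq> {}" using that by (auto simp: partition_on_def)
    ultimately show ?thesis by auto
  qed
  moreover have "partition_on {0::nat} {{0}}" by (rule partition_on_space) simp
  ultimately have "{\<pi>. partition_on {0::nat} \<pi>} = {{{0}}}" by blast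
  moreover have "{..<length [X]} = {0}" by auto
  ultimately show ?thesis by (simp only:)
qed

lemma cumulant_singleton: "cumulant E [X] = E X"
proof -
  show ?thesis by (simp add: cumulant_def partition_on_length_singleton del: length_Cons list.size)
qed

text \<open>
  The recursion that makes cumulants behave well under differentiation: for an expectation
  \<open>E\<close>, the bracket is the derivative at \<open>s = 0\<close> of the expectation of the block when the measure is tilted by \<open>exp (s * X')\<close>.
\<close>
lemma cumulant_snoc:
  fixes E :: "('a \<Rightarrow> real) \<Rightarrow> 'b::field_char_0"
  assumes "Xs \<noteq> []"
  shows "cumulant E (Xs @ [X']) = (\<Sum>\<pi> | partition_on {..<length Xs} \<pi>.
     (-1) ^ (card \<pi> - 1) * fact (card \<pi> - 1) *
     (\<Sum>S\<in>\<pi>. (E (\<lambda>\<omega>. (\<Prod>i\<in>S. (Xs ! i) \<omega>) * X' \<omega>) - E (\<lambda>\<omega>. \<Prod>i\<in>S. (Xs ! i) \<omega>) * E X')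
         * (\<Prod>S'\<in>\<pi> - {S}. E (\<lambda>\<omega>. \<Prod>i\<in>S'. (Xs ! i) \<omega>))))"
proof -
  let ?m = "length Xs" let ?I = "{\<pi>. partition_on {..<?m} \<pi>}"
  define e where "e S = E (\<lambda>\<omega>. \<Prod>i\<in>S. (Xs ! i) \<omega>)" for S
  define e' where "e' S = E (\<lambda>\<omega>. \<Prod>i\<in>S. ((Xs @ [X']) ! i) \<omega>)" for S
  define c :: "nat \<Rightarrow> 'b" where "c n = (-1) ^ (n - 1) * fact (n - 1)" for n
  have ee: "e' S = e S" if "S \<subseteq> {..<?m}" for S
    unfolding e_def e'_def using that
    by (intro arg_cong[where f=E] ext prod.cong) (auto simp: nth_append)
  have ei: "e' (insert ?m S) = E (\<lambda>\<omega>. (\<Prod>i\<in>S. (Xs ! i) \<omega>) * X' \<omega>)" if "S \<subseteq> {..<?m}" for S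
  proof -
    have "finite S" "?m \<notin> S" using that finite_subset by auto
    moreover have "(\<Prod>i\<in>S. ((Xs @ [X']) ! i) \<omega>) = (\<Prod>i\<in>S. (Xs ! i) \<omega>)" for \<omega>
      using that by (intro prod.cong) (auto simp: nth_append)
    ultimately show ?thesis unfolding e'_def by (simp add: mult.commute)
  qed
  have fin: "finite ?I" by (rule finitely_many_partition_on) auto
  have "cumulant E (Xs @ [X']) = (\<Sum>\<pi> | partition_on (insert ?m {..<?m}) \<pi>. c (card \<pi>) * (\<Prod>S\<in>\<pi>. e' S))"
    unfolding cumulant_def c_def e'_def by (simp add: lessThan_Suc)
  also have "\<dots> = (\<Sum>(\<pi>, S)\<in>(SIGMA \<pi> : ?I. insert {} \<pi>).
      c (card (insert (insert ?m S) (\<pi> - {S}))) * (\<Prod>S\<in>insert (insert ?m S) (\<pi> - {S}). e' S))"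
    by (subst sum.reindex_bij_betw[OF bij_betw_partitions_insert, symmetric])
       (auto intro!: sum.cong)
  also have "\<dots> = (\<Sum>\<pi>\<in>?I. \<Sum>S\<in>insert {} \<pi>.
      c (card (insert (insert ?m S) (\<pi> - {S}))) * (\<Prod>S\<in>insert (insert ?m S) (\<pi> - {S}). e' S))"
    by (subst sum.Sigma) (auto simp: fin intro: finite_elements[OF finite_lessThan])
  also have "\<dots> = (\<Sum>\<pi>\<in>?I. c (card \<pi>) * 
      (\<Sum>S\<in>\<pi>. (e' (insert ?m S) - e S * E X') * (\<Prod>S'\<in>\<pi> - {S}. e S')))"
  proof (rule sum.cong[OF refl])
    fix \<pi> assume "\<pi> \<in> ?I"
    then have \<pi>: "partition_on {..<?m} \<pi>" by simp
    have f: "finite \<pi>" by (rule finite_elements[OF finite_lessThan \<pi>])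
    have sub: "S \<subseteq> {..<?m}" if "S \<in> \<pi>" for S by (rule partition_on_block_subset[OF \<pi> that])
    have ne: "\<pi> \<noteq> {}" using partition_onD1[OF \<pi>] assms by auto
    have e0: "{} \<notin> \<pi>" by (rule partition_onD3[OF \<pi>])
    have mm: "insert ?m S \<notin> \<pi>" for S using sub by blast
    obtain n where n: "card \<pi> = Suc n" using f ne by (metis card_gt_0_iff gr0_implies_Suc)
    \<comment> \<open>the term of the new singleton block splits evenly over the blocks of \<open>\<pi>\<close> and gives the subtracted terms\<close>
    have c1: "c (Suc (card \<pi>)) = - of_nat (card \<pi>) * c (card \<pi>)"
      unfolding c_def n by (simp add: algebra_simps)
    have pe: "prod e' (\<pi> - X) = prod e (\<pi> - X)" for X
      by (intro prod.cong refl ee[OF sub]) simp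
    have "(\<Sum>S\<in>insert {} \<pi>. c (card (insert (insert ?m S) (\<pi> - {S}))) * (\<Prod>S\<in>insert (insert ?m S) (\<pi> - {S}). e' S))
       = c (Suc (card \<pi>)) * (E X' * prod e \<pi>) +
         (\<Sum>S\<in>\<pi>. c (card \<pi>) * (e' (insert ?m S) * prod e (\<pi> - {S})))"
    proof -
      have "(\<Sum>S\<in>\<pi>. c (card (insert (insert ?m S) (\<pi> - {S}))) * (\<Prod>S\<in>insert (insert ?m S) (\<pi> - {S}). e' S))
         = (\<Sum>S\<in>\<pi>. c (card \<pi>) * (e' (insert ?m S) * prod e (\<pi> - {S})))"
        using f mm by (intro sum.cong refl) (auto simp: pe n)
      moreover have "c (card (insert (insert ?m {}) (\<pi> - {{}}))) * (\<Prod>S\<in>insert (insert ?m {}) (\<pi> - {{}}). e' S)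
        = c (Suc (card \<pi>)) * (E X' * prod e \<pi>)"
        using f mm[of "{}"] pe[of "{}"] ei[of "{}"] e0 by simp
      ultimately show ?thesis using f e0 by simp
    qed
    also have "(\<Sum>S\<in>\<pi>. c (card \<pi>) * (e' (insert ?m S) * prod e (\<pi> - {S})))
       = c (card \<pi>) * (\<Sum>S\<in>\<pi>. e' (insert ?m S) * prod e (\<pi> - {S}))"
      by (simp add: sum_distrib_left)
    also have "c (Suc (card \<pi>)) * (E X' * prod e \<pi>) = - (c (card \<pi>) * (\<Sum>S\<in>\<pi>. e S * E X' * prod e (\<pi> - {S})))"
    proof -
      have "(\<Sum>S\<in>\<pi>. e S * E X' * prod e (\<pi> - {S})) = (\<Sum>S\<in>\<pi>. E X' * prod e \<pi>)"
        using f by (intro sum.cong refl) (simp add: prod.remove)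
      then show ?thesis unfolding c1 by (simp add: algebra_simps)
    qed
    finally show "(\<Sum>S\<in>insert {} \<pi>. c (card (insert (insert ?m S) (\<pi> - {S}))) * (\<Prod>S\<in>insert (insert ?m S) (\<pi> - {S}). e' S)) =
       c (card \<pi>) * (\<Sum>S\<in>\<pi>. (e' (insert ?m S) - e S * E X') * (\<Prod>S'\<in>\<pi> - {S}. e S'))"
      by (simp add: algebra_simps sum_subtractf)
  qed
  also have "\<dots> = (\<Sum>\<pi>\<in>?I. c (card \<pi>) * 
      (\<Sum>S\<in>\<pi>. (E (\<lambda>\<omega>. (\<Prod>i\<in>S. (Xs ! i) \<omega>) * X' \<omega>) - e S * E X') * (\<Prod>S'\<in>\<pi> - {S}. e S')))"
    by (intro sum.cong refl arg_cong2[where f="(*)"] arg_cong2[where f="(-)"] ei)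
       (auto simp: partition_on_def)
  finally show ?thesis unfolding c_def e_def .
qed

lemma cumulant_pair: "cumulant E [X, X'] = E (\<lambda>\<omega>. X \<omega> * X' \<omega>) - E X * E X'"
proof -
  show ?thesis using cumulant_snoc[of "[X]" E X'] by (simp add: partition_on_length_singleton del: length_Cons list.size)
qed

lemma cumulant_permute:
  assumes "mset Xs = mset Ys"
  shows "cumulant E Xs = cumulant E Ys"
proof -
  obtain p where p: "p permutes {..<length Ys}" "permute_list p Ys = Xs"
    using mset_eq_permutation[OF assms] by blast
  have len: "length Xs = length Ys" using assms by (rule mset_eq_length)
  have injp: "inj p" and surj: "p ` {..<length Ys} = {..<length Ys}"
    using p(1) by (auto simp: permutes_inj permutes_image)
  have ppart: "partition_on {..<length Ys} ((`) q ` \<pi>)" if "partition_on {..<length Ys} \<pi>"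
      and q: "q permutes {..<length Ys}" for \<pi> q
  proof -
    have "(`) q ` \<pi> - {{}} = (`) q ` \<pi>" using that(1) by (auto simp: partition_on_def)
    then show ?thesis using partition_on_inj_image[OF that(1), of q] permutes_inj[OF q] permutes_image[OF q]
      by (auto simp: inj_on_subset)
  qed
  have cancel: "(`) q ` (`) q' ` \<pi> = \<pi>" if "q \<circ> q' = id" for q q' :: "nat \<Rightarrow> nat" and \<pi>
    using that by (auto simp: image_comp image_iff)
  have bij: "bij_betw ((`) ((`) p)) {\<pi>. partition_on {..<length Ys} \<pi>} {\<pi>. partition_on {..<length Ys} \<pi>}"
    by (rule bij_betw_byWitness[where f'="(`) ((`) (inv p))"])
       (use p(1) in \<open>auto intro!: ppart cancel permutes_inv simp: permutes_inv_o\<close>)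
  have "cumulant E Ys = (\<Sum>\<pi> | partition_on {..<length Ys} \<pi>. (-1) ^ (card ((`) p ` \<pi>) - 1) *
      fact (card ((`) p ` \<pi>) - 1) * (\<Prod>S\<in>(`) p ` \<pi>. E (\<lambda>\<omega>. \<Prod>i\<in>S. (Ys ! i) \<omega>)))"
    unfolding cumulant_def by (subst sum.reindex_bij_betw[OF bij, symmetric]) simp
  also have "\<dots> = cumulant E Xs"
    unfolding cumulant_def len
  proof (rule sum.cong[OF refl])
    fix \<pi> assume "\<pi> \<in> {\<pi>. partition_on {..<length Ys} \<pi>}"
    then have sub: "\<And>S. S \<in> \<pi> \<Longrightarrow> S \<subseteq> {..<length Ys}" by (auto simp: partition_on_def)
    have inj: "inj_on ((`) p) \<pi>" using injp by (auto simp: inj_on_def inj_image_eq_iff)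
    have "(\<Prod>S\<in>(`) p ` \<pi>. E (\<lambda>\<omega>. \<Prod>i\<in>S. (Ys ! i) \<omega>)) = (\<Prod>S\<in>\<pi>. E (\<lambda>\<omega>. \<Prod>i\<in>p ` S. (Ys ! i) \<omega>))"
      by (simp add: prod.reindex[OF inj])
    also have "\<dots> = (\<Prod>S\<in>\<pi>. E (\<lambda>\<omega>. \<Prod>i\<in>S. (Xs ! i) \<omega>))"
    proof (rule prod.cong[OF refl], rule arg_cong[where f=E], rule ext)
      fix S \<omega> assume "S \<in> \<pi>"
      then have "\<And>i. i \<in> S \<Longrightarrow> Ys ! p i = Xs ! i"
        using sub[OF \<open>S \<in> \<pi>\<close>] p(2)[symmetric] permute_list_nth[OF p(1)] by auto
      then show "(\<Prod>i\<in>p ` S. (Ys ! i) \<omega>) = (\<Prod>i\<in>S. (Xs ! i) \<omega>)"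
        using injp by (subst prod.reindex) (auto simp: inj_on_def)
    qed
    finally show "(-1) ^ (card ((`) p ` \<pi>) - 1) * fact (card ((`) p ` \<pi>) - 1) *
         (\<Prod>S\<in>(`) p ` \<pi>. E (\<lambda>\<omega>. \<Prod>i\<in>S. (Ys ! i) \<omega>)) =
         (-1) ^ (card \<pi> - 1) * fact (card \<pi> - 1) * (\<Prod>S\<in>\<pi>. E (\<lambda>\<omega>. \<Prod>i\<in>S. (Xs ! i) \<omega>))"
      by (simp add: card_image[OF inj])
  qed
  finally show ?thesis ..
qed

text \<open>
  After multiplying out, each term of the recursion contains exactly one expectation that involves
  the last variable.
\<close>
lemma cumulant_linear_last:
  fixes E :: "('a \<Rightarrow> real) \<Rightarrow> 'b::field_char_0"
  assumes "Xs \<noteq> []" "finite I"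
    and lin: "\<And>g. E (\<lambda>\<omega>. g \<omega> * (\<Sum>i\<in>I. \<Psi> i \<omega>)) = (\<Sum>i\<in>I. E (\<lambda>\<omega>. g \<omega> * \<Psi> i \<omega>))"
  shows "cumulant E (Xs @ [\<lambda>\<omega>. \<Sum>i\<in>I. \<Psi> i \<omega>]) = (\<Sum>i\<in>I. cumulant E (Xs @ [\<Psi> i]))"
proof -
  have l1: "E (\<lambda>\<omega>. (\<Sum>i\<in>I. \<Psi> i \<omega>)) = (\<Sum>i\<in>I. E (\<Psi> i))"
    using lin[of "\<lambda>_. 1"] by simp
  have s1: "(\<Sum>i\<in>I. a i * b) = (\<Sum>i\<in>I. a i) * b" for a and b :: 'b by (simp add: sum_distrib_right)
  have s2: "(\<Sum>i\<in>I. b * a i) = b * (\<Sum>i\<in>I. a i)" for a and b :: 'b by (simp add: sum_distrib_left)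
  show ?thesis
    unfolding cumulant_snoc[OF assms(1)] l1 lin
    by (subst sum.swap, intro sum.cong refl, subst s2, intro arg_cong2[where f="(*)"] refl,
        subst sum.swap, intro sum.cong refl) (simp add: s1 s2 sum_subtractf)
qed

section \<open>Weighted sums over spin configurations\<close>

text \<open>
  A configuration is encoded by the set of its minus spins, on the whole lattice. In this way
  configurations of different volumes are objects of the same kind, and enlarging a volume, flipping
  spins and translating are operations on sets.
\<close>
definition spins :: "'v set \<Rightarrow> 'v \<Rightarrow> real" where
  "spins D t = (if t \<in> D then -1 else 1)"

definition spin_prod :: "'v set \<Rightarrow> ('v \<Rightarrow> real) \<Rightarrow> real" where
  "spin_prod T \<sigma> = (\<Prod>t\<in>T. \<sigma> t)"

text \<open>
  The unnormalised expectation of \<open>f\<close> for free boundary conditions in \<open>\<Lambda>\<close>, with a complex energy \<open>h\<close>.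
\<close>
definition wsum :: "'v set \<Rightarrow> (('v \<Rightarrow> real) \<Rightarrow> complex) \<Rightarrow> (('v \<Rightarrow> real) \<Rightarrow> real) \<Rightarrow> complex" where
  "wsum \<Lambda> h f = (\<Sum>D\<in>Pow \<Lambda>. of_real (f (spins D)) * exp (h (spins D)))"

definition gibbs_ex :: "'v set \<Rightarrow> (('v \<Rightarrow> real) \<Rightarrow> complex) \<Rightarrow> (('v \<Rightarrow> real) \<Rightarrow> real) \<Rightarrow> complex" where
  "gibbs_ex \<Lambda> h f = wsum \<Lambda> h f / wsum \<Lambda> h (\<lambda>_. 1)"

lemma wsum_deriv:
  "((\<lambda>s. wsum \<Lambda> (\<lambda>\<sigma>. h \<sigma> + s * of_real (\<Psi> \<sigma>)) f) has_field_derivative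
     wsum \<Lambda> (\<lambda>\<sigma>. h \<sigma> + s * of_real (\<Psi> \<sigma>)) (\<lambda>\<sigma>. f \<sigma> * \<Psi> \<sigma>)) (at s)"
  unfolding wsum_def by (auto intro!: derivative_eq_intros sum.cong)

lemma gibbs_ex_deriv:
  assumes "wsum \<Lambda> (\<lambda>\<sigma>. h \<sigma> + s * of_real (\<Psi> \<sigma>)) (\<lambda>_. 1) \<noteq> 0"
  shows "((\<lambda>s. gibbs_ex \<Lambda> (\<lambda>\<sigma>. h \<sigma> + s * of_real (\<Psi> \<sigma>)) f) has_field_derivative
     gibbs_ex \<Lambda> (\<lambda>\<sigma>. h \<sigma> + s * of_real (\<Psi> \<sigma>)) (\<lambda>\<sigma>. f \<sigma> * \<Psi> \<sigma>)
     - gibbs_ex \<Lambda> (\<lambda>\<sigma>. h \<sigma> + s * of_real (\<Psi> \<sigma>)) f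
       * gibbs_ex \<Lambda> (\<lambda>\<sigma>. h \<sigma> + s * of_real (\<Psi> \<sigma>)) \<Psi>) (at s)"
  using DERIV_divide[OF wsum_deriv[of \<Lambda> h \<Psi> f s] wsum_deriv[of \<Lambda> h \<Psi> "\<lambda>_. 1" s] assms] assms
  unfolding gibbs_ex_def by (simp add: diff_divide_distrib)

text \<open>
  For one variable the derivative of the expectation is a covariance; the general case is the product
  rule, matched term by term with the recursion for cumulants.
\<close>
lemma cumulant_gibbs_deriv:
  assumes "Xs \<noteq> []" and nz: "wsum \<Lambda> (\<lambda>\<sigma>. h \<sigma> + s * of_real (\<Psi> \<sigma>)) (\<lambda>_. 1) \<noteq> 0"
  shows "((\<lambda>s. cumulant (gibbs_ex \<Lambda> (\<lambda>\<sigma>. h \<sigma> + s * of_real (\<Psi> \<sigma>))) Xs) has_field_derivative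
     cumulant (gibbs_ex \<Lambda> (\<lambda>\<sigma>. h \<sigma> + s * of_real (\<Psi> \<sigma>))) (Xs @ [\<Psi>])) (at s)"
  unfolding cumulant_snoc[OF assms(1)] unfolding cumulant_def
  by (intro DERIV_sum DERIV_cmult has_field_derivative_prod gibbs_ex_deriv nz)

lemma gibbs_ex_linear:
  "finite I \<Longrightarrow> gibbs_ex \<Lambda> h (\<lambda>\<sigma>. g \<sigma> * (\<Sum>i\<in>I. \<Psi> i \<sigma>)) = (\<Sum>i\<in>I. gibbs_ex \<Lambda> h (\<lambda>\<sigma>. g \<sigma> * \<Psi> i \<sigma>))"
  unfolding gibbs_ex_def wsum_def
  by (simp add: sum_distrib_left sum_distrib_right flip: sum_divide_distrib) (subst sum.swap, simp)

text \<open>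
  Iterating the derivative and expanding the appended interaction by linearity in the last variable
  gives one cumulant for each sequence of bonds.
\<close>
lemma cumulant_gibbs_higher_deriv:
  assumes Xs: "Xs \<noteq> []" and B: "finite B" and S: "open S" "z \<in> S"
    and nz: "\<And>z. z \<in> S \<Longrightarrow> wsum \<Lambda> (\<lambda>\<sigma>. z * of_real (\<Sum>A\<in>B. \<Psi> A \<sigma>)) (\<lambda>_. 1) \<noteq> 0"
  shows "(deriv ^^ n) (\<lambda>z. cumulant (gibbs_ex \<Lambda> (\<lambda>\<sigma>. z * of_real (\<Sum>A\<in>B. \<Psi> A \<sigma>))) Xs) z =
     (\<Sum>As | set As \<subseteq> B \<and> length As = n.
        cumulant (gibbs_ex \<Lambda> (\<lambda>\<sigma>. z * of_real (\<Sum>A\<in>B. \<Psi> A \<sigma>))) (Xs @ map \<Psi> As))"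
  using S(2)
proof (induction n arbitrary: z)
  case 0
  have "{As. set As \<subseteq> B \<and> As = []} = {[]}" by auto
  then show ?case by simp
next
  case (Suc n)
  let ?K = "\<lambda>z Xs. cumulant (gibbs_ex \<Lambda> (\<lambda>\<sigma>. z * of_real (\<Sum>A\<in>B. \<Psi> A \<sigma>))) Xs"
  let ?F = "\<lambda>z. \<Sum>As | set As \<subseteq> B \<and> length As = n. ?K z (Xs @ map \<Psi> As)"
  have step: "((\<lambda>z. ?K z Ys) has_field_derivative (\<Sum>A\<in>B. ?K z (Ys @ [\<Psi> A]))) (at z)" if "Ys \<noteq> []" for Ys
    using cumulant_gibbs_deriv[OF that, of \<Lambda> "\<lambda>_. 0" z "\<lambda>\<sigma>. \<Sum>A\<in>B. \<Psi> A \<sigma>"] nz[OF Suc.prems]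
    by (simp add: cumulant_linear_last[OF that B gibbs_ex_linear[OF B]])
  have "(?F has_field_derivative (\<Sum>As | set As \<subseteq> B \<and> length As = n. \<Sum>A\<in>B. ?K z ((Xs @ map \<Psi> As) @ [\<Psi> A]))) (at z)"
    by (intro DERIV_sum step) (use Xs in simp)
  then have "((deriv ^^ n) (\<lambda>z. ?K z Xs) has_field_derivative
      (\<Sum>As | set As \<subseteq> B \<and> length As = n. \<Sum>A\<in>B. ?K z ((Xs @ map \<Psi> As) @ [\<Psi> A]))) (at z)"
    by (rule has_field_derivative_transform_within_open[OF _ S(1) Suc.prems]) (simp only: Suc.IH)
  then have "(deriv ^^ Suc n) (\<lambda>z. ?K z Xs) z =
      (\<Sum>As | set As \<subseteq> B \<and> length As = n. \<Sum>A\<in>B. ?K z ((Xs @ map \<Psi> As) @ [\<Psi> A]))"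
    by (simp add: DERIV_imp_deriv)
  also have "\<dots> = (\<Sum>(As, A)\<in>{As. set As \<subseteq> B \<and> length As = n} \<times> B. ?K z (Xs @ map \<Psi> (As @ [A])))"
    by (subst sum.cartesian_product) simp
  also have "\<dots> = (\<Sum>As | set As \<subseteq> B \<and> length As = Suc n. ?K z (Xs @ map \<Psi> As))"
    by (rule sum.reindex_bij_witness[where i = "\<lambda>As. (butlast As, last As)" and j = "\<lambda>(As, A). As @ [A]"])
       (auto dest: in_set_butlastD simp: subset_iff length_Suc_conv_rev)
  finally show ?case .
qed

section \<open>Symmetries and independence\<close>

lemma wsum_reindex:
  assumes "bij_betw \<phi> (Pow \<Lambda>) (Pow \<Lambda>')" "\<And>D. D \<subseteq> \<Lambda> \<Longrightarrow> spins (\<phi> D) = m (spins D)"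
  shows "wsum \<Lambda>' h f = wsum \<Lambda> (\<lambda>\<sigma>. h (m \<sigma>)) (\<lambda>\<sigma>. f (m \<sigma>))"
  unfolding wsum_def by (subst sum.reindex_bij_betw[OF assms(1), symmetric]) (auto simp: assms(2))

lemma wsum_flip:
  assumes "W \<subseteq> \<Lambda>"
  shows "wsum \<Lambda> h f = wsum \<Lambda> (\<lambda>\<sigma>. h (\<lambda>t. spins W t * \<sigma> t)) (\<lambda>\<sigma>. f (\<lambda>t. spins W t * \<sigma> t))"
  by (rule wsum_reindex[where \<phi> = "sym_diff W"])
     (use assms in \<open>auto intro!: bij_betw_byWitness[where f' = "sym_diff W"] simp: spins_def fun_eq_iff\<close>)

lemma wsum_image:
  assumes "bij \<phi>"
  shows "wsum (\<phi> ` \<Lambda>) h f = wsum \<Lambda> (\<lambda>\<sigma>. h (\<lambda>t. \<sigma> (inv \<phi> t))) (\<lambda>\<sigma>. f (\<lambda>t. \<sigma> (inv \<phi> t)))"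
proof (rule wsum_reindex[where \<phi> = "(`) \<phi>"])
  show "bij_betw ((`) \<phi>) (Pow \<Lambda>) (Pow (\<phi> ` \<Lambda>))"
    by (rule bij_betw_Pow) (use assms in \<open>auto simp: bij_def bij_betw_def inj_on_def\<close>)
  show "spins (\<phi> ` D) = (\<lambda>t. spins D (inv \<phi> t))" for D
  proof -
    have "t \<in> \<phi> ` D \<longleftrightarrow> inv \<phi> t \<in> D" for t
      using bij_inv_eq_iff[OF assms] by (metis image_iff)
    then show ?thesis by (simp add: spins_def fun_eq_iff)
  qed
qed

lemma spin_prod_mult: "spin_prod T (\<lambda>t. a t * b t) = spin_prod T a * spin_prod T b"
  by (simp add: spin_prod_def prod.distrib)

lemma spin_prod_spins:
  assumes "finite T" shows "spin_prod T (spins D) = (-1) ^ card (T \<inter> D)"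
  unfolding spin_prod_def spins_def using assms
  by (subst prod.If_cases) (auto simp: Int_def)

lemma spin_prod_shift:
  assumes "bij \<phi>" shows "spin_prod T (\<lambda>t. \<sigma> (inv \<phi> t)) = spin_prod (\<phi> -` T) \<sigma>"
  unfolding spin_prod_def
  by (rule prod.reindex_bij_witness[where i = \<phi> and j = "inv \<phi>"])
     (use assms in \<open>auto simp: bij_is_inj bij_is_surj surj_f_inv_f inv_f_f\<close>)

definition depends_on :: "'v set \<Rightarrow> (('v \<Rightarrow> real) \<Rightarrow> 'c) \<Rightarrow> bool" where
  "depends_on W f \<longleftrightarrow> (\<forall>\<sigma> \<sigma>'. (\<forall>t\<in>W. \<sigma> t = \<sigma>' t) \<longrightarrow> f \<sigma> = f \<sigma>')"

lemma depends_on_spin_prod: "T \<subseteq> W \<Longrightarrow> depends_on W (spin_prod T)"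
  by (auto simp: depends_on_def spin_prod_def intro!: prod.cong)

lemma depends_on_const: "depends_on W (\<lambda>_. c)"
  by (simp add: depends_on_def)

text \<open>
  Subsets of a disjoint union are pairs of subsets.
\<close>
lemma wsum_factor:
  assumes "W \<inter> W' = {}" "depends_on W f" "depends_on W h" "depends_on W' f'" "depends_on W' h'"
  shows "wsum (W \<union> W') (\<lambda>\<sigma>. h \<sigma> + h' \<sigma>) (\<lambda>\<sigma>. f \<sigma> * f' \<sigma>) = wsum W h f * wsum W' h' f'"
proof -
  have s1: "g (spins (D \<union> D')) = g (spins D)" if "depends_on W g" "D \<subseteq> W" "D' \<subseteq> W'" 
    for g :: "('a \<Rightarrow> real) \<Rightarrow> 'd" and D D'
    using that assms(1) unfolding depends_on_def by (elim allE impE) (auto simp: spins_def)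
  have s2: "g (spins (D \<union> D')) = g (spins D')" if "depends_on W' g" "D \<subseteq> W" "D' \<subseteq> W'" 
    for g :: "('a \<Rightarrow> real) \<Rightarrow> 'd" and D D'
    using that assms(1) unfolding depends_on_def by (elim allE impE) (auto simp: spins_def)
  let ?F = "\<lambda>D. of_real (f (spins D) * f' (spins D)) * exp (h (spins D) + h' (spins D))"
  have bij: "bij_betw (\<lambda>(D, D'). D \<union> D') (Pow W \<times> Pow W') (Pow (W \<union> W'))"
    by (rule bij_betw_byWitness[where f' = "\<lambda>D. (D \<inter> W, D \<inter> W')"]) (use assms(1) in auto)
  have "wsum (W \<union> W') (\<lambda>\<sigma>. h \<sigma> + h' \<sigma>) (\<lambda>\<sigma>. f \<sigma> * f' \<sigma>) = (\<Sum>(D, D')\<in>Pow W \<times> Pow W'. ?F (D \<union> D'))"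
    unfolding wsum_def by (subst sum.reindex_bij_betw[OF bij, symmetric]) (simp add: case_prod_beta)
  also have "\<dots> = (\<Sum>(D, D')\<in>Pow W \<times> Pow W'. (of_real (f (spins D)) * exp (h (spins D)))
       * (of_real (f' (spins D')) * exp (h' (spins D'))))"
    by (intro sum.cong) (auto simp: s1[OF assms(2)] s1[OF assms(3)] s2[OF assms(4)] s2[OF assms(5)] exp_add)
  also have "\<dots> = wsum W h f * wsum W' h' f'"
    unfolding wsum_def sum_product by (simp add: sum.cartesian_product)
  finally show ?thesis .
qed

text \<open>
  Spins that interact neither with \<open>W\<close> nor with the observable cancel from the quotient. With \<open>h = h' = 0\<close> this
  says that an expectation at coupling zero does not depend on the volume.
\<close>
lemma gibbs_ex_restrict:
  assumes "W \<subseteq> \<Lambda>" "depends_on W f" "depends_on W h" "depends_on (\<Lambda> - W) h'"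
    and "wsum (\<Lambda> - W) h' (\<lambda>_. 1) \<noteq> 0"
  shows "gibbs_ex \<Lambda> (\<lambda>\<sigma>. h \<sigma> + h' \<sigma>) f = gibbs_ex W h f"
proof -
  have \<Lambda>: "W \<union> (\<Lambda> - W) = \<Lambda>" "W \<inter> (\<Lambda> - W) = {}" using assms(1) by auto
  have *: "wsum \<Lambda> (\<lambda>\<sigma>. h \<sigma> + h' \<sigma>) g = wsum W h g * wsum (\<Lambda> - W) h' (\<lambda>_. 1)" if "depends_on W g" for g
    using wsum_factor[OF \<Lambda>(2) that assms(3) depends_on_const[of _ 1] assms(4)] unfolding \<Lambda>(1) by simp
  show ?thesis unfolding gibbs_ex_def *[OF assms(2)] *[OF depends_on_const] using assms(5) by simp
qed

section \<open>Vanishing of cumulants\<close>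

text \<open>
  Each bond has its own real coupling \<open>w A\<close>, so that cumulants containing several bonds can be reached
  by differentiating in one coupling after another.
\<close>
definition energy :: "'v set set \<Rightarrow> ('v set \<Rightarrow> real) \<Rightarrow> ('v \<Rightarrow> real) \<Rightarrow> complex" where
  "energy E w \<sigma> = of_real (\<Sum>A\<in>E. w A * spin_prod A \<sigma>)"

lemma wsum_real_nonzero:
  assumes "finite \<Lambda>" shows "wsum \<Lambda> (\<lambda>\<sigma>. of_real (g \<sigma>)) (\<lambda>_. 1) \<noteq> 0"
proof -
  have "wsum \<Lambda> (\<lambda>\<sigma>. of_real (g \<sigma>)) (\<lambda>_. 1) = of_real (\<Sum>D\<in>Pow \<Lambda>. exp (g (spins D)))"
    unfolding wsum_def by (simp add: exp_of_real)
  moreover have "(\<Sum>D\<in>Pow \<Lambda>. exp (g (spins D))) > 0"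
    by (rule sum_pos) (use assms in auto)
  ultimately show ?thesis by (metis of_real_eq_0_iff less_irrefl)
qed

lemma wsum_energy_nonzero: "finite \<Lambda> \<Longrightarrow> wsum \<Lambda> (energy E w) (\<lambda>_. 1) \<noteq> 0"
  unfolding energy_def by (rule wsum_real_nonzero)

text \<open>
  The differentiation rule read from right to left. A statement about plain expectations that
  holds for all couplings \<open>w\<close> carries over to cumulants with any number of further bonds, by induction
  on their number. The lemmas \<open>cumulant_energy_cong\<close>, \<open>cumulant_odd\<close> and
  \<open>cumulant_cluster\<close> are instances of this principle.
\<close>
lemma cumulant_energy_snoc:
  assumes "finite \<Lambda>" "finite E" "A \<in> E" "Xs \<noteq> []"
  shows "cumulant (gibbs_ex \<Lambda> (energy E w)) (Xs @ [spin_prod A]) =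
    vector_derivative (\<lambda>s. cumulant (gibbs_ex \<Lambda> (energy E (w(A := w A + s)))) Xs) (at 0)"
proof -
  have e: "energy E (w(A := w A + s)) = (\<lambda>\<sigma>. energy E w \<sigma> + of_real s * of_real (spin_prod A \<sigma>))" for s
  proof
    fix \<sigma>
    have "(\<Sum>B\<in>E - {A}. (w(A := w A + s)) B * spin_prod B \<sigma>) = (\<Sum>B\<in>E - {A}. w B * spin_prod B \<sigma>)"
      by (intro sum.cong) auto
    then show "energy E (w(A := w A + s)) \<sigma> = energy E w \<sigma> + of_real s * of_real (spin_prod A \<sigma>)"
      unfolding energy_def using assms(2,3) by (simp add: sum.remove algebra_simps)
  qed
  have "((\<lambda>s. cumulant (gibbs_ex \<Lambda> (\<lambda>\<sigma>. energy E w \<sigma> + s * of_real (spin_prod A \<sigma>))) Xs) has_field_derivative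
     cumulant (gibbs_ex \<Lambda> (energy E w)) (Xs @ [spin_prod A])) (at (of_real 0))"
    using cumulant_gibbs_deriv[OF assms(4), of \<Lambda> "energy E w" 0 "spin_prod A"]
      wsum_energy_nonzero[OF assms(1), of E w] by simp
  \<comment> \<open>the couplings are real, so the complex derivative is restricted to the real line\<close>
  from has_vector_derivative_real_field[OF this]
  show ?thesis unfolding e by (rule vector_derivative_at[symmetric])
qed

lemma cumulant_energy_cong:
  assumes fin: "finite \<Lambda>" "finite E" and ne: "Xs \<noteq> []" "Ys \<noteq> []"
    and eq: "\<And>w. cumulant (gibbs_ex \<Lambda> (energy E w)) Xs = cumulant (gibbs_ex \<Lambda> (energy E w)) Ys"
    and As: "set As \<subseteq> E"
  shows "cumulant (gibbs_ex \<Lambda> (energy E w)) (Xs @ map spin_prod As) =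
    cumulant (gibbs_ex \<Lambda> (energy E w)) (Ys @ map spin_prod As)"
  using As
proof (induction As arbitrary: w rule: rev_induct)
  case (snoc A As)
  then show ?case
    using cumulant_energy_snoc[OF fin, of A "Xs @ map spin_prod As" w]
      cumulant_energy_snoc[OF fin, of A "Ys @ map spin_prod As" w] ne
    by (simp del: fun_upd_apply)
qed (use eq in simp)

text \<open>
  Flipping all spins in \<open>W\<close> preserves the energy and changes the sign of the observable.
\<close>
lemma wsum_odd:
  assumes "finite T" "W \<subseteq> \<Lambda>" "odd (card (T \<inter> W))"
    and h: "\<And>\<sigma>. h (\<lambda>t. spins W t * \<sigma> t) = h \<sigma>"
  shows "wsum \<Lambda> h (spin_prod T) = 0"
proof -
  have "spin_prod T (\<lambda>t. spins W t * \<sigma> t) = - spin_prod T \<sigma>" for \<sigma>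
    using assms(1,3) by (simp add: spin_prod_mult spin_prod_spins)
  then have "wsum \<Lambda> h (spin_prod T) = wsum \<Lambda> h (\<lambda>\<sigma>. - spin_prod T \<sigma>)"
    by (subst wsum_flip[OF assms(2)]) (simp add: h)
  also have "\<dots> = - wsum \<Lambda> h (spin_prod T)"
    unfolding wsum_def by (simp add: sum_negf)
  finally show ?thesis by simp
qed

lemma gibbs_ex_odd:
  assumes "finite T" "W \<subseteq> \<Lambda>" "odd (card (T \<inter> W))"
    and E: "\<And>A. A \<in> E \<Longrightarrow> finite A \<and> even (card (A \<inter> W))"
  shows "gibbs_ex \<Lambda> (energy E w) (spin_prod T) = 0"
proof -
  have "energy E w (\<lambda>t. spins W t * \<sigma> t) = energy E w \<sigma>" for \<sigma>
    unfolding energy_def using E by (auto intro!: sum.cong simp: spin_prod_mult spin_prod_spins)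
  from wsum_odd[OF assms(1-3), of "energy E w", OF this] show ?thesis unfolding gibbs_ex_def by simp
qed

lemma cumulant_odd:
  assumes "finite \<Lambda>" "finite E" "finite T" "W \<subseteq> \<Lambda>" "odd (card (T \<inter> W))"
    and E: "\<And>A. A \<in> E \<Longrightarrow> finite A \<and> even (card (A \<inter> W))" and As: "set As \<subseteq> E"
  shows "cumulant (gibbs_ex \<Lambda> (energy E w)) (spin_prod T # map spin_prod As) = 0"
  using As
proof (induction As arbitrary: w rule: rev_induct)
  case Nil
  then show ?case using gibbs_ex_odd[OF assms(3-6)] by (simp add: cumulant_singleton)
next
  case (snoc A As)
  then show ?case
    using cumulant_energy_snoc[OF assms(1,2), of A "spin_prod T # map spin_prod As" w]
    by (simp del: fun_upd_apply)
qed

lemma gibbs_ex_cluster: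
  assumes "finite \<Lambda>" "finite E" "T \<subseteq> W" "W \<subseteq> \<Lambda>"
    and E: "\<And>A. A \<in> E \<Longrightarrow> A \<subseteq> \<Lambda> \<and> (A \<subseteq> W \<or> A \<inter> W = {})"
    and w: "\<And>A. A \<in> E \<Longrightarrow> A \<inter> W \<noteq> {} \<Longrightarrow> w A = w' A"
  shows "gibbs_ex \<Lambda> (energy E w) (spin_prod T) = gibbs_ex \<Lambda> (energy E w') (spin_prod T)"
proof -
  let ?EW = "{A \<in> E. A \<inter> W \<noteq> {}}"
  have *: "gibbs_ex \<Lambda> (energy E u) (spin_prod T) = gibbs_ex W (energy ?EW u) (spin_prod T)" for u
  proof -
    have split: "energy E u = (\<lambda>\<sigma>. energy ?EW u \<sigma> + energy (E - ?EW) u \<sigma>)"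
      unfolding energy_def of_real_add[symmetric]
      by (subst sum.subset_diff[of ?EW E]) (use assms(2) in \<open>auto simp: add.commute\<close>)
    have "depends_on W (energy ?EW u)"
      unfolding depends_on_def
    proof (intro allI impI)
      fix \<sigma> \<sigma>' :: "'a \<Rightarrow> real" assume *: "\<forall>t\<in>W. \<sigma> t = \<sigma>' t"
      have "spin_prod A \<sigma> = spin_prod A \<sigma>'" if "A \<in> ?EW" for A
        using that E[of A] * unfolding spin_prod_def by (intro prod.cong) auto
      then show "energy ?EW u \<sigma> = energy ?EW u \<sigma>'"
        unfolding energy_def by simp
    qed
    moreover have "depends_on (\<Lambda> - W) (energy (E - ?EW) u)"
      unfolding depends_on_def
    proof (intro allI impI)
      fix \<sigma> \<sigma>' :: "'a \<Rightarrow> real" assume *: "\<forall>t\<in>\<Lambda> - W. \<sigma> t = \<sigma>' t"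
      have "spin_prod A \<sigma> = spin_prod A \<sigma>'" if "A \<in> E - ?EW" for A
        using that E[of A] * unfolding spin_prod_def by (intro prod.cong) auto
      then show "energy (E - ?EW) u \<sigma> = energy (E - ?EW) u \<sigma>'"
        unfolding energy_def by simp
    qed
    moreover have "wsum (\<Lambda> - W) (energy (E - ?EW) u) (\<lambda>_. 1) \<noteq> 0"
      by (rule wsum_energy_nonzero) (use assms(1) in simp)
    ultimately show ?thesis unfolding split
      by (intro gibbs_ex_restrict assms depends_on_spin_prod)
  qed
  have "energy ?EW w = energy ?EW w'"
    unfolding energy_def fun_eq_iff using w by (auto intro!: sum.cong)
  then show ?thesis unfolding * by simp
qed

text \<open>
  Bonds outside \<open>W\<close> are independent of the observable, so their couplings do not matter.
\<close>
lemma cumulant_cluster: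
  assumes "finite \<Lambda>" "finite E" "T \<subseteq> W" "W \<subseteq> \<Lambda>"
    and E: "\<And>A. A \<in> E \<Longrightarrow> A \<subseteq> \<Lambda> \<and> (A \<subseteq> W \<or> A \<inter> W = {})"
    and w: "\<And>A. A \<in> E \<Longrightarrow> A \<inter> W \<noteq> {} \<Longrightarrow> w A = w' A" and As: "set As \<subseteq> E"
  shows "cumulant (gibbs_ex \<Lambda> (energy E w)) (spin_prod T # map spin_prod As) =
    cumulant (gibbs_ex \<Lambda> (energy E w')) (spin_prod T # map spin_prod As)"
  using As w
proof (induction As arbitrary: w w' rule: rev_induct)
  case Nil
  have "gibbs_ex \<Lambda> (energy E w) (spin_prod T) = gibbs_ex \<Lambda> (energy E w') (spin_prod T)"
    by (rule gibbs_ex_cluster[OF assms(1-5) Nil(2)])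
  then show ?case by (simp add: cumulant_singleton)
next
  case (snoc A As)
  have "cumulant (gibbs_ex \<Lambda> (energy E (w(A := w A + s)))) (spin_prod T # map spin_prod As) =
    cumulant (gibbs_ex \<Lambda> (energy E (w'(A := w' A + s)))) (spin_prod T # map spin_prod As)" for s
  proof (rule snoc.IH)
    show "set As \<subseteq> E" using snoc.prems(1) by simp
    show "(w(A := w A + s)) B = (w'(A := w' A + s)) B" if "B \<in> E" "B \<inter> W \<noteq> {}" for B
      using snoc.prems(2)[OF that] by (cases "B = A") simp_all
  qed
  then show ?case
    using cumulant_energy_snoc[OF assms(1,2), of A "spin_prod T # map spin_prod As"] snoc.prems(1)
    by (simp del: fun_upd_apply)
qed

text \<open>
  A bond outside \<open>W\<close> enters as the derivative of a function that is constant in its coupling.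
\<close>
lemma cumulant_outside_cluster:
  assumes "finite \<Lambda>" "finite E" "T \<subseteq> W" "W \<subseteq> \<Lambda>"
    and E: "\<And>A. A \<in> E \<Longrightarrow> A \<subseteq> \<Lambda> \<and> (A \<subseteq> W \<or> A \<inter> W = {})"
    and As: "set As \<subseteq> E" "A \<in> set As" "A \<inter> W = {}"
  shows "cumulant (gibbs_ex \<Lambda> (energy E w)) (spin_prod T # map spin_prod As) = 0"
  using As(1,2)
proof (induction As arbitrary: w rule: rev_induct)
  case (snoc A' As)
  have "\<exists>c. \<forall>s. cumulant (gibbs_ex \<Lambda> (energy E (w(A' := w A' + s)))) (spin_prod T # map spin_prod As) = c"
  proof (cases "A' = A")
    case True
    have "cumulant (gibbs_ex \<Lambda> (energy E (w(A' := w A' + s)))) (spin_prod T # map spin_prod As) =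
      cumulant (gibbs_ex \<Lambda> (energy E w)) (spin_prod T # map spin_prod As)" for s
      by (rule cumulant_cluster[OF assms(1-5)]) (use snoc.prems True As(3) in auto)
    then show ?thesis by blast
  next
    case False
    then have "A \<in> set As" "set As \<subseteq> E" using snoc.prems by auto
    then show ?thesis using snoc.IH by blast
  qed
  then obtain c where c: "\<And>s. cumulant (gibbs_ex \<Lambda> (energy E (w(A' := w A' + s)))) (spin_prod T # map spin_prod As) = c"
    by blast
  show ?case
    using cumulant_energy_snoc[OF assms(1,2), of A' "spin_prod T # map spin_prod As" w] snoc.prems(1)
    by (simp add: c del: fun_upd_apply)
qed simp

section \<open>A zero-free disc for the partition function\<close>

lemma spin_prod_sym_diff:
  assumes "finite U" "finite A"
  shows "spin_prod U (spins D) * spin_prod A (spins D) = spin_prod (sym_diff U A) (spins D)"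
proof -
  have U: "spin_prod U (spins D) = spin_prod (U \<inter> A) (spins D) * spin_prod (U - A) (spins D)"
    unfolding spin_prod_def by (rule prod.Int_Diff[OF assms(1)])
  have A: "spin_prod A (spins D) = spin_prod (U \<inter> A) (spins D) * spin_prod (A - U) (spins D)"
    unfolding spin_prod_def using prod.Int_Diff[OF assms(2), of _ U] by (simp add: Int_commute)
  have S: "spin_prod (sym_diff U A) (spins D) = spin_prod (U - A) (spins D) * spin_prod (A - U) (spins D)"
    unfolding spin_prod_def by (rule prod.union_disjoint) (use assms in auto)
  have "spin_prod (U \<inter> A) (spins D) * spin_prod (U \<inter> A) (spins D) = 1"
    unfolding spin_prod_def spins_def prod.distrib[symmetric] by (rule prod.neutral) simp
  then show ?thesis unfolding U A S by (metis mult.assoc mult.left_commute mult_1)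
qed

text \<open>
  A version of \<open>wsum\<close> for complex observables, needed because Boltzmann factors at a complex
  coupling are split off as observables.
\<close>
definition csum :: "'v set \<Rightarrow> complex \<Rightarrow> 'v set set \<Rightarrow> (('v \<Rightarrow> real) \<Rightarrow> complex) \<Rightarrow> complex" where
  "csum \<Lambda> z E g = (\<Sum>D\<in>Pow \<Lambda>. g (spins D) * exp (z * of_real (\<Sum>A\<in>E. spin_prod A (spins D))))"

lemma csum_of_real: "csum \<Lambda> z E (\<lambda>\<sigma>. of_real (f \<sigma>)) = wsum \<Lambda> (\<lambda>\<sigma>. z * of_real (\<Sum>A\<in>E. spin_prod A \<sigma>)) f"
  by (simp add: csum_def wsum_def)

lemma csum_add: "csum \<Lambda> z E (\<lambda>\<sigma>. f \<sigma> + g \<sigma>) = csum \<Lambda> z E f + csum \<Lambda> z E g"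
  by (simp add: csum_def algebra_simps sum.distrib)

lemma csum_cmult: "csum \<Lambda> z E (\<lambda>\<sigma>. c * f \<sigma>) = c * csum \<Lambda> z E f"
  by (simp add: csum_def algebra_simps sum_distrib_left)

lemma csum_cong: "(\<And>D. D \<subseteq> \<Lambda> \<Longrightarrow> f (spins D) = g (spins D)) \<Longrightarrow> csum \<Lambda> z E f = csum \<Lambda> z E g"
  by (simp add: csum_def)

lemma csum_split:
  assumes "finite E" "S \<subseteq> E"
  shows "csum \<Lambda> z E g = csum \<Lambda> z (E - S) (\<lambda>\<sigma>. g \<sigma> * (\<Prod>A\<in>S. exp (z * of_real (spin_prod A \<sigma>))))"
proof -
  have "finite S" using assms finite_subset by auto
  then have "exp (z * of_real (\<Sum>A\<in>E. spin_prod A \<sigma>)) =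
      (\<Prod>A\<in>S. exp (z * of_real (spin_prod A \<sigma>))) * exp (z * of_real (\<Sum>A\<in>E - S. spin_prod A \<sigma>))" for \<sigma>
    by (subst sum.subset_diff[OF assms(2,1)])
       (simp add: exp_add distrib_left sum_distrib_left exp_sum)
  then show ?thesis by (simp add: csum_def mult.assoc)
qed

text \<open>
  \<open>spin_prod A\<close> takes only the values \<open>1\<close> and \<open>-1\<close>, on which the exponential is \<open>cosh z \<plusminus> sinh z\<close>.
\<close>
lemma exp_spin_prod:
  fixes z :: complex
  assumes "finite A"
  shows "exp (z * of_real (spin_prod A (spins D))) = 1 + ((cosh z - 1) + sinh z * of_real (spin_prod A (spins D)))"
proof -
  have "spin_prod A (spins D) = 1 \<or> spin_prod A (spins D) = -1"
    unfolding spin_prod_spins[OF assms] by (metis neg_one_even_power neg_one_odd_power)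
  then show ?thesis using cosh_plus_sinh[of z] cosh_minus_sinh[of z] by (auto simp: algebra_simps)
qed

text \<open>
  Expanding the product of Boltzmann factors gives a combination of products of spins, since a product
  of two such products is again one (\<open>spin_prod_sym_diff\<close>). Each has sum at most \<open>B\<close> in norm, and the
  norms of the coefficients of the expansion, with the leading \<open>1\<close> removed, add up to at most \<open>(1 + y) ^ card S - 1\<close>. Applied below to the bonds \<open>S\<close> at one site.
\<close>
lemma csum_star_bound:
  assumes y: "norm (cosh z - 1) + norm (sinh z) \<le> y"
    and B: "\<And>U. U \<subseteq> \<Lambda> \<Longrightarrow> norm (csum \<Lambda> z E (\<lambda>\<sigma>. of_real (spin_prod U \<sigma>))) \<le> B"
    and S: "finite S" "\<And>A. A \<in> S \<Longrightarrow> A \<subseteq> \<Lambda>" and fin: "finite \<Lambda>" and U: "U \<subseteq> \<Lambda>"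
  shows "norm (csum \<Lambda> z E (\<lambda>\<sigma>. of_real (spin_prod U \<sigma>) * ((\<Prod>A\<in>S. exp (z * of_real (spin_prod A \<sigma>))) - 1)))
    \<le> ((1 + y) ^ card S - 1) * B"
  using S U
proof (induction S arbitrary: U rule: finite_induct)
  case empty
  then show ?case by (simp add: csum_def)
next
  case (insert A S)
  define a where "a = cosh z - 1"
  define b where "b = sinh z"
  define G where "G \<sigma> = (\<Prod>A\<in>S. exp (z * of_real (spin_prod A \<sigma>))) - 1" for \<sigma> :: "'a \<Rightarrow> real"
  define q where "q U = csum \<Lambda> z E (\<lambda>\<sigma>. of_real (spin_prod U \<sigma>))" for U
  define p where "p U = csum \<Lambda> z E (\<lambda>\<sigma>. of_real (spin_prod U \<sigma>) * G \<sigma>)" for U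
  have A: "A \<subseteq> \<Lambda>" using insert.prems(1) by simp
  have Af: "finite A" and Uf: "finite U" using A insert.prems(2) fin by (auto intro: finite_subset)
  have UA: "sym_diff U A \<subseteq> \<Lambda>" using insert.prems A by auto
  have B0: "0 \<le> B" using B[of "{}"] norm_ge_zero by (meson empty_subsetI order_trans)
  have y0: "0 \<le> y" using y norm_ge_zero by (meson add_nonneg_nonneg order_trans)
  have "csum \<Lambda> z E (\<lambda>\<sigma>. of_real (spin_prod U \<sigma>) * ((\<Prod>A\<in>insert A S. exp (z * of_real (spin_prod A \<sigma>))) - 1))
     = csum \<Lambda> z E (\<lambda>\<sigma>. (of_real (spin_prod U \<sigma>) * G \<sigma>) +
         (a * (of_real (spin_prod U \<sigma>) + of_real (spin_prod U \<sigma>) * G \<sigma>) +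
          b * (of_real (spin_prod (sym_diff U A) \<sigma>) + of_real (spin_prod (sym_diff U A) \<sigma>) * G \<sigma>)))"
    using insert.hyps
    by (intro csum_cong)
       (simp add: exp_spin_prod[OF Af] spin_prod_sym_diff[OF Uf Af, symmetric] G_def a_def b_def algebra_simps)
  also have "\<dots> = p U + (a * (q U + p U) + b * (q (sym_diff U A) + p (sym_diff U A)))"
    unfolding csum_add csum_cmult p_def q_def ..
  also have "norm \<dots> \<le> norm (p U) + (norm a * (norm (q U) + norm (p U)) +
      norm b * (norm (q (sym_diff U A)) + norm (p (sym_diff U A))))"
    by (intro norm_triangle_le add_left_mono add_mono order_trans[OF norm_mult_ineq] mult_left_mono norm_triangle_ineq) auto
  also have "\<dots> \<le> ((1 + y) ^ card S - 1) * B + (norm a * (B + ((1 + y) ^ card S - 1) * B) + norm b * (B + ((1 + y) ^ card S - 1) * B))"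
    unfolding p_def q_def G_def
    by (intro add_mono mult_left_mono B insert.IH insert.prems UA) (use insert.prems in auto)
  also have "\<dots> = ((1 + y) ^ card S - 1) * B + (norm a + norm b) * ((1 + y) ^ card S * B)"
    by (simp add: algebra_simps)
  also have "\<dots> \<le> ((1 + y) ^ card S - 1) * B + y * ((1 + y) ^ card S * B)"
    using y B0 y0 unfolding a_def b_def by (intro add_left_mono mult_right_mono) auto
  also have "\<dots> = ((1 + y) ^ card (insert A S) - 1) * B"
    using insert.hyps by (simp add: algebra_simps)
  finally show ?case .
qed

text \<open>
  Induction on the number of bonds, removing the star of a site \<open>t\<close> at each step. If \<open>Z\<close> is the partition function without the
  star, then the full one differs from \<open>Z\<close> by at most \<open>norm Z / 2\<close>, while a
  numerator whose observable contains \<open>t\<close> is at most \<open>norm Z / 2\<close>: without the star it is zero.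
\<close>
lemma csum_nonzero_and_bound:
  assumes y: "norm (cosh z - 1) + norm (sinh z) \<le> y" "(1 + y) ^ d \<le> 3/2"
    and fin: "finite \<Lambda>" "finite E" and E: "\<And>A. A \<in> E \<Longrightarrow> A \<noteq> {} \<and> A \<subseteq> \<Lambda>"
    and deg: "\<And>t. card {A \<in> E. t \<in> A} \<le> d"
  shows "csum \<Lambda> z E (\<lambda>_. 1) \<noteq> 0 \<and>
    (\<forall>U\<subseteq>\<Lambda>. norm (csum \<Lambda> z E (\<lambda>\<sigma>. of_real (spin_prod U \<sigma>))) \<le> norm (csum \<Lambda> z E (\<lambda>_. 1)))"
  using fin(2) E deg
proof (induction "card E" arbitrary: E rule: less_induct)
  case less
  have y0: "0 \<le> y" using y(1) norm_ge_zero by (meson add_nonneg_nonneg order_trans)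
  let ?S = "\<lambda>t. {A \<in> E. t \<in> A}"
  have E: "A \<subseteq> \<Lambda>" "finite A" if "A \<in> E" for A
    using less.prems(2)[OF that] fin finite_subset by auto
  have isolated: "csum \<Lambda> z (E - ?S t) (\<lambda>\<sigma>. of_real (spin_prod U \<sigma>)) = 0" if "t \<in> U" "U \<subseteq> \<Lambda>" for t U
    unfolding csum_of_real
  proof (rule wsum_odd[where W = "{t}"])
    show "finite U" using that fin finite_subset by auto
    show "{t} \<subseteq> \<Lambda>" "odd (card (U \<inter> {t}))" using that by auto
    fix \<sigma> :: "'a \<Rightarrow> real"
    have "spin_prod A (\<lambda>s. spins {t} s * \<sigma> s) = spin_prod A \<sigma>" if "A \<in> E - ?S t" for A
      using that unfolding spin_prod_def spins_def by (intro prod.cong) auto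
    then show "z * complex_of_real (\<Sum>A\<in>E - ?S t. spin_prod A (\<lambda>s. spins {t} s * \<sigma> s)) =
         z * complex_of_real (\<Sum>A\<in>E - ?S t. spin_prod A \<sigma>)" by simp
  qed
  have star: "csum \<Lambda> z E (\<lambda>_. 1) \<noteq> 0 \<and> (\<forall>U\<subseteq>\<Lambda>. t \<in> U \<longrightarrow>
     norm (csum \<Lambda> z E (\<lambda>\<sigma>. of_real (spin_prod U \<sigma>))) \<le> norm (csum \<Lambda> z E (\<lambda>_. 1)))" if "?S t \<noteq> {}" for t
  proof -
    let ?E' = "E - ?S t"
    define Z where "Z = csum \<Lambda> z ?E' (\<lambda>_. 1)"
    define q where "q U = csum \<Lambda> z ?E' (\<lambda>\<sigma>. of_real (spin_prod U \<sigma>))" for U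
    define p where "p U = csum \<Lambda> z ?E' (\<lambda>\<sigma>. of_real (spin_prod U \<sigma>) * ((\<Prod>A\<in>?S t. exp (z * of_real (spin_prod A \<sigma>))) - 1))" for U
    have IH: "Z \<noteq> 0 \<and> (\<forall>U\<subseteq>\<Lambda>. norm (q U) \<le> norm Z)"
      unfolding Z_def q_def
    proof (rule less.hyps)
      show "card ?E' < card E" using that less.prems(1) by (intro psubset_card_mono) auto
      show "card {A \<in> ?E'. s \<in> A} \<le> d" for s
        using less.prems(1,3) by (intro order_trans[OF card_mono less.prems(3)]) auto
    qed (use less.prems in auto)
    have p: "norm (p U) \<le> norm Z / 2" if "U \<subseteq> \<Lambda>" for U
    proof -
      have "norm (p U) \<le> ((1 + y) ^ card (?S t) - 1) * norm Z"
        unfolding p_def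
        by (rule csum_star_bound[OF y(1)]) (use IH E fin less.prems(1) that in \<open>auto simp: q_def\<close>)
      also have "(1 + y) ^ card (?S t) \<le> (1 + y) ^ d"
        using y0 less.prems(3) by (intro power_increasing) auto
      then have "((1 + y) ^ card (?S t) - 1) * norm Z \<le> (1/2) * norm Z"
        using y(2) by (intro mult_right_mono) auto
      finally show ?thesis by simp
    qed
    have split: "csum \<Lambda> z E (\<lambda>\<sigma>. of_real (spin_prod U \<sigma>)) = q U + p U" for U
      unfolding p_def q_def csum_add[symmetric]
      by (subst csum_split[where S = "?S t"]) (use less.prems(1) in \<open>auto simp: algebra_simps\<close>)
    have E1: "csum \<Lambda> z E (\<lambda>_. 1) = Z + p {}"
      using split[of "{}"] by (simp add: spin_prod_def q_def Z_def)
    have Zp: "norm Z / 2 \<le> norm (Z + p {})"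
      using norm_diff_ineq[of Z "p {}"] p[of "{}"] by simp
    show ?thesis
    proof (intro conjI allI impI)
      show "csum \<Lambda> z E (\<lambda>_. 1) \<noteq> 0" unfolding E1 using Zp IH by auto
      fix U assume U: "U \<subseteq> \<Lambda>" "t \<in> U"
      have "q U = 0" unfolding q_def by (rule isolated) (use U in auto)
      then show "norm (csum \<Lambda> z E (\<lambda>\<sigma>. of_real (spin_prod U \<sigma>))) \<le> norm (csum \<Lambda> z E (\<lambda>_. 1))"
        unfolding split E1 using p[OF U(1)] Zp by simp
    qed
  qed
  show ?case
  proof (intro conjI allI impI)
    show "csum \<Lambda> z E (\<lambda>_. 1) \<noteq> 0"
    proof (cases "E = {}")
      case True
      then show ?thesis using fin(1) by (simp add: csum_def card_Pow)
    next
      case False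
      then obtain A t where "A \<in> E" "t \<in> A" using less.prems(2) by blast
      then show ?thesis using star[of t] by blast
    qed
    fix U assume U: "U \<subseteq> \<Lambda>"
    show "norm (csum \<Lambda> z E (\<lambda>\<sigma>. of_real (spin_prod U \<sigma>))) \<le> norm (csum \<Lambda> z E (\<lambda>_. 1))"
    proof (cases "U = {}")
      case False
      then obtain t where t: "t \<in> U" by blast
      show ?thesis
      proof (cases "?S t = {}")
        case True
        then have "E - ?S t = E" by blast
        then show ?thesis using isolated[OF t U] by simp
      next
        case False
        then show ?thesis using star[OF False] t U by blast
      qed
    qed (simp add: spin_prod_def)
  qed
qed

text \<open>
  A crude bound from \<open>norm (exp w - 1) \<le> 2 * norm w\<close>, applied to \<open>z\<close> and \<open>- z\<close>.
\<close>
lemma cosh_sinh_bound: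
  fixes z :: complex
  assumes "norm z \<le> 1/2"
  shows "norm (cosh z - 1) + norm (sinh z) \<le> 4 * norm z"
proof -
  have e: "norm (exp w - 1) \<le> 2 * norm w" if "norm w \<le> 1/2" for w :: complex
  proof -
    have "norm (exp w - 1) \<le> exp \<bar>Re w\<bar> * norm w"
      using Taylor_exp[of w 0] by simp
    also have "exp \<bar>Re w\<bar> \<le> 2"
    proof -
      have "\<bar>Re w\<bar> \<le> 1/2" using abs_Re_le_cmod[of w] that by linarith
      then show ?thesis using exp_bound_half[of "\<bar>Re w\<bar>"] by simp
    qed
    finally show ?thesis by (simp add: mult_right_mono)
  qed
  have c: "cosh z - 1 = ((exp z - 1) + (exp (-z) - 1)) / 2" and s: "sinh z = ((exp z - 1) - (exp (-z) - 1)) / 2"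
    by (simp_all add: cosh_def sinh_def scaleR_conv_of_real field_simps)
  have "norm (cosh z - 1) \<le> (2 * norm z + 2 * norm z) / 2"
    unfolding c norm_divide using norm_triangle_le[OF add_mono[OF e[of z] e[of "-z"]]] assms
    by simp
  moreover have "norm (sinh z) \<le> (2 * norm z + 2 * norm z) / 2"
    unfolding s norm_divide using norm_triangle_le_diff[OF add_mono[OF e[of z] e[of "-z"]]] assms
    by simp
  ultimately show ?thesis by simp
qed

text \<open>
  The bound \<open>1\<close> holds for every product of spins and every volume; only the maximal number \<open>d\<close> of bonds
  at a site enters.
\<close>
lemma gibbs_ex_nonzero_and_bound:
  assumes z: "norm z * real d \<le> 1/16" "0 < d"
    and fin: "finite \<Lambda>" "finite E" and E: "\<And>A. A \<in> E \<Longrightarrow> A \<noteq> {} \<and> A \<subseteq> \<Lambda>"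
    and deg: "\<And>t. card {A \<in> E. t \<in> A} \<le> d"
  shows "wsum \<Lambda> (\<lambda>\<sigma>. z * of_real (\<Sum>A\<in>E. spin_prod A \<sigma>)) (\<lambda>_. 1) \<noteq> 0"
    and "U \<subseteq> \<Lambda> \<Longrightarrow> norm (gibbs_ex \<Lambda> (\<lambda>\<sigma>. z * of_real (\<Sum>A\<in>E. spin_prod A \<sigma>)) (spin_prod U)) \<le> 1"
proof -
  have "norm z * 1 \<le> norm z * real d" using z(2) by (intro mult_left_mono) auto
  then have z2: "norm z \<le> 1/2" using z(1) by simp
  have "(1 + 4 * norm z) ^ d \<le> exp (4 * norm z) ^ d"
    by (intro power_mono) (auto simp: exp_ge_add_one_self)
  also have "\<dots> = exp (4 * (norm z * real d))" by (simp add: exp_of_nat_mult[symmetric] mult_ac)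
  also have "\<dots> \<le> exp (1/4)" using z(1) by simp
  also have "\<dots> \<le> 3/2" using exp_bound[of "1/4"] by (simp add: power2_eq_square)
  finally have y: "(1 + 4 * norm z) ^ d \<le> 3/2" .
  note * = csum_nonzero_and_bound[OF cosh_sinh_bound[OF z2] y fin E deg]
  have 1: "csum \<Lambda> z E (\<lambda>_. 1) = wsum \<Lambda> (\<lambda>\<sigma>. z * of_real (\<Sum>A\<in>E. spin_prod A \<sigma>)) (\<lambda>_. 1)"
    using csum_of_real[of \<Lambda> z E "\<lambda>_. 1"] by simp
  show "wsum \<Lambda> (\<lambda>\<sigma>. z * of_real (\<Sum>A\<in>E. spin_prod A \<sigma>)) (\<lambda>_. 1) \<noteq> 0"
    using * unfolding 1 by blast
  show "norm (gibbs_ex \<Lambda> (\<lambda>\<sigma>. z * of_real (\<Sum>A\<in>E. spin_prod A \<sigma>)) (spin_prod U)) \<le> 1" if "U \<subseteq> \<Lambda>"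
    using * that unfolding 1 csum_of_real gibbs_ex_def norm_divide by simp
qed

section \<open>Lattice geometry\<close>

lemma box_eq_image: "{t :: 'a ^ 'n::finite. \<forall>i. t $ i \<in> S i} = vec_lambda ` (PiE UNIV S)"
proof (intro set_eqI iffI)
  fix t :: "'a ^ 'n" assume "t \<in> {t. \<forall>i. t $ i \<in> S i}"
  then have "t = vec_lambda (\<lambda>i. t $ i)" "(\<lambda>i. t $ i) \<in> PiE UNIV S" by (auto simp: PiE_UNIV_domain)
  then show "t \<in> vec_lambda ` (PiE UNIV S)" by blast
qed (auto simp: PiE_UNIV_domain)

lemma card_box: "card {t :: 'a ^ 'n::finite. \<forall>i. t $ i \<in> S i} = (\<Prod>i\<in>UNIV. card (S i))"
  unfolding box_eq_image by (subst card_image) (auto simp: card_PiE inj_on_def vec_lambda_inject)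

lemma finite_box: "(\<And>i. finite (S i)) \<Longrightarrow> finite {t :: 'a ^ 'n::finite. \<forall>i. t $ i \<in> S i}"
  unfolding box_eq_image by (intro finite_imageI finite_PiE) auto

lemma cube_eq_box: "(cube N :: (int ^ 'n::finite) set) = {t. \<forall>i. t $ i \<in> {- int N .. int N}}"
  unfolding cube_def by (simp add: abs_le_iff) (metis minus_le_iff)

lemma finite_cube: "finite (cube N :: (int ^ 'n::finite) set)"
  unfolding cube_eq_box by (rule finite_box) simp

lemma card_cube: "card (cube N :: (int ^ 'n::finite) set) = (2 * N + 1) ^ CARD('n)"
proof -
  have "card {- int N .. int N} = 2 * N + 1" by simp
  then show ?thesis unfolding cube_eq_box card_box by (simp only: prod_constant)
qed

lemma cube_mono: "m \<le> n \<Longrightarrow> cube m \<subseteq> (cube n :: (int ^ 'n::finite) set)"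
  unfolding cube_def by (auto intro: order_trans)

lemma finite_subset_cube:
  assumes "finite (T :: (int ^ 'n::finite) set)" shows "\<exists>m. T \<subseteq> cube m"
proof -
  define m where "m = (\<Sum>t\<in>T. \<Sum>i\<in>UNIV. nat \<bar>t $ i\<bar>)"
  have "\<bar>t $ i\<bar> \<le> int m" if "t \<in> T" for t i
  proof -
    have "nat \<bar>t $ i\<bar> \<le> (\<Sum>i\<in>UNIV. nat \<bar>t $ i\<bar>)" by (rule member_le_sum) auto
    also have "\<dots> \<le> m" unfolding m_def by (rule member_le_sum[OF that]) (use assms in auto)
    finally show ?thesis by simp
  qed
  then show ?thesis by (auto simp: cube_def)
qed

lemma bondsE:
  assumes "A \<in> bonds"
  obtains s t where "A = {s, t}" "s \<noteq> t" "rho s t = 1"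
  using assms unfolding bonds_def by (force simp: rho_def)

lemma card_bond: "A \<in> bonds \<Longrightarrow> card A = 2"
  by (elim bondsE) simp

lemma finite_bond: "A \<in> bonds \<Longrightarrow> finite A"
  by (elim bondsE) simp

lemma rho_coordinate: "\<bar>s $ i - t $ i\<bar> \<le> rho s t"
  unfolding rho_def by (rule member_le_sum) auto

lemma bond_coordinate: "{s, t} \<in> bonds \<Longrightarrow> \<bar>s $ i - t $ i\<bar> \<le> 1"
  by (elim bondsE) (metis rho_coordinate abs_minus_commute doubleton_eq_iff)

text \<open>
  A crude count, by the points of a cube of side \<open>3\<close>; the true number of bonds is \<open>2 * CARD('n)\<close>.
\<close>
lemma card_bonds_at:
  "finite {A \<in> bonds. (t :: int ^ 'n::finite) \<in> A} \<and> card {A \<in> bonds. t \<in> A} \<le> 3 ^ CARD('n)"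
proof -
  have sub: "{A \<in> bonds. t \<in> A} \<subseteq> (\<lambda>u. {t, t + u}) ` cube 1"
  proof
    fix A assume A: "A \<in> {A \<in> bonds. t \<in> A}"
    then obtain s where s: "A = {t, s}" by (auto elim!: bondsE)
    then have "\<bar>s $ i - t $ i\<bar> \<le> 1" for i using A bond_coordinate[of s t] by (simp add: insert_commute)
    then have "s - t \<in> cube 1" by (simp add: cube_def)
    moreover have "A = {t, t + (s - t)}" using s by simp
    ultimately show "A \<in> (\<lambda>u. {t, t + u}) ` cube 1" by blast
  qed
  have "card {A \<in> bonds. t \<in> A} \<le> card (cube 1 :: (int ^ 'n) set)"
    using card_mono[OF finite_imageI[OF finite_cube] sub] card_image_le[OF finite_cube] by (rule order_trans)
  moreover have "finite {A \<in> bonds. t \<in> A}"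
    by (rule finite_subset[OF sub finite_imageI[OF finite_cube]])
  ultimately show ?thesis unfolding card_cube by simp
qed

definition bonds_in :: "(int ^ 'n::finite) set \<Rightarrow> (int ^ 'n) set set" where
  "bonds_in \<Lambda> = {A \<in> bonds. A \<subseteq> \<Lambda>}"

lemma finite_bonds_in: "finite \<Lambda> \<Longrightarrow> finite (bonds_in \<Lambda>)"
  by (rule finite_subset[of _ "Pow \<Lambda>"]) (auto simp: bonds_in_def)

section \<open>Clusters of bonds\<close>

definition adj :: "'v set set \<Rightarrow> ('v \<times> 'v) set" where
  "adj E = {(x, y). {x, y} \<in> E}"

lemma sym_adj: "sym (adj E)"
  by (auto simp: sym_def adj_def insert_commute)

text \<open>
  A shortest path uses each directed edge at most once, there are at most two of
  them for each bond, and each step changes a coordinate by at most \<open>1\<close>.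
\<close>
lemma bond_path_bound:
  fixes x y :: "int ^ 'n::finite"
  assumes E: "finite E" "E \<subseteq> bonds" and xy: "(x, y) \<in> (adj E)\<^sup>*"
  shows "\<bar>y $ i - x $ i\<bar> \<le> 2 * int (card E)"
proof -
  define P where "P A = {p. {fst p, snd p} = A}" for A :: "(int ^ 'n) set"
  have adj: "adj E = (\<Union>A\<in>E. P A)" by (auto simp: adj_def P_def)
  have c: "finite (P A) \<and> card (P A) \<le> 2" if "A \<in> E" for A
  proof -
    have "A \<in> bonds" using E(2) that by auto
    then obtain s t where "A = {s, t}" by (rule bondsE)
    then have sub: "P A \<subseteq> {(s, t), (t, s)}" by (auto simp: P_def doubleton_eq_iff)
    have "card (P A) \<le> card {(s, t), (t, s)}" by (rule card_mono[OF _ sub]) simp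
    also have "\<dots> \<le> 2" using card_length[of "[(s, t), (t, s)]"] by simp
    finally show ?thesis by (intro conjI finite_subset[OF sub]) simp_all
  qed
  have fin: "finite (adj E)" unfolding adj using E(1) c by (intro finite_UN_I) blast+
  have "card (adj E) \<le> (\<Sum>A\<in>E. card (P A))" unfolding adj by (rule card_UN_le[OF E(1)])
  also have "\<dots> \<le> (\<Sum>A\<in>E. 2)" by (rule sum_mono) (use c in blast)
  finally have card: "card (adj E) \<le> 2 * card E" by simp
  have step: "\<bar>y $ i - x $ i\<bar> \<le> int k" if "(x, y) \<in> adj E ^^ k" for k x y
    using that
  proof (induction k arbitrary: y)
    case (Suc k)
    then obtain z where z: "(x, z) \<in> adj E ^^ k" "(z, y) \<in> adj E" by auto
    then have "\<bar>z $ i - y $ i\<bar> \<le> 1" using E bond_coordinate[of z y i] by (auto simp: adj_def)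
    then show ?case using Suc.IH[OF z(1)] by linarith
  qed simp
  obtain k where "k \<le> card (adj E)" "(x, y) \<in> adj E ^^ k"
    using xy unfolding rtrancl_finite_eq_relpow[OF fin] by auto
  then show ?thesis using step[of x y k] card by linarith
qed

lemma cluster_closed:
  assumes "A \<in> E" "E \<subseteq> bonds"
  shows "A \<subseteq> (adj E)\<^sup>* `` T \<or> A \<inter> (adj E)\<^sup>* `` T = {}"
proof -
  have "A \<in> bonds" using assms by auto
  then obtain s t where A: "A = {s, t}" by (rule bondsE)
  then have "(s, t) \<in> adj E" "(t, s) \<in> adj E" using assms(1) by (auto simp: adj_def insert_commute)
  then show ?thesis unfolding A Image_def by (auto intro: rtrancl_into_rtrancl)
qed

lemma cluster_subset: "(adj E)\<^sup>* `` T \<subseteq> T \<union> \<Union>E"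
proof
  fix y assume "y \<in> (adj E)\<^sup>* `` T"
  then obtain x where "x \<in> T" "(x, y) \<in> (adj E)\<^sup>*" by auto
  from this(2,1) show "y \<in> T \<union> \<Union>E" by (cases rule: rtranclE) (auto simp: adj_def)
qed

section \<open>Cumulants at zero coupling\<close>

definition cumulant0 :: "(int ^ 'n::finite) set \<Rightarrow> ('n config \<Rightarrow> real) list \<Rightarrow> complex" where
  "cumulant0 \<Lambda> Xs = cumulant (gibbs_ex \<Lambda> (\<lambda>_. 0)) Xs"

lemma energy_zero: "energy E (\<lambda>_. 0) = (\<lambda>_. 0)"
  by (simp add: energy_def fun_eq_iff)

lemma cumulant0_restrict:
  assumes "finite \<Lambda>'" "\<Lambda> \<subseteq> \<Lambda>'" "\<And>X. X \<in> set Xs \<Longrightarrow> depends_on \<Lambda> X"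
  shows "cumulant0 \<Lambda>' Xs = cumulant0 \<Lambda> Xs"
  unfolding cumulant0_def
proof (rule cumulant_cong)
  fix S assume S: "S \<subseteq> {..<length Xs}"
  have "depends_on \<Lambda> (\<lambda>\<sigma>. \<Prod>i\<in>S. (Xs ! i) \<sigma>)"
    unfolding depends_on_def
  proof (intro allI impI prod.cong refl)
    fix \<sigma> \<sigma>' :: "'a config" and i assume "\<forall>t\<in>\<Lambda>. \<sigma> t = \<sigma>' t" "i \<in> S"
    then show "(Xs ! i) \<sigma> = (Xs ! i) \<sigma>'" using assms(3)[of "Xs ! i"] S unfolding depends_on_def by auto
  qed
  from gibbs_ex_restrict[OF assms(2) this depends_on_const depends_on_const, of 0 0]
  show "gibbs_ex \<Lambda>' (\<lambda>_. 0) (\<lambda>\<sigma>. \<Prod>i\<in>S. (Xs ! i) \<sigma>) = gibbs_ex \<Lambda> (\<lambda>_. 0) (\<lambda>\<sigma>. \<Prod>i\<in>S. (Xs ! i) \<sigma>)"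
    using wsum_energy_nonzero[of "\<Lambda>' - \<Lambda>" "{}" "\<lambda>_. 0"] assms(1) unfolding energy_zero by simp
qed

text \<open>
  A bond that is not connected to \<open>T\<close> lies outside the cluster of \<open>T\<close>.
\<close>
lemma cumulant0_nonzero_imp_cluster:
  assumes "finite \<Lambda>" "T \<subseteq> \<Lambda>" "set As \<subseteq> bonds_in \<Lambda>"
    and nz: "cumulant0 \<Lambda> (spin_prod T # map spin_prod As) \<noteq> 0"
  shows "\<Union>(set As) \<subseteq> (adj (set As))\<^sup>* `` T"
proof (rule ccontr)
  let ?W = "(adj (set As))\<^sup>* `` T"
  assume "\<not> \<Union>(set As) \<subseteq> ?W"
  then obtain A where A: "A \<in> set As" "\<not> A \<subseteq> ?W" by blast
  have b: "set As \<subseteq> bonds" using assms(3) by (auto simp: bonds_in_def)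
  have "cumulant (gibbs_ex \<Lambda> (energy (set As) (\<lambda>_. 0))) (spin_prod T # map spin_prod As) = 0"
  proof (rule cumulant_outside_cluster[where W = ?W and A = A])
    show "?W \<subseteq> \<Lambda>" using cluster_subset[of "set As" T] assms(2,3) by (auto simp: bonds_in_def)
    show "B \<subseteq> \<Lambda> \<and> (B \<subseteq> ?W \<or> B \<inter> ?W = {})" if "B \<in> set As" for B
      using cluster_closed[OF that b, of T] that assms(3) by (auto simp: bonds_in_def)
    show "A \<inter> ?W = {}" using cluster_closed[OF A(1) b, of T] A(2) by blast
  qed (use A assms in auto)
  then show False using nz unfolding energy_zero cumulant0_def by simp
qed

text \<open>
  Otherwise the cluster of \<open>s\<close> contains both end points or none of each bond, but only one of the two points \<open>s\<close>, \<open>t\<close>.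
\<close>
lemma cumulant0_nonzero_imp_connected:
  assumes "finite \<Lambda>" "{s, t} \<subseteq> \<Lambda>" "s \<noteq> t" "set As \<subseteq> bonds_in \<Lambda>"
    and nz: "cumulant0 \<Lambda> (spin_prod {s, t} # map spin_prod As) \<noteq> 0"
  shows "(s, t) \<in> (adj (set As))\<^sup>*"
proof (rule ccontr)
  let ?W = "(adj (set As))\<^sup>* `` {s}"
  assume "(s, t) \<notin> (adj (set As))\<^sup>*"
  then have i: "{s, t} \<inter> ?W = {s}" by auto
  have b: "set As \<subseteq> bonds" using assms(4) by (auto simp: bonds_in_def)
  have "cumulant (gibbs_ex \<Lambda> (energy (set As) (\<lambda>_. 0))) (spin_prod {s, t} # map spin_prod As) = 0"
  proof (rule cumulant_odd[where W = ?W])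
    show "?W \<subseteq> \<Lambda>" using cluster_subset[of "set As" "{s}"] assms(2,4) by (auto simp: bonds_in_def)
    show "odd (card ({s, t} \<inter> ?W))" unfolding i by simp
    show "finite A \<and> even (card (A \<inter> ?W))" if "A \<in> set As" for A
    proof -
      have A: "A \<in> bonds" using that b by auto
      then have "card (A \<inter> ?W) = 2 \<or> card (A \<inter> ?W) = 0"
        using cluster_closed[OF that b, of "{s}"] card_bond[OF A] by (metis card.empty inf.absorb1)
      then show ?thesis using finite_bond[OF A] by auto
    qed
  qed (use assms in auto)
  then show False using nz unfolding energy_zero cumulant0_def by simp
qed

text \<open>
  A covariance equals the expectation of the product because single spins have mean zero at all
  couplings. The further bonds are then obtained by differentiation.
\<close>
lemma cumulant0_pair:
  assumes "finite \<Lambda>" "{s, t} \<subseteq> \<Lambda>" "s \<noteq> t" "set As \<subseteq> bonds_in \<Lambda>"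
  shows "cumulant0 \<Lambda> (spin_prod {s} # spin_prod {t} # map spin_prod As) =
    cumulant0 \<Lambda> (spin_prod {s, t} # map spin_prod As)"
proof -
  have b: "A \<in> bonds \<and> A \<subseteq> \<Lambda>" if "A \<in> set As" for A using assms(4) that by (auto simp: bonds_in_def)
  have "gibbs_ex \<Lambda> (energy (set As) w) (spin_prod {s}) = 0" for w
  proof (rule gibbs_ex_odd[where W = \<Lambda>])
    show "odd (card ({s} \<inter> \<Lambda>))" using assms(2) by simp
    show "finite A \<and> even (card (A \<inter> \<Lambda>))" if "A \<in> set As" for A
      using b[OF that] finite_bond[of A] card_bond[of A] by (simp add: inf.absorb1)
  qed auto
  moreover have "(\<lambda>\<omega>. spin_prod {s} \<omega> * spin_prod {t} \<omega>) = spin_prod {s, t}"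
    using assms(3) by (simp add: spin_prod_def fun_eq_iff)
  ultimately have "cumulant (gibbs_ex \<Lambda> (energy (set As) (\<lambda>_. 0))) ([spin_prod {s}, spin_prod {t}] @ map spin_prod As) =
    cumulant (gibbs_ex \<Lambda> (energy (set As) (\<lambda>_. 0))) ([spin_prod {s, t}] @ map spin_prod As)"
    by (intro cumulant_energy_cong) (use assms(1) in \<open>auto simp: cumulant_pair cumulant_singleton\<close>)
  then show ?thesis unfolding energy_zero cumulant0_def by simp
qed

section \<open>Taylor coefficients of correlations\<close>

definition volume_corr :: "(int ^ 'n::finite) set \<Rightarrow> complex \<Rightarrow> (int ^ 'n) set \<Rightarrow> complex" where
  "volume_corr \<Lambda> z T = gibbs_ex \<Lambda> (\<lambda>\<sigma>. z * of_real (\<Sum>A\<in>bonds_in \<Lambda>. spin_prod A \<sigma>)) (spin_prod T)"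

text \<open>
  The radius of the disc of \<open>gibbs_ex_nonzero_and_bound\<close> for \<open>d = 3 ^ \<nu>\<close>.
\<close>
definition corr_radius :: "nat \<Rightarrow> real" where
  "corr_radius \<nu> = 1 / (16 * 3 ^ \<nu>)"

definition volume_coef :: "(int ^ 'n::finite) set \<Rightarrow> (int ^ 'n) set \<Rightarrow> nat \<Rightarrow> complex" where
  "volume_coef \<Lambda> T n = (deriv ^^ n) (\<lambda>z. volume_corr \<Lambda> z T) 0 / fact n"

lemma corr_radius_pos: "0 < corr_radius \<nu>"
  by (simp add: corr_radius_def)

lemma volume_corr_nonzero_and_bound:
  fixes \<Lambda> :: "(int ^ 'n::finite) set"
  assumes "finite \<Lambda>" "norm z \<le> corr_radius CARD('n)"
  shows "wsum \<Lambda> (\<lambda>\<sigma>. z * of_real (\<Sum>A\<in>bonds_in \<Lambda>. spin_prod A \<sigma>)) (\<lambda>_. 1) \<noteq> 0"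
    and "T \<subseteq> \<Lambda> \<Longrightarrow> norm (volume_corr \<Lambda> z T) \<le> 1"
proof -
  have z: "norm z * real (3 ^ CARD('n)) \<le> 1/16" "0 < (3::nat) ^ CARD('n)"
    using assms(2) by (auto simp: corr_radius_def field_simps)
  have b: "A \<noteq> {} \<and> A \<subseteq> \<Lambda>" if "A \<in> bonds_in \<Lambda>" for A
    using that by (auto simp: bonds_in_def elim: bondsE)
  have deg: "card {A \<in> bonds_in \<Lambda>. t \<in> A} \<le> 3 ^ CARD('n)" for t
  proof -
    have sub: "{A \<in> bonds_in \<Lambda>. t \<in> A} \<subseteq> {A \<in> bonds. t \<in> A}" by (auto simp: bonds_in_def)
    show ?thesis
      by (rule order_trans[OF card_mono[OF conjunct1[OF card_bonds_at] sub] conjunct2[OF card_bonds_at]])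
  qed
  note * = gibbs_ex_nonzero_and_bound[OF z assms(1) finite_bonds_in[OF assms(1)] b deg]
  show "wsum \<Lambda> (\<lambda>\<sigma>. z * of_real (\<Sum>A\<in>bonds_in \<Lambda>. spin_prod A \<sigma>)) (\<lambda>_. 1) \<noteq> 0"
    by (rule *(1))
  show "norm (volume_corr \<Lambda> z T) \<le> 1" if "T \<subseteq> \<Lambda>"
    unfolding volume_corr_def by (rule *(2)) (use that in auto)
qed

lemma volume_corr_field_differentiable:
  fixes \<Lambda> :: "(int ^ 'n::finite) set"
  assumes "finite \<Lambda>" "norm z \<le> corr_radius CARD('n)"
  shows "(\<lambda>z. volume_corr \<Lambda> z T) field_differentiable at z"
  unfolding field_differentiable_def volume_corr_def
  using gibbs_ex_deriv[of \<Lambda> "\<lambda>_. 0" z "\<lambda>\<sigma>. \<Sum>A\<in>bonds_in \<Lambda>. spin_prod A \<sigma>"] volume_corr_nonzero_and_bound(1)[OF assms]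
  by auto

lemma volume_corr_holomorphic:
  fixes \<Lambda> :: "(int ^ 'n::finite) set"
  assumes "finite \<Lambda>"
  shows "(\<lambda>z. volume_corr \<Lambda> z T) holomorphic_on cball 0 (corr_radius CARD('n))"
  unfolding holomorphic_on_def
  using volume_corr_field_differentiable[OF assms] by (auto intro: field_differentiable_at_within)

lemma volume_coef_bound:
  fixes \<Lambda> :: "(int ^ 'n::finite) set"
  assumes "finite \<Lambda>" "T \<subseteq> \<Lambda>"
  shows "norm (volume_coef \<Lambda> T n) \<le> 1 / corr_radius CARD('n) ^ n"
proof -
  have "norm ((deriv ^^ n) (\<lambda>z. volume_corr \<Lambda> z T) 0) \<le> fact n * 1 / corr_radius CARD('n) ^ n"
  proof (rule Cauchy_inequality)
    show "(\<lambda>z. volume_corr \<Lambda> z T) holomorphic_on ball 0 (corr_radius CARD('n))"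
      using volume_corr_holomorphic[OF assms(1)] holomorphic_on_subset ball_subset_cball by blast
    show "continuous_on (cball 0 (corr_radius CARD('n))) (\<lambda>z. volume_corr \<Lambda> z T)"
      by (rule holomorphic_on_imp_continuous_on[OF volume_corr_holomorphic[OF assms(1)]])
    show "norm (volume_corr \<Lambda> x T) \<le> 1" if "norm (0 - x) = corr_radius CARD('n)" for x
      using volume_corr_nonzero_and_bound(2)[OF assms(1) _ assms(2), of x] that by simp
  qed (rule corr_radius_pos)
  then show ?thesis unfolding volume_coef_def by (simp add: norm_divide field_simps)
qed

lemma volume_corr_sums:
  fixes \<Lambda> :: "(int ^ 'n::finite) set"
  assumes "finite \<Lambda>" "norm z < corr_radius CARD('n)"
  shows "(\<lambda>n. volume_coef \<Lambda> T n * z ^ n) sums volume_corr \<Lambda> z T"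
proof -
  have "(\<lambda>n. (deriv ^^ n) (\<lambda>z. volume_corr \<Lambda> z T) 0 / (fact n) * (z - 0)^n) sums volume_corr \<Lambda> z T"
    by (rule holomorphic_power_series[where r = "corr_radius CARD('n)"])
       (use assms volume_corr_holomorphic holomorphic_on_subset ball_subset_cball in \<open>blast, simp\<close>)
  then show ?thesis unfolding volume_coef_def by simp
qed

lemma volume_coef_eq:
  fixes \<Lambda> :: "(int ^ 'n::finite) set"
  assumes "finite \<Lambda>"
  shows "volume_coef \<Lambda> T n = (\<Sum>As | set As \<subseteq> bonds_in \<Lambda> \<and> length As = n.
    cumulant0 \<Lambda> (spin_prod T # map spin_prod As)) / fact n"
proof -
  have "(deriv ^^ n) (\<lambda>z. cumulant (gibbs_ex \<Lambda> (\<lambda>\<sigma>. z * of_real (\<Sum>A\<in>bonds_in \<Lambda>. spin_prod A \<sigma>))) [spin_prod T]) 0 =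
     (\<Sum>As | set As \<subseteq> bonds_in \<Lambda> \<and> length As = n.
        cumulant (gibbs_ex \<Lambda> (\<lambda>\<sigma>. 0 * of_real (\<Sum>A\<in>bonds_in \<Lambda>. spin_prod A \<sigma>))) ([spin_prod T] @ map spin_prod As))"
  proof (rule cumulant_gibbs_higher_deriv[where S = "ball 0 (corr_radius CARD('n))"])
    show "wsum \<Lambda> (\<lambda>\<sigma>. z * of_real (\<Sum>A\<in>bonds_in \<Lambda>. spin_prod A \<sigma>)) (\<lambda>_. 1) \<noteq> 0"
      if "z \<in> ball 0 (corr_radius CARD('n))" for z
      by (rule volume_corr_nonzero_and_bound(1)[OF assms]) (use that in simp)
  qed (use finite_bonds_in[OF assms] corr_radius_pos in auto)
  then show ?thesis unfolding volume_coef_def volume_corr_def cumulant0_def by (simp add: cumulant_singleton)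
qed

text \<open>
  Only sequences of bonds that are connected to \<open>T\<close> contribute, and these stay within distance \<open>2 * n\<close> of \<open>T\<close>.
\<close>
lemma volume_coef_local:
  fixes \<Lambda> :: "(int ^ 'n::finite) set"
  assumes "finite \<Lambda>" "T \<subseteq> cube m" "cube (m + 2 * n) \<subseteq> \<Lambda>"
  shows "volume_coef \<Lambda> T n = volume_coef (cube (m + 2 * n)) T n"
proof -
  let ?K = "cube (m + 2 * n) :: (int ^ 'n) set"
  have TK: "T \<subseteq> ?K" using assms(2) cube_mono[of m "m + 2 * n"] by auto
  have sub: "bonds_in ?K \<subseteq> bonds_in \<Lambda>" using assms(3) by (auto simp: bonds_in_def)
  have K: "set As \<subseteq> bonds_in ?K"
    if As: "set As \<subseteq> bonds_in \<Lambda>" "length As = n" and nz: "cumulant0 \<Lambda> (spin_prod T # map spin_prod As) \<noteq> 0" for As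
  proof -
    have b: "set As \<subseteq> bonds" using As by (auto simp: bonds_in_def)
    have c: "\<Union>(set As) \<subseteq> (adj (set As))\<^sup>* `` T"
      by (rule cumulant0_nonzero_imp_cluster[OF assms(1) _ As(1) nz]) (use TK assms(3) in auto)
    have "y \<in> ?K" if "y \<in> \<Union>(set As)" for y
    proof -
      have "y \<in> (adj (set As))\<^sup>* `` T" using c that by blast
      then obtain x where x: "x \<in> T" "(x, y) \<in> (adj (set As))\<^sup>*" by (rule ImageE)
      have "\<bar>y $ i\<bar> \<le> int (m + 2 * n)" for i
      proof -
        have "\<bar>x $ i\<bar> \<le> int m" using x(1) assms(2) by (auto simp: cube_def)
        moreover have "\<bar>y $ i - x $ i\<bar> \<le> 2 * int (card (set As))"
          by (rule bond_path_bound[OF _ b x(2)]) simp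
        ultimately show ?thesis using card_length[of As] As(2) by linarith
      qed
      then show ?thesis by (simp add: cube_def)
    qed
    then show ?thesis using b by (auto simp: bonds_in_def)
  qed
  have eq: "cumulant0 \<Lambda> (spin_prod T # map spin_prod As) = cumulant0 ?K (spin_prod T # map spin_prod As)"
    if "set As \<subseteq> bonds_in ?K" for As
    by (rule cumulant0_restrict[OF assms(1,3)])
       (use that TK in \<open>auto intro!: depends_on_spin_prod simp: bonds_in_def\<close>)
  have "(\<Sum>As | set As \<subseteq> bonds_in \<Lambda> \<and> length As = n. cumulant0 \<Lambda> (spin_prod T # map spin_prod As)) =
    (\<Sum>As | set As \<subseteq> bonds_in ?K \<and> length As = n. cumulant0 \<Lambda> (spin_prod T # map spin_prod As))"
    using sub K by (intro sum.mono_neutral_right finite_lists_length_eq finite_bonds_in assms) auto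
  also have "\<dots> = (\<Sum>As | set As \<subseteq> bonds_in ?K \<and> length As = n. cumulant0 ?K (spin_prod T # map spin_prod As))"
    by (intro sum.cong refl eq) auto
  finally show ?thesis unfolding volume_coef_eq[OF assms(1)] volume_coef_eq[OF finite_cube] by simp
qed

definition limit_coef :: "(int ^ 'n::finite) set \<Rightarrow> nat \<Rightarrow> complex" where
  "limit_coef T n = lim (\<lambda>N. volume_coef (cube N) T n)"

lemma limit_coef_eq:
  fixes \<Lambda> :: "(int ^ 'n::finite) set"
  assumes "finite \<Lambda>" "T \<subseteq> cube m" "cube (m + 2 * n) \<subseteq> \<Lambda>"
  shows "limit_coef T n = volume_coef \<Lambda> T n"
proof -
  have "\<forall>\<^sub>F N in sequentially. volume_coef (cube N) T n = volume_coef (cube (m + 2 * n)) T n"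
    unfolding eventually_sequentially
    using volume_coef_local[OF finite_cube assms(2)] cube_mono by blast
  then have "(\<lambda>N. volume_coef (cube N) T n) \<longlonglongrightarrow> volume_coef (cube (m + 2 * n)) T n"
    by (rule tendsto_eventually)
  then show ?thesis unfolding limit_coef_def volume_coef_local[OF assms] by (rule limI)
qed

lemma volume_coef_tendsto_limit_coef:
  fixes T :: "(int ^ 'n::finite) set"
  assumes "finite T"
  shows "(\<lambda>N. volume_coef (cube N) T n) \<longlonglongrightarrow> limit_coef T n"
proof -
  obtain m where "T \<subseteq> cube m" using finite_subset_cube[OF assms] by blast
  then have "\<forall>\<^sub>F N in sequentially. volume_coef (cube N) T n = limit_coef T n"
    unfolding eventually_sequentially
    using limit_coef_eq[OF finite_cube \<open>T \<subseteq> cube m\<close>] cube_mono by metis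
  then show ?thesis by (rule tendsto_eventually)
qed

lemma eventually_subset_cube:
  fixes T :: "(int ^ 'n::finite) set"
  assumes "finite T" shows "\<forall>\<^sub>F N in sequentially. T \<subseteq> cube N"
proof -
  obtain m where "T \<subseteq> cube m" using finite_subset_cube[OF assms] by blast
  then show ?thesis unfolding eventually_sequentially using cube_mono by blast
qed

lemma limit_coef_bound:
  fixes T :: "(int ^ 'n::finite) set"
  assumes "finite T"
  shows "norm (limit_coef T n) \<le> 1 / corr_radius CARD('n) ^ n"
proof (rule Lim_norm_ubound[OF _ volume_coef_tendsto_limit_coef[OF assms]])
  show "\<forall>\<^sub>F N in sequentially. norm (volume_coef (cube N) T n) \<le> 1 / corr_radius CARD('n) ^ n"
    using eventually_subset_cube[OF assms]
    by eventually_elim (rule volume_coef_bound[OF finite_cube])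
qed simp

text \<open>
  The coefficients converge because they are eventually constant, and the bounds \<open>volume_coef_bound\<close> are
  uniform in the volume.
\<close>
lemma volume_corr_tendsto:
  fixes T :: "(int ^ 'n::finite) set"
  assumes "finite T" "norm z < corr_radius CARD('n)"
  shows "summable (\<lambda>n. norm (limit_coef T n * z ^ n))"
    and "(\<lambda>N. volume_corr (cube N) z T) \<longlonglongrightarrow> (\<Sum>n. limit_coef T n * z ^ n)"
proof -
  define x where "x = norm z / corr_radius CARD('n)"
  have x: "0 \<le> x" "x < 1" using assms(2) corr_radius_pos[of "CARD('n)"] by (auto simp: x_def)
  have "\<forall>\<^sub>F (n, N) in at_top \<times>\<^sub>F sequentially. norm (volume_coef (cube N) T n * z ^ n) \<le> x ^ n"
  proof -
    have "\<forall>\<^sub>F p in at_top \<times>\<^sub>F sequentially. T \<subseteq> cube (snd p)"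
      using eventually_prodI[OF always_eventually eventually_subset_cube[OF assms(1)], of "\<lambda>_. True"] by simp
    then show ?thesis
    proof eventually_elim
      case (elim p)
      have "norm (volume_coef (cube (snd p)) T (fst p) * z ^ fst p) \<le> 1 / corr_radius CARD('n) ^ fst p * norm z ^ fst p"
        unfolding norm_mult norm_power by (intro mult_right_mono volume_coef_bound[OF finite_cube elim]) auto
      then show ?case by (simp add: x_def power_divide case_prod_beta)
    qed
  qed
  from tannerys_theorem[OF tendsto_mult_right[OF volume_coef_tendsto_limit_coef[OF assms(1)]] this summable_geometric]
  have *: "summable (\<lambda>n. norm (limit_coef T n * z ^ n))"
    "(\<lambda>N. \<Sum>n. volume_coef (cube N) T n * z ^ n) \<longlonglongrightarrow> (\<Sum>n. limit_coef T n * z ^ n)"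
    using x by auto
  show "summable (\<lambda>n. norm (limit_coef T n * z ^ n))" by (rule *(1))
  show "(\<lambda>N. volume_corr (cube N) z T) \<longlonglongrightarrow> (\<Sum>n. limit_coef T n * z ^ n)"
    using *(2) sums_unique[OF volume_corr_sums[OF finite_cube assms(2), of _ T]] by simp
qed

section \<open>Translation invariance\<close>

lemma bonds_translate: "(+) u -` A \<in> bonds \<longleftrightarrow> A \<in> bonds" for u :: "int ^ 'n::finite"
proof -
  have 1: "(+) v ` A \<in> bonds" if "A \<in> bonds" for v :: "int ^ 'n" and A
  proof -
    from that obtain s t where "A = {s, t}" "rho s t = 1" by (rule bondsE)
    then have "(+) v ` A = {v + s, v + t}" "rho (v + s) (v + t) = 1" by (auto simp: rho_def)
    then show ?thesis unfolding bonds_def by blast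
  qed
  have "(+) u -` A = (+) (- u) ` A" "(+) u ` ((+) u -` A) = A"
    by (force simp: image_iff)+
  then show ?thesis using 1 by metis
qed

lemma volume_corr_translate:
  fixes u :: "int ^ 'n::finite"
  shows "volume_corr ((+) u ` \<Lambda>) z ((+) u ` T) = volume_corr \<Lambda> z T"
proof -
  have bij: "bij ((+) u)" by (rule bij_betw_byWitness[where f' = "(+) (- u)"]) auto
  have vi: "(+) u -` (+) u ` T = T" for T by (rule inj_vimage_image_eq) simp
  have "(\<Sum>A\<in>bonds_in ((+) u ` \<Lambda>). spin_prod ((+) u -` A) \<sigma>) = (\<Sum>A\<in>bonds_in \<Lambda>. spin_prod A \<sigma>)" for \<sigma>
  proof (rule sum.reindex_bij_witness[where i = "(`) ((+) u)" and j = "(-`) ((+) u)"])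
    fix A assume "A \<in> bonds_in ((+) u ` \<Lambda>)"
    then show "(+) u -` A \<in> bonds_in \<Lambda>" using bonds_translate[of u A] by (auto simp: bonds_in_def)
  next
    fix A assume "A \<in> bonds_in \<Lambda>"
    then show "(+) u ` A \<in> bonds_in ((+) u ` \<Lambda>)" using bonds_translate[of u "(+) u ` A"] by (auto simp: bonds_in_def vi)
  qed (auto simp: vi surj_image_vimage_eq bij_is_surj[OF bij])
  then show ?thesis
    unfolding volume_corr_def gibbs_ex_def wsum_image[OF bij] spin_prod_shift[OF bij] vi by simp
qed

text \<open>
  Coefficients agree in all sufficiently large volumes of any shape, so a large volume and its
  translate may be compared directly.
\<close>
lemma limit_coef_translate:
  fixes u :: "int ^ 'n::finite"
  assumes "finite T"
  shows "limit_coef ((+) u ` T) n = limit_coef T n"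
proof -
  obtain m where m: "T \<subseteq> cube m" using finite_subset_cube[OF assms] by blast
  obtain m' where m': "(+) u ` T \<subseteq> cube m'" using finite_subset_cube[of "(+) u ` T"] assms by blast
  define \<Lambda> where "\<Lambda> = cube (m + 2 * n) \<union> (+) (- u) ` cube (m' + 2 * n)"
  have fin: "finite \<Lambda>" unfolding \<Lambda>_def by (simp add: finite_cube)
  have sub: "cube (m' + 2 * n) \<subseteq> (+) u ` \<Lambda>" unfolding \<Lambda>_def by (auto simp: image_Un image_image)
  have "limit_coef ((+) u ` T) n = volume_coef ((+) u ` \<Lambda>) ((+) u ` T) n"
    by (rule limit_coef_eq[OF _ m' sub]) (simp add: fin)
  also have "\<dots> = volume_coef \<Lambda> T n" unfolding volume_coef_def volume_corr_translate ..
  also have "\<dots> = limit_coef T n" by (rule limit_coef_eq[OF fin m, symmetric]) (simp add: \<Lambda>_def)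
  finally show ?thesis .
qed

section \<open>Expectations under the Gibbs measure of a cube\<close>

lemma Qset_eq: "Qset T = spin_prod T"
  by (simp add: Qset_def Q_def spin_prod_def fun_eq_iff)

lemma Q_eq: "Q t = spin_prod {t}"
  by (simp add: Q_def spin_prod_def fun_eq_iff)

lemma Phi_eq: "Phi = spin_prod"
  by (simp add: Phi_def Q_def spin_prod_def fun_eq_iff)

lemma spins_in_Omega: "spins D \<in> Omega"
  by (simp add: Omega_def spins_def)

lemma cube_cylinder_subset: "cube_cylinder N \<delta> \<subseteq> Omega"
  by (auto simp: cube_cylinder_def)

lemma finite_cube_configs: "finite (cube_configs N :: ('n::finite) config set)"
  unfolding cube_configs_def by (rule finite_PiE[OF finite_cube]) simp

lemma bij_betw_cube_configs:
  "bij_betw (\<lambda>D. restrict (spins D) (cube N)) (Pow (cube N)) (cube_configs N :: ('n::finite) config set)"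
proof (rule bij_betw_byWitness[where f' = "\<lambda>\<delta>. {t \<in> cube N. \<delta> t = -1}"])
  show "\<forall>D\<in>Pow (cube N :: (int ^ 'n) set). {t \<in> cube N. restrict (spins D) (cube N) t = -1} = D"
    by (auto simp: spins_def split: if_splits)
  show "\<forall>\<delta>\<in>(cube_configs N :: 'n config set). restrict (spins {t \<in> cube N. \<delta> t = -1}) (cube N) = \<delta>"
  proof
    fix \<delta> :: "'n config" assume \<delta>: "\<delta> \<in> cube_configs N"
    show "restrict (spins {t \<in> cube N. \<delta> t = -1}) (cube N) = \<delta>"
    proof
      fix t
      show "restrict (spins {t \<in> cube N. \<delta> t = -1}) (cube N) t = \<delta> t"
        using PiE_mem[OF \<delta>[unfolded cube_configs_def], of t] PiE_arb[OF \<delta>[unfolded cube_configs_def], of t]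
        by (auto simp: spins_def)
    qed
  qed
  show "(\<lambda>D. restrict (spins D) (cube N)) ` Pow (cube N) \<subseteq> (cube_configs N :: 'n config set)"
    by (auto simp: cube_configs_def spins_def)
  show "(\<lambda>\<delta>. {t \<in> cube N. \<delta> t = -1}) ` (cube_configs N :: 'n config set) \<subseteq> Pow (cube N)" by auto
qed

definition weight :: "real \<Rightarrow> nat \<Rightarrow> (int ^ 'n::finite) set \<Rightarrow> real" where
  "weight lam N D = exp (lam * (\<Sum>A\<in>bonds_in (cube N). spin_prod A (spins D))) /
     (\<Sum>D'\<in>Pow (cube N :: (int ^ 'n) set). exp (lam * (\<Sum>A\<in>bonds_in (cube N). spin_prod A (spins D'))))"

lemma gibbs_weight_restrict: "gibbs_weight lam N (restrict (spins D) (cube N)) = weight lam N D"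
proof -
  have b: "boltzmann lam N (restrict (spins D) (cube N)) =
      exp (lam * (\<Sum>A\<in>bonds_in (cube N). spin_prod A (spins D)))" for D :: "(int ^ 'a) set"
  proof -
    have "(\<Prod>t\<in>A. restrict (spins D) (cube N) t) = spin_prod A (spins D)" if "A \<in> bonds_in (cube N)" for A
      unfolding spin_prod_def using that by (intro prod.cong) (auto simp: bonds_in_def)
    then show ?thesis unfolding boltzmann_def cube_bonds_def bonds_in_def[symmetric] by simp
  qed
  show ?thesis unfolding gibbs_weight_def weight_def b
    by (subst sum.reindex_bij_betw[OF bij_betw_cube_configs, symmetric]) (simp add: b)
qed

lemma weight_nonneg: "0 \<le> weight lam N D"
  unfolding weight_def by (intro divide_nonneg_nonneg sum_nonneg) auto

lemma gibbs_ex_eq_weight: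
  fixes f :: "('n::finite) config \<Rightarrow> real"
  shows
  "gibbs_ex (cube N) (\<lambda>\<sigma>. of_real lam * of_real (\<Sum>A\<in>bonds_in (cube N). spin_prod A \<sigma>)) f =
    of_real (\<Sum>D\<in>Pow (cube N). weight lam N D * f (spins D))"
proof -
  have "(\<Sum>D\<in>Pow (cube N). weight lam N D * f (spins D)) =
    (\<Sum>D\<in>Pow (cube N). f (spins D) * exp (lam * (\<Sum>A\<in>bonds_in (cube N). spin_prod A (spins D)))) /
    (\<Sum>D\<in>Pow (cube N :: (int ^ 'n) set). exp (lam * (\<Sum>A\<in>bonds_in (cube N). spin_prod A (spins D))))"
    unfolding weight_def sum_divide_distrib by (simp add: mult.commute)
  then show ?thesis
    unfolding gibbs_ex_def wsum_def by (simp add: exp_of_real flip: of_real_mult of_real_sum of_real_divide)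
qed

text \<open>
  A measurable set contains a cylinder of the generating partition or is disjoint from it, so
  inclusion of the cylinder is the same as membership of one configuration of it. This turns the
  set function of the definition into the image of a weighted counting measure, and in particular
  shows that it is countably additive.
\<close>
lemma gibbs_cube_eq_distr:
  fixes lam :: real and N :: nat
  defines "M' \<equiv> distr (point_measure (Pow (cube N :: (int ^ 'n::finite) set)) (\<lambda>D. ennreal (weight lam N D)))
    (sigma Omega (cube_cylinder N ` cube_configs N)) spins"
  shows "(gibbs_cube lam N :: 'n config measure) = M'"
proof -
  let ?CY = "cube_cylinder N ` cube_configs N :: 'n config set set"
  let ?\<mu> = "\<lambda>E :: 'n config set. ennreal (\<Sum>\<delta> | \<delta> \<in> cube_configs N \<and> cube_cylinder N \<delta> \<subseteq> E. gibbs_weight lam N \<delta>)"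
  have CY: "?CY \<subseteq> Pow Omega" using cube_cylinder_subset by blast
  have mem: "spins D \<in> E \<longleftrightarrow> cube_cylinder N (restrict (spins D) (cube N)) \<subseteq> E"
    if E: "E \<in> sigma_sets Omega ?CY" for E and D :: "(int ^ 'n) set"
  proof -
    have D: "spins D \<in> cube_cylinder N (restrict (spins D) (cube N))"
      by (auto simp: cube_cylinder_def spins_in_Omega)
    have "cube_cylinder N (restrict (spins D) (cube N)) \<subseteq> E \<or> cube_cylinder N (restrict (spins D) (cube N)) \<inter> E = {}"
      using E
    proof (induction rule: sigma_sets.induct)
      case (Basic a)
      then obtain \<delta> where "a = cube_cylinder N \<delta>" by blast
      then show ?case by (auto simp: cube_cylinder_def)
    next
      case (Compl a)
      then show ?case using cube_cylinder_subset[of N "restrict (spins D) (cube N)"] by blast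
    qed blast+
    then show ?thesis using D by blast
  qed
  have sets': "sets M' = sigma_sets Omega ?CY" unfolding M'_def using CY by simp
  have meas: "spins \<in> point_measure (Pow (cube N)) (\<lambda>D. ennreal (weight lam N D)) \<rightarrow>\<^sub>M sigma Omega ?CY"
    unfolding measurable_point_measure_eq1 using CY spins_in_Omega by (auto simp: space_measure_of)
  have em: "emeasure M' E = ?\<mu> E" if E: "E \<in> sigma_sets Omega ?CY" for E
  proof -
    have "emeasure M' E = emeasure (point_measure (Pow (cube N)) (\<lambda>D. ennreal (weight lam N D))) {D \<in> Pow (cube N). spins D \<in> E}"
      unfolding M'_def using E CY
      by (subst emeasure_distr[OF meas]) (auto simp: space_point_measure intro!: arg_cong2[where f = emeasure])
    also have "\<dots> = (\<Sum>D | D \<in> Pow (cube N) \<and> spins D \<in> E. ennreal (weight lam N D))"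
      by (rule emeasure_point_measure_finite) (auto simp: finite_cube)
    also have "\<dots> = ennreal (\<Sum>D | D \<in> Pow (cube N) \<and> spins D \<in> E. weight lam N D)"
      by (rule sum_ennreal) (rule weight_nonneg)
    also have "(\<Sum>D | D \<in> Pow (cube N) \<and> spins D \<in> E. weight lam N D) =
       (\<Sum>D\<in>Pow (cube N). if spins D \<in> E then weight lam N D else 0)"
      by (rule sum.inter_filter) (simp add: finite_cube)
    also have "\<dots> = (\<Sum>D\<in>Pow (cube N). (\<lambda>\<delta>. if cube_cylinder N \<delta> \<subseteq> E then gibbs_weight lam N \<delta> else 0) (restrict (spins D) (cube N)))"
      by (intro sum.cong refl) (simp add: mem[OF E] gibbs_weight_restrict)
    also have "\<dots> = (\<Sum>\<delta>\<in>cube_configs N. if cube_cylinder N \<delta> \<subseteq> E then gibbs_weight lam N \<delta> else 0)"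
      by (rule sum.reindex_bij_betw[OF bij_betw_cube_configs])
    also have "\<dots> = (\<Sum>\<delta> | \<delta> \<in> cube_configs N \<and> cube_cylinder N \<delta> \<subseteq> E. gibbs_weight lam N \<delta>)"
      by (rule sum.inter_filter[OF finite_cube_configs, symmetric])
    finally show ?thesis .
  qed
  have sets: "sets (gibbs_cube lam N :: 'n config measure) = sigma_sets Omega ?CY"
    unfolding gibbs_cube_def using CY by simp
  show ?thesis
  proof (rule measure_eqI)
    show "sets (gibbs_cube lam N) = sets M'" by (simp add: sets sets')
    fix E :: "'n config set" assume E: "E \<in> sets (gibbs_cube lam N)"
    have "emeasure (gibbs_cube lam N) E = ?\<mu> E"
    proof (rule emeasure_measure_of[OF gibbs_cube_def CY _ _ E])
      show "positive (sets (gibbs_cube lam N)) ?\<mu>"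
        unfolding positive_def using em[OF sigma_sets.Empty] by simp
      show "countably_additive (sets (gibbs_cube lam N)) ?\<mu>"
        unfolding countably_additive_def sets
      proof (intro allI impI)
        fix F :: "nat \<Rightarrow> 'n config set"
        assume F: "range F \<subseteq> sigma_sets Omega ?CY" "disjoint_family F" "\<Union>(range F) \<in> sigma_sets Omega ?CY"
        have "(\<Sum>i. ?\<mu> (F i)) = (\<Sum>i. emeasure M' (F i))"
          using F(1) by (intro suminf_cong em[symmetric]) auto
        also have "\<dots> = emeasure M' (\<Union>(range F))"
          by (rule suminf_emeasure) (use F sets' in auto)
        also have "\<dots> = ?\<mu> (\<Union>(range F))" by (rule em[OF F(3)])
        finally show "(\<Sum>i. ?\<mu> (F i)) = ?\<mu> (\<Union>(range F))" .
      qed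
    qed
    then show "emeasure (gibbs_cube lam N) E = emeasure M' E" using em E sets by simp
  qed
qed

lemma measurable_cube:
  fixes f :: "('n::finite) config \<Rightarrow> real"
  assumes "depends_on (cube N) f"
  shows "f \<in> borel_measurable (sigma Omega (cube_cylinder N ` cube_configs N))"
proof (rule measurableI)
  let ?CY = "cube_cylinder N ` cube_configs N :: 'n config set set"
  have CY: "?CY \<subseteq> Pow Omega" using cube_cylinder_subset by blast
  fix B :: "real set" assume "B \<in> sets borel"
  let ?I = "{\<delta> \<in> cube_configs N. f \<delta> \<in> B}"
  have "f -` B \<inter> Omega = (\<Union>\<delta>\<in>?I. cube_cylinder N \<delta>)"
  proof (intro set_eqI iffI)
    fix \<omega> assume \<omega>: "\<omega> \<in> f -` B \<inter> Omega"
    let ?\<delta> = "restrict \<omega> (cube N)"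
    have "f ?\<delta> = f \<omega>" using assms unfolding depends_on_def by (elim allE impE) auto
    moreover have "?\<delta> \<in> cube_configs N" using \<omega> by (auto simp: cube_configs_def Omega_def)
    moreover have "\<omega> \<in> cube_cylinder N ?\<delta>" using \<omega> by (auto simp: cube_cylinder_def)
    ultimately show "\<omega> \<in> (\<Union>\<delta>\<in>?I. cube_cylinder N \<delta>)" using \<omega> by auto
  next
    fix \<omega> assume "\<omega> \<in> (\<Union>\<delta>\<in>?I. cube_cylinder N \<delta>)"
    then obtain \<delta> where \<delta>: "f \<delta> \<in> B" "\<omega> \<in> cube_cylinder N \<delta>" by auto
    then have "f \<omega> = f \<delta>" using assms unfolding depends_on_def cube_cylinder_def by blast
    then show "\<omega> \<in> f -` B \<inter> Omega" using \<delta> by (auto simp: cube_cylinder_def)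
  qed
  moreover have "(\<Union>\<delta>\<in>?I. cube_cylinder N \<delta>) \<in> sets (sigma Omega ?CY)"
  proof (rule sets.finite_UN)
    show "finite ?I" by (rule finite_subset[OF _ finite_cube_configs]) auto
  qed (use CY in \<open>auto intro!: sigma_sets.Basic\<close>)
  ultimately show "f -` B \<inter> space (sigma Omega ?CY) \<in> sets (sigma Omega ?CY)"
    using CY by (simp add: space_measure_of_conv)
qed simp

lemma integral_gibbs_cube:
  fixes f :: "('n::finite) config \<Rightarrow> real"
  assumes "depends_on (cube N) f"
  shows "integral\<^sup>L (gibbs_cube lam N) f = (\<Sum>D\<in>Pow (cube N). weight lam N D * f (spins D))"
proof -
  let ?CY = "cube_cylinder N ` cube_configs N :: 'n config set set"
  have CY: "?CY \<subseteq> Pow Omega" using cube_cylinder_subset by blast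
  have "spins \<in> point_measure (Pow (cube N)) (\<lambda>D. ennreal (weight lam N D)) \<rightarrow>\<^sub>M sigma Omega ?CY"
    unfolding measurable_point_measure_eq1 using CY spins_in_Omega by (auto simp: space_measure_of)
  then show ?thesis
    unfolding gibbs_cube_eq_distr
    by (subst integral_distr[OF _ measurable_cube[OF assms]])
       (simp_all add: lebesgue_integral_point_measure_finite finite_cube weight_nonneg)
qed

lemma of_real_integral_gibbs_cube:
  assumes "depends_on (cube N) f"
  shows "of_real (integral\<^sup>L (gibbs_cube lam N) f) =
    gibbs_ex (cube N) (\<lambda>\<sigma>. of_real lam * of_real (\<Sum>A\<in>bonds_in (cube N). spin_prod A \<sigma>)) f"
  unfolding integral_gibbs_cube[OF assms] gibbs_ex_eq_weight ..

text \<open>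
  The semi-invariants under the measures of the cubes are eventually constant, with value the cumulant in any volume that carries the variables.
\<close>
lemma semi_invariant_0_eq:
  fixes \<Lambda> :: "(int ^ 'n::finite) set"
  assumes "finite \<Lambda>" "\<And>X. X \<in> set Xs \<Longrightarrow> depends_on \<Lambda> X"
  shows "of_real (semi_invariant_0 Xs) = cumulant0 \<Lambda> Xs"
proof -
  have sinv: "of_real (semi_invariant (gibbs_cube 0 N) Xs) = cumulant0 \<Lambda> Xs" if N: "\<Lambda> \<subseteq> cube N" for N
  proof -
    have dep: "depends_on (cube N) X" if "X \<in> set Xs" for X
      using assms(2)[OF that] N unfolding depends_on_def by blast
    have "of_real (semi_invariant (gibbs_cube 0 N) Xs) = cumulant0 (cube N) Xs"
      unfolding semi_invariant_eq_cumulant of_real_cumulant cumulant0_def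
    proof (rule cumulant_cong)
      fix S assume S: "S \<subseteq> {..<length Xs}"
      have "depends_on (cube N) (\<lambda>\<omega>. \<Prod>i\<in>S. (Xs ! i) \<omega>)"
        unfolding depends_on_def
      proof (intro allI impI prod.cong refl)
        fix \<sigma> \<sigma>' :: "'n config" and i assume *: "\<forall>t\<in>cube N. \<sigma> t = \<sigma>' t" "i \<in> S"
        then have "Xs ! i \<in> set Xs" using S by auto
        from dep[OF this] show "(Xs ! i) \<sigma> = (Xs ! i) \<sigma>'" using *(1) unfolding depends_on_def by blast
      qed
      from of_real_integral_gibbs_cube[OF this, of 0]
      show "of_real (integral\<^sup>L (gibbs_cube 0 N) (\<lambda>\<omega>. \<Prod>i\<in>S. (Xs ! i) \<omega>)) =
         gibbs_ex (cube N) (\<lambda>_. 0) (\<lambda>\<omega>. \<Prod>i\<in>S. (Xs ! i) \<omega>)" by simp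
    qed
    also have "\<dots> = cumulant0 \<Lambda> Xs" by (rule cumulant0_restrict[OF finite_cube N assms(2)])
    finally show ?thesis .
  qed
  have ev: "\<forall>\<^sub>F N in sequentially. semi_invariant (gibbs_cube 0 N) Xs = Re (cumulant0 \<Lambda> Xs)"
    using eventually_subset_cube[OF assms(1)] by (rule eventually_mono) (metis sinv Re_complex_of_real)
  have "semi_invariant_0 Xs = Re (cumulant0 \<Lambda> Xs)"
    unfolding semi_invariant_0_def
  proof (rule the_equality)
    show "\<forall>\<^sub>F N in sequentially. semi_invariant (gibbs_cube 0 N) Xs = Re (cumulant0 \<Lambda> Xs)" by (rule ev)
    fix c assume "\<forall>\<^sub>F N in sequentially. semi_invariant (gibbs_cube 0 N) Xs = c"
    with ev have "\<forall>\<^sub>F N in sequentially. c = Re (cumulant0 \<Lambda> Xs)"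
      by eventually_elim simp
    then show "c = Re (cumulant0 \<Lambda> Xs)" by simp
  qed
  \<comment> \<open>a cube whose semi-invariant equals the cumulant, which is therefore real\<close>
  moreover obtain N where "\<Lambda> \<subseteq> cube N" using finite_subset_cube[OF assms(1)] by blast
  ultimately show ?thesis using sinv by (metis Re_complex_of_real)
qed

lemma gibbs_cube_tendsto:
  fixes T :: "(int ^ 'n::finite) set"
  assumes "finite T" "\<bar>lam\<bar> < corr_radius CARD('n)"
  shows "of_real (limit_corr lam T) = (\<Sum>n. limit_coef T n * of_real lam ^ n)"
    and "(\<lambda>N. integral\<^sup>L (gibbs_cube lam N) (Qset T)) \<longlonglongrightarrow> limit_corr lam T"
proof -
  have z: "norm (complex_of_real lam) < corr_radius CARD('n)" using assms(2) by simp
  let ?l = "\<Sum>n. limit_coef T n * complex_of_real lam ^ n"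
  have "\<forall>\<^sub>F N in sequentially. volume_corr (cube N) (of_real lam) T = of_real (integral\<^sup>L (gibbs_cube lam N) (Qset T))"
    using eventually_subset_cube[OF assms(1)]
    by eventually_elim
       (simp only: volume_corr_def Qset_eq of_real_integral_gibbs_cube[OF depends_on_spin_prod])
  with volume_corr_tendsto(2)[OF assms(1) z]
  have lim: "(\<lambda>N. complex_of_real (integral\<^sup>L (gibbs_cube lam N) (Qset T))) \<longlonglongrightarrow> ?l"
    by (rule Lim_transform_eventually)
  from tendsto_Re[OF this] have re: "(\<lambda>N. integral\<^sup>L (gibbs_cube lam N) (Qset T)) \<longlonglongrightarrow> Re ?l" by simp
  have "limit_corr lam T = Re ?l"
    unfolding limit_corr_def semi_invariant_eq_cumulant cumulant_singleton by (rule limI[OF re])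
  moreover have "complex_of_real (Re ?l) = ?l"
    using tendsto_of_real[OF re] lim LIMSEQ_unique by blast
  ultimately show "of_real (limit_corr lam T) = ?l"
    "(\<lambda>N. integral\<^sup>L (gibbs_cube lam N) (Qset T)) \<longlonglongrightarrow> limit_corr lam T"
    using re by auto
qed

section \<open>The coefficients as sums over families\<close>

text \<open>
  A multiset \<open>\<gamma>\<close> of size \<open>n\<close> has \<open>fact n / family_fact \<gamma>\<close> enumerations.
\<close>
lemma sum_lists_eq_sum_multisets:
  fixes f :: "'a list \<Rightarrow> complex"
  assumes "finite B" and f: "\<And>xs ys. mset xs = mset ys \<Longrightarrow> f xs = f ys"
  shows "(\<Sum>xs | set xs \<subseteq> B \<and> length xs = n. f xs) / fact n =
    (\<Sum>\<gamma> | set_mset \<gamma> \<subseteq> B \<and> size \<gamma> = n. 1 / of_real (family_fact \<gamma>) * f (family_seq \<gamma>))"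
proof -
  let ?S = "{xs. set xs \<subseteq> B \<and> length xs = n}" and ?T = "{\<gamma>. set_mset \<gamma> \<subseteq> B \<and> size \<gamma> = n}"
  have finS: "finite ?S" by (rule finite_lists_length_eq[OF assms(1)])
  have T: "?T = mset ` ?S"
  proof (intro set_eqI iffI)
    fix \<gamma> assume "\<gamma> \<in> ?T"
    moreover obtain xs where xs: "mset xs = \<gamma>" using ex_mset by blast
    ultimately have "xs \<in> ?S" by (metis (mono_tags, lifting) mem_Collect_eq set_mset_mset size_mset)
    then show "\<gamma> \<in> mset ` ?S" using xs by blast
  qed auto
  have "(\<Sum>xs\<in>?S. f xs) = (\<Sum>\<gamma>\<in>?T. \<Sum>xs | xs \<in> ?S \<and> mset xs = \<gamma>. f xs)"
    by (rule sum.group[symmetric]) (use finS T in auto)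
  also have "\<dots> = (\<Sum>\<gamma>\<in>?T. fact n * (1 / of_real (family_fact \<gamma>) * f (family_seq \<gamma>)))"
  proof (rule sum.cong[OF refl])
    fix \<gamma> assume \<gamma>: "\<gamma> \<in> ?T"
    have seq: "mset (family_seq \<gamma>) = \<gamma>" unfolding family_seq_def by (rule someI_ex[OF ex_mset])
    have eq: "{xs. xs \<in> ?S \<and> mset xs = \<gamma>} = permutations_of_multiset \<gamma>"
      using \<gamma> by (auto simp: permutations_of_multiset_def)
    have "(\<Sum>xs | xs \<in> ?S \<and> mset xs = \<gamma>. f xs) = (\<Sum>xs\<in>permutations_of_multiset \<gamma>. f (family_seq \<gamma>))"
      unfolding eq by (intro sum.cong refl f) (auto simp: permutations_of_multiset_def seq)
    moreover have "of_nat (card (permutations_of_multiset \<gamma>)) * (of_real (family_fact \<gamma>) :: complex) = fact n"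
    proof -
      have "real (card (permutations_of_multiset \<gamma>)) * family_fact \<gamma> = fact n"
        using arg_cong[OF card_permutations_of_multiset_aux[of \<gamma>], of real] \<gamma>
        by (simp add: family_fact_def)
      from arg_cong[OF this, of complex_of_real] show ?thesis by simp
    qed
    moreover have "family_fact \<gamma> \<noteq> 0" by (simp add: family_fact_def)
    ultimately show "(\<Sum>xs | xs \<in> ?S \<and> mset xs = \<gamma>. f xs) = fact n * (1 / of_real (family_fact \<gamma>) * f (family_seq \<gamma>))"
      by (simp add: field_simps)
  qed
  finally show ?thesis by (simp add: sum_divide_distrib)
qed

lemma connects_iff:
  "connects \<gamma> b \<longleftrightarrow> (\<forall>u\<in>set b \<union> \<Union>(set_mset \<gamma>). \<forall>v\<in>set b \<union> \<Union>(set_mset \<gamma>). (u, v) \<in> (adj (set_mset \<gamma>))\<^sup>*)"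
proof -
  have "{(x, y). x \<in> set b \<union> \<Union>(set_mset \<gamma>) \<and> y \<in> set b \<union> \<Union>(set_mset \<gamma>) \<and> {x, y} \<in> set_mset \<gamma>} = adj (set_mset \<gamma>)"
    by (auto simp: adj_def)
  then show ?thesis unfolding connects_def connected_graph_def by simp
qed

lemma connectsI:
  assumes "\<Union>(set_mset \<gamma>) \<subseteq> (adj (set_mset \<gamma>))\<^sup>* `` {s, t}" "(s, t) \<in> (adj (set_mset \<gamma>))\<^sup>*"
  shows "connects \<gamma> [s, t]"
proof -
  have s: "(s, v) \<in> (adj (set_mset \<gamma>))\<^sup>*" if "v \<in> set [s, t] \<union> \<Union>(set_mset \<gamma>)" for v
    using that assms by (auto dest!: subsetD intro: rtrancl_trans)
  have "sym ((adj (set_mset \<gamma>))\<^sup>*)" by (rule sym_rtrancl[OF sym_adj])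
  then show ?thesis unfolding connects_iff using s by (meson rtrancl_trans symD)
qed

text \<open>
  The sum defining \<open>V\<close> is extended to all pairs of a family \<open>\<gamma>\<close> in a large cube and a point \<open>t \<noteq> 0\<close>: the additional
  pairs contribute zero, because a cumulant that does not vanish forces \<open>\<gamma>\<close> to connect \<open>0\<close> and \<open>t\<close>. For
  fixed \<open>t\<close> the families then assemble to the Taylor coefficient of the correlation of \<open>0\<close> and \<open>t\<close>.
\<close>
lemma V_eq:
  "of_real (V TYPE('n::finite) n) = (\<Sum>t\<in>cube (2 * n) - {0 :: int ^ 'n}. limit_coef {0, t} n)"
proof -
  \<comment> \<open>large enough for the pair \<open>0, t\<close> with \<open>t\<close> in \<open>cube (2 * n)\<close> and for \<open>n\<close> bonds connected to it\<close>
  define \<Lambda> where "\<Lambda> = (cube (2 * n + 2 * n) :: (int ^ 'n) set)"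
  define g where "g \<gamma> t = 1 / family_fact \<gamma> * semi_invariant_0 ([Q 0, Q t] @ map Phi (family_seq \<gamma>))"
    for \<gamma> and t :: "int ^ 'n"
  define \<Gamma> where "\<Gamma> = {\<gamma>. set_mset \<gamma> \<subseteq> bonds_in \<Lambda> \<and> size \<gamma> = n}"
  define \<Gamma>' where "\<Gamma>' = {\<gamma>. set_mset \<gamma> \<subseteq> bonds \<and> size \<gamma> = n \<and> connects \<gamma> [0 :: int ^ 'n]}"
  define U where "U \<gamma> = {t. t \<in> \<Union>(set_mset \<gamma>) \<and> t \<noteq> 0 \<and> connects \<gamma> [0, t]}" for \<gamma> :: "(int ^ 'n) set multiset"
  let ?c = "cube (2 * n) - {0 :: int ^ 'n}"
  have fin\<Lambda>: "finite \<Lambda>" unfolding \<Lambda>_def by (rule finite_cube)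
  have c\<Lambda>: "cube (2 * n) \<subseteq> \<Lambda>" unfolding \<Lambda>_def by (rule cube_mono) simp
  have zero: "0 \<in> (cube m :: (int ^ 'n) set)" for m by (simp add: cube_def)
  have seq: "mset (family_seq \<gamma>) = \<gamma>" for \<gamma> :: "(int ^ 'n) set multiset"
    unfolding family_seq_def by (rule someI_ex[OF ex_mset])
  have sset: "set (family_seq \<gamma>) = set_mset \<gamma>" for \<gamma> :: "(int ^ 'n) set multiset"
    using seq by (metis set_mset_mset)
  have fin\<Gamma>: "finite \<Gamma>"
  proof -
    have "\<Gamma> \<subseteq> mset ` {xs. set xs \<subseteq> bonds_in \<Lambda> \<and> length xs = n}"
      unfolding \<Gamma>_def by (auto simp: image_iff) (metis seq sset size_mset)
    then show ?thesis
      by (rule finite_subset) (intro finite_imageI finite_lists_length_eq finite_bonds_in fin\<Lambda>)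
  qed
  \<comment> \<open>a family that connects the origin has all its points in \<open>cube (2 * n)\<close>\<close>
  have in_cube: "v \<in> cube (2 * n)" if "(0, v) \<in> (adj (set_mset \<gamma>))\<^sup>*" "set_mset \<gamma> \<subseteq> bonds" "size \<gamma> = n"
    for \<gamma> and v :: "int ^ 'n"
  proof -
    have "card (set_mset \<gamma>) \<le> n" using card_length[of "family_seq \<gamma>"] sset[of \<gamma>] seq[of \<gamma>] that(3)
      by (metis size_mset)
    then have "\<bar>v $ i\<bar> \<le> int (2 * n)" for i
      using bond_path_bound[OF _ that(2,1), of i] by simp
    then show ?thesis by (simp add: cube_def)
  qed
  have dep: "depends_on \<Lambda> X" if "\<gamma> \<in> \<Gamma>" "t \<in> ?c" "X \<in> set ([Q 0, Q t] @ map Phi (family_seq \<gamma>))" for X t \<gamma>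
    using that c\<Lambda> zero unfolding Q_eq Phi_eq \<Gamma>_def
    by (auto intro!: depends_on_spin_prod simp: sset bonds_in_def)
  have k: "of_real (g \<gamma> t) = 1 / of_real (family_fact \<gamma>) *
      cumulant0 \<Lambda> (spin_prod {0, t} # map spin_prod (family_seq \<gamma>))" if \<gamma>t: "\<gamma> \<in> \<Gamma>" "t \<in> ?c" for \<gamma> t
  proof -
    have "of_real (semi_invariant_0 ([Q 0, Q t] @ map Phi (family_seq \<gamma>))) =
      cumulant0 \<Lambda> ([Q 0, Q t] @ map Phi (family_seq \<gamma>))"
      by (rule semi_invariant_0_eq[OF fin\<Lambda> dep[OF \<gamma>t]])
    also have "\<dots> = cumulant0 \<Lambda> (spin_prod {0} # spin_prod {t} # map spin_prod (family_seq \<gamma>))"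
      by (simp add: Q_eq Phi_eq)
    also have "\<dots> = cumulant0 \<Lambda> (spin_prod {0, t} # map spin_prod (family_seq \<gamma>))"
      by (rule cumulant0_pair[OF fin\<Lambda>]) (use \<gamma>t c\<Lambda> zero in \<open>auto simp: sset \<Gamma>_def\<close>)
    finally show ?thesis unfolding g_def by simp
  qed
  have lc: "limit_coef {0, t} n = of_real (\<Sum>\<gamma>\<in>\<Gamma>. g \<gamma> t)" if t: "t \<in> ?c" for t
  proof -
    have "limit_coef {0, t} n = volume_coef \<Lambda> {0, t} n"
      by (rule limit_coef_eq[OF fin\<Lambda>, of _ "2 * n"]) (use t zero in \<open>auto simp: \<Lambda>_def\<close>)
    also have "\<dots> = (\<Sum>\<gamma> | set_mset \<gamma> \<subseteq> bonds_in \<Lambda> \<and> size \<gamma> = n.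
       1 / of_real (family_fact \<gamma>) * cumulant0 \<Lambda> (spin_prod {0, t} # map spin_prod (family_seq \<gamma>)))"
      unfolding volume_coef_eq[OF fin\<Lambda>]
    proof (rule sum_lists_eq_sum_multisets[OF finite_bonds_in[OF fin\<Lambda>]])
      fix xs ys :: "(int ^ 'n) set list" assume "mset xs = mset ys"
      then have "mset (spin_prod {0, t} # map spin_prod xs) = mset (spin_prod {0, t} # map spin_prod ys)" by simp
      then show "cumulant0 \<Lambda> (spin_prod {0, t} # map spin_prod xs) = cumulant0 \<Lambda> (spin_prod {0, t} # map spin_prod ys)"
        unfolding cumulant0_def by (rule cumulant_permute)
    qed
    also have "\<dots> = (\<Sum>\<gamma>\<in>\<Gamma>. of_real (g \<gamma> t))"
      unfolding \<Gamma>_def[symmetric] by (intro sum.cong refl k[symmetric] t)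
    finally show ?thesis by simp
  qed
  have nz: "\<gamma> \<in> \<Gamma>' \<and> t \<in> U \<gamma>" if \<gamma>t: "\<gamma> \<in> \<Gamma>" "t \<in> ?c" and "g \<gamma> t \<noteq> 0" for \<gamma> t
  proof -
    have c0: "cumulant0 \<Lambda> (spin_prod {0, t} # map spin_prod (family_seq \<gamma>)) \<noteq> 0"
      using k[OF \<gamma>t] \<open>g \<gamma> t \<noteq> 0\<close> by auto
    have s: "{0, t} \<subseteq> \<Lambda>" "0 \<noteq> t" "set (family_seq \<gamma>) \<subseteq> bonds_in \<Lambda>"
      using \<gamma>t c\<Lambda> zero by (auto simp: sset \<Gamma>_def)
    have p: "(0, t) \<in> (adj (set_mset \<gamma>))\<^sup>*"
      using cumulant0_nonzero_imp_connected[OF fin\<Lambda> s c0] by (simp add: sset)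
    have con: "connects \<gamma> [0, t]"
      by (rule connectsI[OF _ p]) (use cumulant0_nonzero_imp_cluster[OF fin\<Lambda> s(1,3) c0] in \<open>simp add: sset\<close>)
    have tU: "t \<in> \<Union>(set_mset \<gamma>)"
      using cluster_subset[of "set_mset \<gamma>" "{0}"] p s(2) by auto
    then have "connects \<gamma> [0]" using con unfolding connects_iff by auto
    then show ?thesis using con tU s \<gamma>t unfolding \<Gamma>'_def U_def \<Gamma>_def by (auto simp: bonds_in_def)
  qed
  have \<Gamma>'\<Gamma>: "\<gamma> \<in> \<Gamma>" "U \<gamma> \<subseteq> ?c" if "\<gamma> \<in> \<Gamma>'" for \<gamma>
  proof -
    have \<gamma>: "set_mset \<gamma> \<subseteq> bonds" "size \<gamma> = n" "connects \<gamma> [0]" using that by (auto simp: \<Gamma>'_def)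
    have v: "v \<in> cube (2 * n)" if "v \<in> \<Union>(set_mset \<gamma>)" for v
      by (rule in_cube[OF _ \<gamma>(1,2)]) (use \<gamma>(3) that in \<open>auto simp: connects_iff\<close>)
    show "\<gamma> \<in> \<Gamma>" using \<gamma> v c\<Lambda> unfolding \<Gamma>_def bonds_in_def by blast
    show "U \<gamma> \<subseteq> ?c" using v unfolding U_def by blast
  qed
  have finc: "finite ?c" using finite_cube by auto
  have "V TYPE('n) n = (\<Sum>\<gamma>\<in>\<Gamma>'. \<Sum>t\<in>U \<gamma>. g \<gamma> t)"
    unfolding V_def \<Gamma>'_def U_def g_def ..
  also have "\<dots> = (\<Sum>(\<gamma>, t)\<in>Sigma \<Gamma>' U. g \<gamma> t)"
    by (rule sum.Sigma) (use \<Gamma>'\<Gamma> fin\<Gamma> finc finite_subset in \<open>blast intro: finite_subset\<close>)+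
  also have "\<dots> = (\<Sum>(\<gamma>, t)\<in>\<Gamma> \<times> ?c. g \<gamma> t)"
    by (rule sum.mono_neutral_left) (use \<Gamma>'\<Gamma> fin\<Gamma> finc nz in auto)
  also have "\<dots> = (\<Sum>\<gamma>\<in>\<Gamma>. \<Sum>t\<in>?c. g \<gamma> t)"
    by (rule sum.cartesian_product[symmetric])
  also have "\<dots> = (\<Sum>t\<in>?c. \<Sum>\<gamma>\<in>\<Gamma>. g \<gamma> t)" by (rule sum.swap)
  finally show ?thesis by (simp add: lc)
qed

lemma limit_coef_far:
  assumes "t \<noteq> 0" "t \<notin> cube (2 * n)"
  shows "limit_coef {0, t :: int ^ 'n::finite} n = 0"
proof -
  obtain m where m: "{0, t} \<subseteq> cube m" using finite_subset_cube[of "{0, t}"] by blast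
  define \<Lambda> where "\<Lambda> = (cube (m + 2 * n) :: (int ^ 'n) set)"
  have fin: "finite \<Lambda>" unfolding \<Lambda>_def by (rule finite_cube)
  have sub: "{0, t} \<subseteq> \<Lambda>" using m cube_mono[of m "m + 2 * n"] unfolding \<Lambda>_def by auto
  have "cumulant0 \<Lambda> (spin_prod {0, t} # map spin_prod As) = 0"
    if As: "set As \<subseteq> bonds_in \<Lambda>" "length As = n" for As
  proof (rule ccontr)
    assume nz: "cumulant0 \<Lambda> (spin_prod {0, t} # map spin_prod As) \<noteq> 0"
    have p: "(0, t) \<in> (adj (set As))\<^sup>*"
      by (rule cumulant0_nonzero_imp_connected[OF fin sub _ As(1) nz]) (use assms(1) in simp)
    have "set As \<subseteq> bonds" using As by (auto simp: bonds_in_def)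
    then have "\<bar>t $ i\<bar> \<le> int (2 * n)" for i
      using bond_path_bound[OF _ _ p, of i] card_length[of As] As(2) by simp
    then show False using assms(2) by (simp add: cube_def)
  qed
  then have "volume_coef \<Lambda> {0, t} n = 0" unfolding volume_coef_eq[OF fin] by simp
  then show ?thesis using limit_coef_eq[OF fin m] unfolding \<Lambda>_def by simp
qed

section \<open>Marginals of the limiting Gibbs measure\<close>

text \<open>
  The probability that \<open>D\<close> is the set of minus spins among the spins in \<open>J\<close>, by Fourier inversion
  on the group of spin configurations in \<open>J\<close>.
\<close>
definition marginal :: "real \<Rightarrow> (int ^ 'n::finite) set \<Rightarrow> (int ^ 'n) set \<Rightarrow> real" where
  "marginal lam J D = (\<Sum>T\<in>Pow J. spin_prod T (spins D) * limit_corr lam T) / 2 ^ card J"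

definition cube_marginal :: "real \<Rightarrow> nat \<Rightarrow> (int ^ 'n::finite) set \<Rightarrow> (int ^ 'n) set \<Rightarrow> real" where
  "cube_marginal lam N J D = (\<Sum>D' | D' \<subseteq> cube N \<and> D' \<inter> J = D. weight lam N D')"

lemma sum_weight: "(\<Sum>D\<in>Pow (cube N :: (int ^ 'n::finite) set). weight lam N D) = 1"
proof -
  have "(\<Sum>D\<in>Pow (cube N :: (int ^ 'n) set). exp (lam * (\<Sum>A\<in>bonds_in (cube N). spin_prod A (spins D)))) > 0"
    by (rule sum_pos) (auto simp: finite_cube)
  then show ?thesis unfolding weight_def by (simp flip: sum_divide_distrib)
qed

text \<open>
  Fourier inversion: the right-hand side is the product of the factors
  \<open>(1 + spins D t * spins D' t) / 2\<close> over \<open>t \<in> J\<close>, and a factor is \<open>1\<close> if the two spins agree and \<open>0\<close> otherwise.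
\<close>
lemma indicator_spins:
  assumes "finite J" "D \<subseteq> J"
  shows "(if D' \<inter> J = D then 1 else 0 :: real) =
    (\<Sum>T\<in>Pow J. spin_prod T (spins D) * spin_prod T (spins D')) / 2 ^ card J"
proof -
  have "(\<Sum>T\<in>Pow J. spin_prod T (spins D) * spin_prod T (spins D')) = (\<Sum>T\<in>Pow J. \<Prod>t\<in>T. spins D t * spins D' t)"
    by (simp add: spin_prod_def prod.distrib)
  also have "\<dots> = (\<Prod>t\<in>J. 1 + spins D t * spins D' t)"
    using prod_add[OF assms(1), of "\<lambda>t. spins D t * spins D' t" "\<lambda>_. 1"] by (simp add: add.commute)
  also have "\<dots> = (\<Prod>t\<in>J. if t \<in> D \<longleftrightarrow> t \<in> D' then 2 else 0)"
    by (intro prod.cong refl) (simp add: spins_def)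
  also have "\<dots> = (if D' \<inter> J = D then 2 ^ card J else 0)"
  proof (cases "D' \<inter> J = D")
    case True
    then have "(\<Prod>t\<in>J. if t \<in> D \<longleftrightarrow> t \<in> D' then 2 else (0::real)) = (\<Prod>t\<in>J. 2)"
      by (intro prod.cong refl) auto
    then show ?thesis using True by simp
  next
    case False
    then obtain t where "t \<in> J" "\<not> (t \<in> D \<longleftrightarrow> t \<in> D')" using assms(2) by blast
    then have "\<exists>t\<in>J. (if t \<in> D \<longleftrightarrow> t \<in> D' then 2 else (0::real)) = 0" by (intro bexI[of _ t]) auto
    then have "(\<Prod>t\<in>J. if t \<in> D \<longleftrightarrow> t \<in> D' then 2 else (0::real)) = 0"
      by (rule prod_zero[OF assms(1)])
    then show ?thesis using False by simp
  qed
  finally show ?thesis by simp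
qed

lemma cube_marginal_eq:
  fixes J :: "(int ^ 'n::finite) set"
  assumes "J \<subseteq> cube N" "D \<subseteq> J"
  shows "cube_marginal lam N J D =
    (\<Sum>T\<in>Pow J. spin_prod T (spins D) * integral\<^sup>L (gibbs_cube lam N) (Qset T)) / 2 ^ card J"
proof -
  have fin: "finite J" using assms(1) finite_cube finite_subset by blast
  have "cube_marginal lam N J D = (\<Sum>D' | D' \<in> Pow (cube N) \<and> D' \<inter> J = D. weight lam N D')"
    unfolding cube_marginal_def by simp
  also have "\<dots> = (\<Sum>D'\<in>Pow (cube N). if D' \<inter> J = D then weight lam N D' else 0)"
    by (rule sum.inter_filter) (simp add: finite_cube)
  also have "\<dots> = (\<Sum>D'\<in>Pow (cube N). weight lam N D' * (if D' \<inter> J = D then 1 else 0))"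
    by (intro sum.cong refl) simp
  also have "\<dots> = (\<Sum>D'\<in>Pow (cube N). \<Sum>T\<in>Pow J. spin_prod T (spins D) * (weight lam N D' * spin_prod T (spins D'))) / 2 ^ card J"
    unfolding indicator_spins[OF fin assms(2)] by (simp add: sum_distrib_left sum_divide_distrib mult_ac)
  also have "\<dots> = (\<Sum>T\<in>Pow J. spin_prod T (spins D) * (\<Sum>D'\<in>Pow (cube N). weight lam N D' * spin_prod T (spins D'))) / 2 ^ card J"
    by (subst sum.swap) (simp add: sum_distrib_left)
  also have "\<dots> = (\<Sum>T\<in>Pow J. spin_prod T (spins D) * integral\<^sup>L (gibbs_cube lam N) (Qset T)) / 2 ^ card J"
  proof (intro arg_cong2[where f = "(/)"] sum.cong refl arg_cong2[where f = "(*)"])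
    fix T assume "T \<in> Pow J"
    then have "depends_on (cube N) (Qset T)" unfolding Qset_eq using assms(1) by (intro depends_on_spin_prod) auto
    from integral_gibbs_cube[OF this]
    show "(\<Sum>D'\<in>Pow (cube N). weight lam N D' * spin_prod T (spins D')) = integral\<^sup>L (gibbs_cube lam N) (Qset T)"
      by (simp add: Qset_eq)
  qed
  finally show ?thesis .
qed

lemma cube_marginal_tendsto:
  fixes J :: "(int ^ 'n::finite) set"
  assumes "\<bar>lam\<bar> < corr_radius CARD('n)" "finite J" "D \<subseteq> J"
  shows "(\<lambda>N. cube_marginal lam N J D) \<longlonglongrightarrow> marginal lam J D"
proof -
  have "(\<lambda>N. (\<Sum>T\<in>Pow J. spin_prod T (spins D) * integral\<^sup>L (gibbs_cube lam N) (Qset T)) / 2 ^ card J)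
     \<longlonglongrightarrow> marginal lam J D"
    unfolding marginal_def
    by (intro tendsto_divide tendsto_sum tendsto_mult tendsto_const gibbs_cube_tendsto(2))
       (use assms finite_subset in auto)
  moreover have "\<forall>\<^sub>F N in sequentially. (\<Sum>T\<in>Pow J. spin_prod T (spins D) * integral\<^sup>L (gibbs_cube lam N) (Qset T)) / 2 ^ card J
      = cube_marginal lam N J D"
    using eventually_subset_cube[OF assms(2)]
    by (rule eventually_mono) (rule cube_marginal_eq[OF _ assms(3), symmetric])
  ultimately show ?thesis by (rule Lim_transform_eventually)
qed

lemma marginal_nonneg:
  fixes J :: "(int ^ 'n::finite) set"
  assumes "\<bar>lam\<bar> < corr_radius CARD('n)" "finite J" "D \<subseteq> J"
  shows "0 \<le> marginal lam J D"
  by (rule LIMSEQ_le_const[OF cube_marginal_tendsto[OF assms]])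
     (auto simp: cube_marginal_def intro!: sum_nonneg weight_nonneg)

lemma cube_marginal_consistent:
  fixes J H :: "(int ^ 'n::finite) set"
  assumes "finite H" "J \<subseteq> H"
  shows "(\<Sum>D' | D' \<subseteq> H \<and> D' \<inter> J = D. cube_marginal lam N H D') = cube_marginal lam N J D"
proof -
  have "cube_marginal lam N J D = (\<Sum>D' | D' \<subseteq> H \<and> D' \<inter> J = D.
      \<Sum>D'' | D'' \<in> {D''. D'' \<subseteq> cube N \<and> D'' \<inter> J = D} \<and> D'' \<inter> H = D'. weight lam N D'')"
    unfolding cube_marginal_def
    by (rule sum.group[symmetric, where g = "\<lambda>D''. D'' \<inter> H"])
       (use assms finite_cube in \<open>auto intro: finite_subset[of _ "Pow (cube N)"]\<close>)
  also have "\<dots> = (\<Sum>D' | D' \<subseteq> H \<and> D' \<inter> J = D. cube_marginal lam N H D')"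
    unfolding cube_marginal_def
    by (intro sum.cong refl) (use assms(2) in auto)
  finally show ?thesis ..
qed

text \<open>
  Consistency holds for the marginals in each cube and passes to the limit.
\<close>
lemma marginal_consistent:
  fixes J H :: "(int ^ 'n::finite) set"
  assumes lam: "\<bar>lam\<bar> < corr_radius CARD('n)" and "finite H" "J \<subseteq> H" "D \<subseteq> J"
  shows "(\<Sum>D' | D' \<subseteq> H \<and> D' \<inter> J = D. marginal lam H D') = marginal lam J D"
proof (rule LIMSEQ_unique)
  have "finite J" using assms finite_subset by auto
  from cube_marginal_tendsto[OF lam this assms(4)]
  show "(\<lambda>N. cube_marginal lam N J D) \<longlonglongrightarrow> marginal lam J D" .
  show "(\<lambda>N. cube_marginal lam N J D) \<longlonglongrightarrow> (\<Sum>D' | D' \<subseteq> H \<and> D' \<inter> J = D. marginal lam H D')"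
    unfolding cube_marginal_consistent[OF assms(2,3), symmetric]
    by (intro tendsto_sum cube_marginal_tendsto[OF lam assms(2)]) auto
qed

lemma marginal_empty:
  assumes "\<bar>lam\<bar> < corr_radius CARD('n::finite)"
  shows "marginal lam {} ({} :: (int ^ 'n) set) = 1"
proof (rule LIMSEQ_unique)
  show "(\<lambda>N. cube_marginal lam N {} ({} :: (int ^ 'n) set)) \<longlonglongrightarrow> marginal lam {} ({} :: (int ^ 'n) set)"
    by (rule cube_marginal_tendsto[OF assms]) auto
  have "cube_marginal lam N {} ({} :: (int ^ 'n) set) = 1" for N
    using sum_weight[where 'n = 'n and N = N and lam = lam] unfolding cube_marginal_def by (simp add: Pow_def)
  then show "(\<lambda>N. cube_marginal lam N {} ({} :: (int ^ 'n) set)) \<longlonglongrightarrow> 1" by simp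
qed

lemma sum_marginal:
  fixes J :: "(int ^ 'n::finite) set"
  assumes "\<bar>lam\<bar> < corr_radius CARD('n)" "finite J"
  shows "(\<Sum>D\<in>Pow J. marginal lam J D) = 1"
  using marginal_consistent[OF assms, of "{}" "{}"] marginal_empty[OF assms(1)] by (simp add: Pow_def)

lemma sum_marginal_spin_prod:
  fixes T :: "(int ^ 'n::finite) set"
  assumes lam: "\<bar>lam\<bar> < corr_radius CARD('n)" and T: "finite T"
  shows "(\<Sum>D\<in>Pow T. spin_prod T (spins D) * marginal lam T D) = limit_corr lam T"
proof (rule LIMSEQ_unique)
  show "(\<lambda>N. \<Sum>D\<in>Pow T. spin_prod T (spins D) * cube_marginal lam N T D)
     \<longlonglongrightarrow> (\<Sum>D\<in>Pow T. spin_prod T (spins D) * marginal lam T D)"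
    by (intro tendsto_sum tendsto_mult tendsto_const cube_marginal_tendsto[OF lam T]) auto
  have eq: "integral\<^sup>L (gibbs_cube lam N) (Qset T) = (\<Sum>D\<in>Pow T. spin_prod T (spins D) * cube_marginal lam N T D)"
    if N: "T \<subseteq> cube N" for N
  proof -
    have "integral\<^sup>L (gibbs_cube lam N) (Qset T) = (\<Sum>D'\<in>Pow (cube N). weight lam N D' * spin_prod T (spins D'))"
      using integral_gibbs_cube[of N "Qset T"] depends_on_spin_prod[OF N] by (simp add: Qset_eq)
    also have "\<dots> = (\<Sum>D\<in>Pow T. \<Sum>D' | D' \<in> Pow (cube N) \<and> D' \<inter> T = D. weight lam N D' * spin_prod T (spins D'))"
      by (rule sum.group[symmetric, where g = "\<lambda>D'. D' \<inter> T"]) (use T finite_cube in auto)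
    also have "\<dots> = (\<Sum>D\<in>Pow T. spin_prod T (spins D) * cube_marginal lam N T D)"
      unfolding cube_marginal_def sum_distrib_left
    proof (rule sum.cong[OF refl], rule sum.cong)
      fix D D' assume "D' \<in> {D'. D' \<subseteq> cube N \<and> D' \<inter> T = D}"
      then have "spin_prod T (spins D') = spin_prod T (spins D)"
        unfolding spin_prod_def spins_def by (intro prod.cong) auto
      then show "weight lam N D' * spin_prod T (spins D') = spin_prod T (spins D) * weight lam N D'" by simp
    qed auto
    finally show ?thesis .
  qed
  show "(\<lambda>N. \<Sum>D\<in>Pow T. spin_prod T (spins D) * cube_marginal lam N T D) \<longlonglongrightarrow> limit_corr lam T"
    by (rule Lim_transform_eventually[OF gibbs_cube_tendsto(2)[OF T lam]])
       (use eventually_subset_cube[OF T] eq in \<open>auto elim: eventually_mono\<close>)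
qed

section \<open>Existence and uniqueness of the limiting Gibbs measure\<close>

definition marginal_measure :: "real \<Rightarrow> (int ^ 'n::finite) set \<Rightarrow> 'n config measure" where
  "marginal_measure lam J = distr (point_measure (Pow J) (\<lambda>D. ennreal (marginal lam J D)))
     (PiM J (\<lambda>_. borel)) (\<lambda>D. restrict (spins D) J)"

lemma measurable_restrict_spins:
  "(\<lambda>D. restrict (spins D) J) \<in> point_measure (Pow H) f \<rightarrow>\<^sub>M PiM J (\<lambda>_. borel)"
  unfolding measurable_point_measure_eq1 by (auto simp: space_PiM)

lemma emeasure_marginal_measure:
  assumes "finite J" "X \<in> sets (PiM J (\<lambda>_. borel))"
  shows "emeasure (marginal_measure lam J) X =
    (\<Sum>D | D \<in> Pow J \<and> restrict (spins D) J \<in> X. ennreal (marginal lam J D))"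
proof -
  have "emeasure (marginal_measure lam J) X = emeasure (point_measure (Pow J) (\<lambda>D. ennreal (marginal lam J D)))
     {D \<in> Pow J. restrict (spins D) J \<in> X}"
    unfolding marginal_measure_def
    by (subst emeasure_distr[OF measurable_restrict_spins assms(2)])
       (auto simp: space_point_measure intro!: arg_cong2[where f = emeasure])
  also have "\<dots> = (\<Sum>D | D \<in> Pow J \<and> restrict (spins D) J \<in> X. ennreal (marginal lam J D))"
    by (rule emeasure_point_measure_finite) (use assms in auto)
  finally show ?thesis .
qed

lemma projective_marginal_measure:
  assumes lam: "\<bar>lam\<bar> < corr_radius CARD('n::finite)"
  shows "polish_projective UNIV (marginal_measure lam :: (int ^ 'n) set \<Rightarrow> 'n config measure)"
proof (rule polish_projective.intro, rule projective_family.intro)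
  fix J H :: "(int ^ 'n) set" assume JH: "J \<subseteq> H" "finite H"
  then have J: "finite J" using finite_subset by auto
  have r: "(\<lambda>f. restrict f J) \<in> marginal_measure lam H \<rightarrow>\<^sub>M PiM J (\<lambda>_. borel)"
    unfolding marginal_measure_def using JH(1) by (simp add: measurable_restrict_subset)
  show "marginal_measure lam J = distr (marginal_measure lam H) (PiM J (\<lambda>_. borel)) (\<lambda>f. restrict f J)"
  proof (rule measure_eqI)
    fix X assume "X \<in> sets (marginal_measure lam J)"
    then have X: "X \<in> sets (PiM J (\<lambda>_. borel))" by (simp add: marginal_measure_def)
    let ?X' = "(\<lambda>f. restrict f J) -` X \<inter> space (PiM H (\<lambda>_. borel))"
    have X': "?X' \<in> sets (PiM H (\<lambda>_. borel))"
      by (rule measurable_sets[OF measurable_restrict_subset[OF JH(1)] X])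
    have sp: "restrict (spins D) H \<in> space (PiM H (\<lambda>_. borel))" for D :: "(int ^ 'n) set"
      by (simp add: space_PiM)
    have rr: "restrict (restrict (spins D) H) J = restrict (spins (D \<inter> J)) J" for D :: "(int ^ 'n) set"
      using JH(1) by (auto simp: fun_eq_iff spins_def restrict_def)
    have "emeasure (distr (marginal_measure lam H) (PiM J (\<lambda>_. borel)) (\<lambda>f. restrict f J)) X =
      emeasure (marginal_measure lam H) ?X'"
      by (subst emeasure_distr[OF r X]) (simp add: marginal_measure_def)
    also have "\<dots> = (\<Sum>D' | D' \<in> Pow H \<and> restrict (spins D') H \<in> ?X'. ennreal (marginal lam H D'))"
      by (rule emeasure_marginal_measure[OF JH(2) X'])
    also have "\<dots> = (\<Sum>D' | D' \<in> Pow H \<and> restrict (spins (D' \<inter> J)) J \<in> X. ennreal (marginal lam H D'))"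
      by (intro sum.cong refl Collect_cong) (simp only: vimage_eq Int_iff sp rr simp_thms)
    also have "\<dots> = (\<Sum>D | D \<in> Pow J \<and> restrict (spins D) J \<in> X.
        \<Sum>D' | D' \<in> {D' \<in> Pow H. restrict (spins (D' \<inter> J)) J \<in> X} \<and> D' \<inter> J = D. ennreal (marginal lam H D'))"
      by (rule sum.group[symmetric, where g = "\<lambda>D'. D' \<inter> J"]) (use J JH in auto)
    also have "\<dots> = (\<Sum>D | D \<in> Pow J \<and> restrict (spins D) J \<in> X. ennreal (marginal lam J D))"
    proof (intro sum.cong refl)
      fix D assume D: "D \<in> {D \<in> Pow J. restrict (spins D) J \<in> X}"
      have "(\<Sum>D' | D' \<in> {D' \<in> Pow H. restrict (spins (D' \<inter> J)) J \<in> X} \<and> D' \<inter> J = D. ennreal (marginal lam H D'))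
        = (\<Sum>D' | D' \<subseteq> H \<and> D' \<inter> J = D. ennreal (marginal lam H D'))"
        using D by (intro sum.cong) auto
      also have "\<dots> = ennreal (\<Sum>D' | D' \<subseteq> H \<and> D' \<inter> J = D. marginal lam H D')"
        by (rule sum_ennreal) (use marginal_nonneg[OF lam JH(2)] in auto)
      also have "\<dots> = ennreal (marginal lam J D)"
        using marginal_consistent[OF lam JH(2,1)] D by simp
      finally show "(\<Sum>D' | D' \<in> {D' \<in> Pow H. restrict (spins (D' \<inter> J)) J \<in> X} \<and> D' \<inter> J = D. ennreal (marginal lam H D'))
        = ennreal (marginal lam J D)" .
    qed
    also have "\<dots> = emeasure (marginal_measure lam J) X"
      by (rule emeasure_marginal_measure[OF J X, symmetric])
    finally show "emeasure (marginal_measure lam J) X =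
      emeasure (distr (marginal_measure lam H) (PiM J (\<lambda>_. borel)) (\<lambda>f. restrict f J)) X" ..
  qed (simp add: marginal_measure_def)
next
  fix J :: "(int ^ 'n) set" assume J: "finite J"
  show "prob_space (marginal_measure lam J)"
  proof
    have "emeasure (marginal_measure lam J) (space (marginal_measure lam J)) =
      (\<Sum>D | D \<in> Pow J \<and> restrict (spins D) J \<in> space (PiM J (\<lambda>_. borel :: real measure)). ennreal (marginal lam J D))"
      using emeasure_marginal_measure[OF J sets.top] by (simp add: marginal_measure_def)
    also have "\<dots> = (\<Sum>D\<in>Pow J. ennreal (marginal lam J D))"
      by (intro sum.cong) (auto simp: space_PiM)
    also have "\<dots> = ennreal (\<Sum>D\<in>Pow J. marginal lam J D)"
      by (rule sum_ennreal) (use marginal_nonneg[OF lam J] in auto)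
    finally show "emeasure (marginal_measure lam J) (space (marginal_measure lam J)) = 1"
      unfolding sum_marginal[OF lam J] by simp
  qed
qed

abbreviation cylinders :: "('n::finite) config set set" where
  "cylinders \<equiv> {cylinder T a | T a. finite T \<and> a \<in> T \<rightarrow> {-1, 1}}"

lemma cylinders_subset: "cylinders \<subseteq> Pow Omega"
  by (auto simp: cylinder_def)

text \<open>
  The formula that defines the limiting measure, rewritten with
  \<open>(\<Prod>t\<in>T. a t) * (\<Prod>t\<in>T - T'. a t) = (\<Prod>t\<in>T'. a t)\<close>.
\<close>
lemma marginal_formula:
  assumes "finite T" "a \<in> T \<rightarrow> {-1, 1}"
  shows "(-1) ^ card {t \<in> T. a t = -1} / 2 ^ card T *
      (\<Sum>T'\<in>Pow T. limit_corr lam T' * (\<Prod>t\<in>T - T'. a t)) = marginal lam T {t \<in> T. a t = -1}"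
proof -
  let ?D = "{t \<in> T. a t = -1}"
  have a: "a t = spins ?D t" if "t \<in> T" for t using that assms(2) by (auto simp: spins_def)
  have "(-1) ^ card ?D * (\<Prod>t\<in>T - T'. a t) = spin_prod T' (spins ?D)" if "T' \<in> Pow T" for T'
  proof -
    have "(\<Prod>t\<in>T - T'. a t) = spin_prod (T - T') (spins ?D)"
      unfolding spin_prod_def by (intro prod.cong refl a) auto
    moreover have "(-1) ^ card ?D = spin_prod T (spins ?D)"
      unfolding spin_prod_spins[OF assms(1)] by (simp add: Int_absorb1)
    moreover have "sym_diff T (T - T') = T'" using that by auto
    ultimately show ?thesis using spin_prod_sym_diff[of T "T - T'"] assms(1) by simp
  qed
  then have "(-1) ^ card ?D * (limit_corr lam T' * (\<Prod>t\<in>T - T'. a t)) = spin_prod T' (spins ?D) * limit_corr lam T'"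
    if "T' \<in> Pow T" for T' using that by (simp add: mult.left_commute mult.commute)
  then have "(-1) ^ card ?D * (\<Sum>T'\<in>Pow T. limit_corr lam T' * (\<Prod>t\<in>T - T'. a t)) =
    (\<Sum>T'\<in>Pow T. spin_prod T' (spins ?D) * limit_corr lam T')"
    unfolding sum_distrib_left by (intro sum.cong refl)
  then show ?thesis unfolding marginal_def times_divide_eq_left by simp
qed

text \<open>
  The Kolmogorov extension lives on all real-valued functions. It is pushed forward to \<open>Omega\<close>
  by a map that rounds every value to a spin and does not change the probabilities of cylinders.
\<close>
lemma is_limit_gibbs_exists:
  assumes lam: "\<bar>lam\<bar> < corr_radius CARD('n::finite)"
  shows "\<exists>M :: 'n config measure. is_limit_gibbs lam M"
proof -
  interpret polish_projective UNIV "marginal_measure lam :: (int ^ 'n) set \<Rightarrow> 'n config measure"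
    by (rule projective_marginal_measure[OF lam])
  define g where "g \<omega> t = (if \<omega> t = -1 then -1 else 1 :: real)" for \<omega> :: "'n config" and t
  define M where "M = distr lim (sigma Omega cylinders) g"
  \<comment> \<open>the values that \<open>g\<close> rounds to \<open>a t\<close>, for every \<open>t\<close>\<close>
  define X where "X T a = PiE T (\<lambda>t. if a t = -1 then {-1} else - {-1 :: real})" for T and a :: "'n config"
  have X: "X T a \<in> sets (PiM T (\<lambda>_. borel))" if "finite T" for T a
    unfolding X_def by (rule sets_PiM_I_finite[OF that]) auto
  have vim: "g -` cylinder T a \<inter> space lim = emb UNIV T (X T a)" if "a \<in> T \<rightarrow> {-1, 1}" for T a
  proof -
    have "g \<omega> \<in> cylinder T a \<longleftrightarrow> restrict \<omega> T \<in> X T a" for \<omega>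
    proof -
      have "g \<omega> t = a t \<longleftrightarrow> \<omega> t \<in> (if a t = -1 then {-1} else - {-1})" if "t \<in> T" for t
        using that \<open>a \<in> T \<rightarrow> {-1, 1}\<close> by (auto simp: g_def)
      moreover have "g \<omega> \<in> Omega" by (simp add: g_def Omega_def)
      ultimately show ?thesis unfolding cylinder_def X_def restrict_PiE_iff by simp
    qed
    then show ?thesis unfolding prod_emb_def space_lim by (auto simp: space_PiM)
  qed
  have g: "g \<in> lim \<rightarrow>\<^sub>M sigma Omega cylinders"
  proof (rule measurable_measure_of[OF cylinders_subset])
    show "g \<in> space lim \<rightarrow> Omega" by (auto simp: g_def Omega_def)
    fix A assume "A \<in> (cylinders :: 'n config set set)"
    then obtain T a where T: "A = cylinder T a" "finite T" "a \<in> T \<rightarrow> {-1, 1}" by blast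
    show "g -` A \<inter> space lim \<in> sets lim"
      unfolding T(1) vim[OF T(3)] sets_lim by (rule measurable_prod_emb[OF _ X[OF T(2)]]) simp
  qed
  have "is_limit_gibbs lam M"
    unfolding is_limit_gibbs_def
  proof (intro conjI allI impI)
    show "prob_space M" unfolding M_def by (rule P.prob_space_distr[OF g])
    show "space M = Omega" unfolding M_def using cylinders_subset by (simp add: space_measure_of_conv)
    show "sets M = sigma_sets Omega cylinders" unfolding M_def by (simp only: sets_distr sets_measure_of[OF cylinders_subset])
    fix T and a :: "'n config" assume T: "finite T" "a \<in> T \<rightarrow> {-1, 1}"
    have "cylinder T a \<in> sets (sigma Omega cylinders)"
      unfolding sets_measure_of[OF cylinders_subset] using T by (intro sigma_sets.Basic) blast
    then have "measure M (cylinder T a) = measure lim (emb UNIV T (X T a))"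
      unfolding M_def vim[OF T(2), symmetric] by (rule measure_distr[OF g])
    also have "\<dots> = measure (marginal_measure lam T) (X T a)"
      by (rule measure_lim_emb[OF _ T(1) X[OF T(1)]]) simp
    also have "\<dots> = marginal lam T {t \<in> T. a t = -1}"
    proof -
      have "{D. D \<in> Pow T \<and> restrict (spins D) T \<in> X T a} = {{t \<in> T. a t = -1}}"
        by (auto simp: X_def spins_def restrict_PiE_iff split: if_splits)
      then have "emeasure (marginal_measure lam T) (X T a) = ennreal (marginal lam T {t \<in> T. a t = -1})"
        unfolding emeasure_marginal_measure[OF T(1) X[OF T(1)]] by simp
      then show ?thesis using marginal_nonneg[OF lam T(1)] unfolding measure_def by simp
    qed
    finally show "measure M (cylinder T a) = (-1) ^ card {t \<in> T. a t = -1} / 2 ^ card T *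
      (\<Sum>T'\<in>Pow T. limit_corr lam T' * (\<Prod>t\<in>T - T'. a t))"
      unfolding marginal_formula[OF T] .
  qed
  then show ?thesis ..
qed

text \<open>
  Two cylinders intersect in a cylinder or not at all, so together with the empty set they form
  a generator that is stable under intersections.
\<close>
lemma is_limit_gibbs_unique:
  fixes M M' :: "('n::finite) config measure"
  assumes M: "is_limit_gibbs lam M" and M': "is_limit_gibbs lam M'"
  shows "M = M'"
proof -
  interpret M: prob_space M using M by (simp add: is_limit_gibbs_def)
  interpret M': prob_space M' using M' by (simp add: is_limit_gibbs_def)
  let ?E = "insert {} cylinders :: 'n config set set"
  have sig: "sigma_sets Omega ?E = sigma_sets Omega cylinders"
  proof (rule sigma_sets_eqI)
    fix a assume "a \<in> ?E" then show "a \<in> sigma_sets Omega cylinders"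
      by (auto intro: sigma_sets.Empty sigma_sets.Basic)
  qed (auto intro: sigma_sets.Basic)
  have top: "Omega = cylinder {} (\<lambda>_. 1)" by (simp add: cylinder_def)
  show ?thesis
  proof (rule measure_eqI_generator_eq[where \<Omega> = Omega and E = ?E and A = "\<lambda>_. Omega"])
    \<comment> \<open>disjoint cylinders meet in the empty set, which is not a cylinder\<close>
    show "Int_stable ?E"
    proof (rule Int_stableI)
      fix A B assume A: "A \<in> ?E" and B: "B \<in> ?E"
      show "A \<inter> B \<in> ?E"
      proof (cases "A \<inter> B = {}")
        case False
        with A B obtain T a T' a' where T: "A = cylinder T a" "finite T" "a \<in> T \<rightarrow> {-1, 1}"
          "B = cylinder T' a'" "finite T'" "a' \<in> T' \<rightarrow> {-1, 1}" by blast
        obtain \<omega> where \<omega>: "\<omega> \<in> A \<inter> B" using False by blast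
        have "A \<inter> B = cylinder (T \<union> T') \<omega>"
          using \<omega> unfolding T(1,4) cylinder_def by auto
        moreover have "\<omega> \<in> T \<union> T' \<rightarrow> {-1, 1}" using \<omega> unfolding T(1) cylinder_def Omega_def by auto
        ultimately show ?thesis using T(2,5) by blast
      qed simp
    qed
    show "?E \<subseteq> Pow Omega" using cylinders_subset by auto
    show "sets M = sigma_sets Omega ?E" "sets M' = sigma_sets Omega ?E"
      using M M' unfolding sig is_limit_gibbs_def by auto
    show "range (\<lambda>_. Omega) \<subseteq> ?E" using top by blast
    show "emeasure M A = emeasure M' A" if "A \<in> ?E" for A
      using that M M' unfolding is_limit_gibbs_def M.emeasure_eq_measure M'.emeasure_eq_measure by auto
  qed auto
qed

lemma is_limit_gibbs_limit_gibbs: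
  assumes "\<bar>lam\<bar> < corr_radius CARD('n::finite)"
  shows "is_limit_gibbs lam (limit_gibbs lam :: 'n config measure)"
  unfolding limit_gibbs_def
  using is_limit_gibbs_exists[OF assms] is_limit_gibbs_unique by (metis theI)

lemma integral_limit_gibbs:
  fixes T :: "(int ^ 'n::finite) set"
  assumes lam: "\<bar>lam\<bar> < corr_radius CARD('n)" and T: "finite T"
  shows "integral\<^sup>L (limit_gibbs lam) (Qset T) = limit_corr lam T"
    and "integrable (limit_gibbs lam) (Qset T)"
proof -
  let ?M = "limit_gibbs lam :: 'n config measure"
  have M: "is_limit_gibbs lam ?M" by (rule is_limit_gibbs_limit_gibbs[OF lam])
  then interpret prob_space ?M by (simp add: is_limit_gibbs_def)
  have sp: "space ?M = Omega" and sets: "sets ?M = sigma_sets Omega cylinders"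
    using M by (auto simp: is_limit_gibbs_def)
  have pm: "spins D \<in> T \<rightarrow> {-1, 1}" for D by (auto simp: spins_def)
  have cyl: "cylinder T (spins D) \<in> sets ?M" for D
    unfolding sets using T pm by (intro sigma_sets.Basic) blast
  have meas: "measure ?M (cylinder T (spins D)) = marginal lam T D" if "D \<in> Pow T" for D
  proof -
    have "{t \<in> T. spins D t = -1} = D" using that by (auto simp: spins_def split: if_splits)
    then show ?thesis using M T pm[of D] marginal_formula[OF T pm, of D lam] unfolding is_limit_gibbs_def by simp
  qed
  have eq: "Qset T \<omega> = (\<Sum>D\<in>Pow T. spin_prod T (spins D) * indicator (cylinder T (spins D)) \<omega>)"
    if "\<omega> \<in> space ?M" for \<omega>
  proof -
    let ?D = "{t \<in> T. \<omega> t = -1}"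
    have \<omega>: "\<omega> t = spins ?D t" if "t \<in> T" for t
      using that \<open>\<omega> \<in> space ?M\<close> by (auto simp: sp Omega_def spins_def)
    have ind: "indicator (cylinder T (spins D)) \<omega> = (if D = ?D then 1 else 0 :: real)" if "D \<in> Pow T" for D
    proof -
      have "\<omega> \<in> cylinder T (spins D) \<longleftrightarrow> (\<forall>t\<in>T. spins ?D t = spins D t)"
        using \<omega> \<open>\<omega> \<in> space ?M\<close> by (auto simp: cylinder_def sp)
      also have "\<dots> \<longleftrightarrow> D = ?D" using that by (auto simp: spins_def split: if_splits)
      finally show ?thesis by (simp add: indicator_def)
    qed
    have "(\<Sum>D\<in>Pow T. spin_prod T (spins D) * indicator (cylinder T (spins D)) \<omega>) =
      (\<Sum>D\<in>Pow T. if D = ?D then spin_prod T (spins D) else 0)"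
      by (intro sum.cong refl) (simp add: ind)
    also have "\<dots> = spin_prod T (spins ?D)" using T by (simp add: sum.delta)
    also have "\<dots> = Qset T \<omega>" unfolding Qset_eq spin_prod_def by (intro prod.cong refl) (simp add: \<omega>)
    finally show ?thesis ..
  qed
  have ii: "integrable ?M (indicat_real (cylinder T (spins D)))" for D
    by (rule integrable_real_indicator[OF cyl]) (simp add: emeasure_eq_measure)
  let ?f = "\<lambda>\<omega>. \<Sum>D\<in>Pow T. spin_prod T (spins D) * indicator (cylinder T (spins D)) \<omega>"
  have int: "integrable ?M ?f" by (intro Bochner_Integration.integrable_sum integrable_mult_right ii)
  have "integral\<^sup>L ?M (Qset T) = integral\<^sup>L ?M ?f"
    by (rule Bochner_Integration.integral_cong[OF refl]) (rule eq)
  also have "\<dots> = (\<Sum>D\<in>Pow T. spin_prod T (spins D) * measure ?M (cylinder T (spins D)))"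
    using cyl sets.sets_into_space[OF cyl]
    by (subst Bochner_Integration.integral_sum) (auto simp: Int_absorb1 Int_absorb2 intro!: integrable_mult_right ii)
  also have "\<dots> = limit_corr lam T"
    unfolding sum_marginal_spin_prod[OF lam T, symmetric] by (intro sum.cong refl) (simp add: meas)
  finally show "integral\<^sup>L ?M (Qset T) = limit_corr lam T" .
  show "integrable ?M (Qset T)"
    by (rule Bochner_Integration.integrable_cong[THEN iffD1, OF refl _ int]) (simp add: eq)
qed

text \<open>
  Flipping all spins of the cube shows that single spins have mean zero in every finite volume.
\<close>
lemma limit_corr_odd:
  fixes t :: "int ^ 'n::finite"
  assumes "\<bar>lam\<bar> < corr_radius CARD('n)"
  shows "limit_corr lam {t} = 0"
proof (rule LIMSEQ_unique[OF gibbs_cube_tendsto(2)[OF _ assms]])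
  have "integral\<^sup>L (gibbs_cube lam N) (Qset {t}) = 0" if "{t} \<subseteq> cube N" for N
  proof -
    have e: "(\<lambda>\<sigma>. of_real lam * of_real (\<Sum>A\<in>bonds_in (cube N). spin_prod A \<sigma>)) = energy (bonds_in (cube N)) (\<lambda>_. lam)"
      by (simp add: energy_def fun_eq_iff sum_distrib_left)
    have "gibbs_ex (cube N) (energy (bonds_in (cube N)) (\<lambda>_. lam)) (spin_prod {t}) = 0"
    proof (rule gibbs_ex_odd[where W = "cube N"])
      show "finite A \<and> even (card (A \<inter> cube N))" if "A \<in> bonds_in (cube N)" for A
        using that finite_bond[of A] card_bond[of A] by (auto simp: bonds_in_def Int_absorb2)
    qed (use that in auto)
    then show ?thesis
      using of_real_integral_gibbs_cube[OF depends_on_spin_prod[OF that], of lam] unfolding e Qset_eq by simp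
  qed
  then show "(\<lambda>N. integral\<^sup>L (gibbs_cube lam N) (Qset {t})) \<longlonglongrightarrow> 0"
    by (intro tendsto_eventually eventually_mono[OF eventually_subset_cube[of "{t}"]]) auto
qed simp

section \<open>Block spins\<close>

lemma block_eq_box:
  assumes "0 < k"
  shows "G k -` {\<tau>} = {t :: int ^ 'n::finite. \<forall>i. t $ i \<in> {int k * \<tau> $ i ..< int k * \<tau> $ i + int k}}"
proof -
  have *: "\<lfloor>real_of_int a / real k\<rfloor> = b \<longleftrightarrow> a \<in> {int k * b ..< int k * b + int k}" for a b :: int
  proof -
    have "\<lfloor>real_of_int a / real k\<rfloor> = b \<longleftrightarrow> real_of_int (int k * b) \<le> real_of_int a \<and> real_of_int a < real_of_int (int k * b + int k)"
      unfolding floor_eq_iff using assms by (simp add: field_simps)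
    then show ?thesis unfolding of_int_le_iff of_int_less_iff by simp
  qed
  show ?thesis
    by (simp only: set_eq_iff vimage_singleton_eq mem_Collect_eq G_def vec_eq_iff vec_lambda_beta * simp_thms)
qed

lemma card_block_overlap:
  fixes \<tau> u :: "int ^ 'n::finite"
  assumes "0 < k"
  shows "card {s \<in> G k -` {\<tau>}. s + u \<in> G k -` {\<tau>}} = (\<Prod>i\<in>UNIV. nat (int k - \<bar>u $ i\<bar>))"
proof -
  let ?S = "\<lambda>i. {max (int k * \<tau> $ i) (int k * \<tau> $ i - u $ i) ..<
     min (int k * \<tau> $ i + int k) (int k * \<tau> $ i + int k - u $ i)}"
  have "{s \<in> G k -` {\<tau>}. s + u \<in> G k -` {\<tau>}} = {s. \<forall>i. s $ i \<in> ?S i}"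
    unfolding block_eq_box[OF assms] by auto (smt (verit))+
  moreover have "card (?S i) = nat (int k - \<bar>u $ i\<bar>)" for i
    by (simp add: max_def min_def abs_if)
  ultimately show ?thesis by (simp only: card_box)
qed

lemma finite_block: "0 < k \<Longrightarrow> finite (G k -` {\<tau> :: int ^ 'n::finite})"
  unfolding block_eq_box by (rule finite_box) simp

lemma card_block: "0 < k \<Longrightarrow> card (G k -` {\<tau> :: int ^ 'n::finite}) = k ^ CARD('n)"
proof -
  assume "0 < k"
  moreover have "{s \<in> G k -` {\<tau>}. s + 0 \<in> G k -` {\<tau>}} = G k -` {\<tau>}" by auto
  ultimately show ?thesis using card_block_overlap[of k \<tau> 0] by (simp only:) simp
qed

text \<open>
  The weight of the difference \<open>u\<close> among the pairs of points of a block.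
\<close>
definition overlap :: "nat \<Rightarrow> int ^ 'n::finite \<Rightarrow> int ^ 'n \<Rightarrow> real" where
  "overlap k \<tau> u = real (card {s \<in> G k -` {\<tau>}. s + u \<in> G k -` {\<tau>}}) / real k ^ CARD('n)"

lemma overlap_bounds: "0 \<le> overlap k \<tau> u" "overlap k \<tau> u \<le> 1"
proof -
  show "0 \<le> overlap k \<tau> u" by (simp add: overlap_def)
  show "overlap k \<tau> u \<le> 1"
  proof (cases "0 < k")
    case True
    have "card {s \<in> G k -` {\<tau>}. s + u \<in> G k -` {\<tau>}} \<le> card (G k -` {\<tau>})"
      by (rule card_mono[OF finite_block[OF True]]) auto
    then have "real (card {s \<in> G k -` {\<tau>}. s + u \<in> G k -` {\<tau>}}) \<le> real k ^ CARD('a)"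
      unfolding card_block[OF True] by (simp flip: of_nat_power)
    then show ?thesis unfolding overlap_def using True by simp
  \<comment> \<open>for \<open>k = 0\<close> the quotient is a division by zero, hence zero\<close>
  qed (simp add: overlap_def power_0_left)
qed

lemma overlap_tendsto: "(\<lambda>k. overlap k \<tau> (u :: int ^ 'n::finite)) \<longlonglongrightarrow> 1"
proof -
  have 1: "(\<lambda>k. real (nat (int k - \<bar>a\<bar>)) / real k) \<longlonglongrightarrow> 1" for a :: int
  proof (rule Lim_transform_eventually)
    show "(\<lambda>k. 1 - real_of_int \<bar>a\<bar> / real k) \<longlonglongrightarrow> 1"
      using tendsto_diff[OF tendsto_const lim_const_over_n[of "real_of_int \<bar>a\<bar>"], of 1] by simp
    show "\<forall>\<^sub>F k in sequentially. 1 - real_of_int \<bar>a\<bar> / real k = real (nat (int k - \<bar>a\<bar>)) / real k"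
      using eventually_gt_at_top[of "nat \<bar>a\<bar>"]
    proof eventually_elim
      case (elim k)
      then have "real (nat (int k - \<bar>a\<bar>)) = real k - real_of_int \<bar>a\<bar>" "0 < k" by auto
      then show ?case by (simp add: diff_divide_distrib)
    qed
  qed
  have "(\<lambda>k. \<Prod>i\<in>UNIV. real (nat (int k - \<bar>u $ i\<bar>)) / real k) \<longlonglongrightarrow> (\<Prod>i\<in>(UNIV :: 'n set). 1)"
    by (intro tendsto_prod 1)
  moreover have "\<forall>\<^sub>F k in sequentially. (\<Prod>i\<in>UNIV. real (nat (int k - \<bar>u $ i\<bar>)) / real k) = overlap k \<tau> u"
    using eventually_gt_at_top[of 0]
    by eventually_elim (simp only: overlap_def card_block_overlap prod_dividef prod_constant of_nat_prod)
  ultimately show ?thesis using Lim_transform_eventually by fastforce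
qed

text \<open>
  The coefficient of \<open>lam ^ n\<close> in the variance of a block spin.
\<close>
definition smeared :: "nat \<Rightarrow> int ^ 'n::finite \<Rightarrow> nat \<Rightarrow> complex" where
  "smeared k \<tau> n = (\<Sum>u\<in>cube (2 * n) - {0}. limit_coef {0, u} n * of_real (overlap k \<tau> u))"

text \<open>
  The domination for Tannery's theorem: a bound that is uniform in the weights \<open>c\<close> and geometric in \<open>n\<close>.
\<close>
lemma norm_sum_limit_coef_bound:
  fixes c :: "int ^ 'n::finite \<Rightarrow> complex"
  assumes "\<And>u. norm (c u) \<le> 1"
  shows "norm (\<Sum>u\<in>cube (2 * n) - {0}. limit_coef {0, u} n * c u) \<le> (5 ^ CARD('n) / corr_radius CARD('n)) ^ n"
proof -
  have "norm (\<Sum>u\<in>cube (2 * n) - {0 :: int ^ 'n}. limit_coef {0, u} n * c u) \<le> (\<Sum>u\<in>cube (2 * n) - {0 :: int ^ 'n}. 1 / corr_radius CARD('n) ^ n)"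
  proof (rule order_trans[OF norm_sum sum_mono])
    fix u :: "int ^ 'n"
    have "norm (limit_coef {0, u} n * c u) \<le> 1 / corr_radius CARD('n) ^ n * 1"
      unfolding norm_mult by (intro mult_mono limit_coef_bound assms) (use corr_radius_pos[of "CARD('n)"] in auto)
    then show "norm (limit_coef {0, u} n * c u) \<le> 1 / corr_radius CARD('n) ^ n" by simp
  qed
  also have "\<dots> = real (card (cube (2 * n) - {0 :: int ^ 'n})) / corr_radius CARD('n) ^ n" by simp
  also have "\<dots> \<le> (5 ^ CARD('n)) ^ n / corr_radius CARD('n) ^ n"
  proof (rule divide_right_mono)
    have "card (cube (2 * n) - {0 :: int ^ 'n}) \<le> (2 * (2 * n) + 1) ^ CARD('n)"
      using card_mono[OF finite_cube, of "cube (2 * n) - {0 :: int ^ 'n}" "2 * n"] unfolding card_cube by auto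
    \<comment> \<open>trades the polynomial number of points for a geometric factor\<close>
    also have "2 * (2 * n) + 1 \<le> 5 ^ n" by (induction n) auto
    then have "(2 * (2 * n) + 1) ^ CARD('n) \<le> (5 ^ n) ^ CARD('n)" by (rule power_mono) simp
    finally have "real (card (cube (2 * n) - {0 :: int ^ 'n})) \<le> real ((5 ^ n) ^ CARD('n))" by (rule of_nat_mono)
    then show "real (card (cube (2 * n) - {0 :: int ^ 'n})) \<le> (5 ^ CARD('n)) ^ n"
      by (simp add: power_mult[symmetric] mult.commute)
  qed (use corr_radius_pos[of "CARD('n)"] in auto)
  also have "\<dots> = (5 ^ CARD('n) / corr_radius CARD('n)) ^ n" by (simp add: power_divide)
  finally show ?thesis .
qed

lemma smeared_tendsto:
  "(\<lambda>k. smeared k (\<tau> :: int ^ 'n::finite) n) \<longlonglongrightarrow> of_real (V TYPE('n) n)"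
proof -
  have "(\<lambda>k. smeared k \<tau> n) \<longlonglongrightarrow> (\<Sum>u\<in>cube (2 * n) - {0 :: int ^ 'n}. limit_coef {0, u} n * of_real 1)"
    unfolding smeared_def by (intro tendsto_sum tendsto_mult tendsto_const tendsto_of_real overlap_tendsto)
  then show ?thesis by (simp add: V_eq)
qed

lemma V_bound: "\<bar>V TYPE('n::finite) n\<bar> \<le> (5 ^ CARD('n) / corr_radius CARD('n)) ^ n"
  using norm_sum_limit_coef_bound[where c = "\<lambda>_ :: int ^ 'n. 1" and n = n] V_eq[where 'n = 'n and n = n]
  by (metis (no_types, lifting) mult.right_neutral norm_of_real norm_one order_refl sum.cong)

lemma V_0: "V TYPE('n::finite) 0 = 0"
proof -
  have "(cube (2 * 0) :: (int ^ 'n) set) - {0} = {}" by (auto simp: cube_def vec_eq_iff)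
  then have "complex_of_real (V TYPE('n) 0) = 0" unfolding V_eq by (simp only: sum.empty)
  then show ?thesis by simp
qed

lemma limit_corr_translate:
  fixes s t :: "int ^ 'n::finite"
  assumes "\<bar>lam\<bar> < corr_radius CARD('n)"
  shows "limit_corr lam {s, t} = limit_corr lam {0, t - s}"
proof -
  have st: "{s, t} = (+) s ` {0, t - s}" by simp
  have "limit_corr lam ((+) s ` U) = limit_corr lam U" if "finite U" for U
    unfolding of_real_eq_iff[where 'a = complex, symmetric] gibbs_cube_tendsto(1)[OF that assms]
      gibbs_cube_tendsto(1)[OF finite_imageI[OF that] assms] limit_coef_translate[OF that] ..
  from this[of "{0, t - s}"] show ?thesis unfolding st[symmetric] by simp
qed

lemma variance_block_spin:
  fixes \<tau> :: "int ^ 'n::finite"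
  assumes lam: "\<bar>lam\<bar> < corr_radius CARD('n)" and k: "0 < k"
  shows "semi_invariant (limit_gibbs lam) [Y k \<tau>, Y k \<tau>] =
    1 + (\<Sum>(s, t) | s \<in> G k -` {\<tau>} \<and> t \<in> G k -` {\<tau>} \<and> s \<noteq> t. limit_corr lam {0, t - s}) / real k ^ CARD('n)"
proof -
  let ?M = "limit_gibbs lam :: 'n config measure"
  let ?B = "G k -` {\<tau>}"
  define c where "c = real k powr (- real CARD('n) / 2)"
  have M: "is_limit_gibbs lam ?M" by (rule is_limit_gibbs_limit_gibbs[OF lam])
  then interpret prob_space ?M by (simp add: is_limit_gibbs_def)
  have sp: "space ?M = Omega" using M by (simp add: is_limit_gibbs_def)
  have fin: "finite ?B" by (rule finite_block[OF k])
  have cc: "c * c = 1 / real k ^ CARD('n)"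
  proof -
    have "c * c = real k powr (- real CARD('n))" unfolding c_def by (simp flip: powr_add)
    then show ?thesis using k by (simp add: powr_minus powr_realpow field_simps)
  qed
  have Y: "Y k \<tau> = (\<lambda>\<omega>. c * (\<Sum>t\<in>?B. Q t \<omega>))" by (simp add: Y_def c_def fun_eq_iff)
  have Q: "Q t = Qset {t}" for t :: "int ^ 'n" by (simp add: Q_eq Qset_eq)
  have EY: "integral\<^sup>L ?M (Y k \<tau>) = 0"
  proof -
    have "integral\<^sup>L ?M (Y k \<tau>) = c * (\<Sum>t\<in>?B. integral\<^sup>L ?M (Q t))"
      unfolding Y Q
      by (subst integral_mult_right_zero, subst Bochner_Integration.integral_sum)
         (auto intro: integral_limit_gibbs(2)[OF lam])
    then show ?thesis unfolding Q by (simp add: integral_limit_gibbs(1)[OF lam] limit_corr_odd[OF lam])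
  qed
  have QQ: "integrable ?M (\<lambda>\<omega>. Q s \<omega> * Q t \<omega>) \<and>
      integral\<^sup>L ?M (\<lambda>\<omega>. Q s \<omega> * Q t \<omega>) = (if s = t then 1 else limit_corr lam {0, t - s})" for s t :: "int ^ 'n"
  proof (cases "s = t")
    case True
    have "Q s \<omega> * Q t \<omega> = 1" if "\<omega> \<in> space ?M" for \<omega>
    proof -
      have "\<omega> t = 1 \<or> \<omega> t = -1" using that unfolding sp Omega_def by auto
      then show ?thesis using True by (auto simp: Q_def)
    qed
    then have "integrable ?M (\<lambda>\<omega>. Q s \<omega> * Q t \<omega>) = integrable ?M (\<lambda>_. 1 :: real)"
      "integral\<^sup>L ?M (\<lambda>\<omega>. Q s \<omega> * Q t \<omega>) = integral\<^sup>L ?M (\<lambda>_. 1)"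
      by (intro Bochner_Integration.integrable_cong Bochner_Integration.integral_cong refl; simp)+
    then show ?thesis using True by (simp add: prob_space)
  next
    case False
    then have "(\<lambda>\<omega>. Q s \<omega> * Q t \<omega>) = Qset {s, t}" by (simp add: Qset_def fun_eq_iff)
    then show ?thesis using False integral_limit_gibbs[OF lam, of "{s, t}"]
      limit_corr_translate[OF lam, of s t] by simp
  qed
  have "integral\<^sup>L ?M (\<lambda>\<omega>. Y k \<tau> \<omega> * Y k \<tau> \<omega>) = integral\<^sup>L ?M (\<lambda>\<omega>. c * c * (\<Sum>s\<in>?B. \<Sum>t\<in>?B. Q s \<omega> * Q t \<omega>))"
    unfolding Y sum_product[symmetric] by (simp add: mult_ac)
  also have "\<dots> = c * c * (\<Sum>s\<in>?B. \<Sum>t\<in>?B. integral\<^sup>L ?M (\<lambda>\<omega>. Q s \<omega> * Q t \<omega>))"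
    by (subst integral_mult_right_zero, subst Bochner_Integration.integral_sum)
       (auto simp: QQ intro!: Bochner_Integration.integrable_sum Bochner_Integration.integral_sum)
  also have "(\<Sum>s\<in>?B. \<Sum>t\<in>?B. integral\<^sup>L ?M (\<lambda>\<omega>. Q s \<omega> * Q t \<omega>)) =
      (\<Sum>(s, t)\<in>?B \<times> ?B. if s = t then 1 else limit_corr lam {0, t - s})"
    by (simp add: QQ sum.cartesian_product)
  also have "\<dots> = (\<Sum>(s, t)\<in>(\<lambda>s. (s, s)) ` ?B. if s = t then 1 else limit_corr lam {0, t - s}) +
      (\<Sum>(s, t) | s \<in> ?B \<and> t \<in> ?B \<and> s \<noteq> t. if s = t then 1 else limit_corr lam {0, t - s})"
  proof -
    have "{(s, t). s \<in> ?B \<and> t \<in> ?B \<and> s \<noteq> t} = ?B \<times> ?B - (\<lambda>s. (s, s)) ` ?B" by auto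
    then show ?thesis using fin by (subst sum.subset_diff[of "(\<lambda>s. (s, s)) ` ?B"]) (auto simp: add.commute)
  qed
  also have "(\<Sum>(s, t)\<in>(\<lambda>s. (s, s)) ` ?B. if s = t then 1 else limit_corr lam {0, t - s}) = real k ^ CARD('n)"
    by (subst sum.reindex) (auto simp: inj_on_def card_block[OF k])
  also have "(\<Sum>(s, t) | s \<in> ?B \<and> t \<in> ?B \<and> s \<noteq> t. if s = t then 1 else limit_corr lam {0, t - s}) =
      (\<Sum>(s, t) | s \<in> ?B \<and> t \<in> ?B \<and> s \<noteq> t. limit_corr lam {0, t - s})"
    by (intro sum.cong) auto
  finally have "integral\<^sup>L ?M (\<lambda>\<omega>. Y k \<tau> \<omega> * Y k \<tau> \<omega>) =
     1 + (\<Sum>(s, t) | s \<in> ?B \<and> t \<in> ?B \<and> s \<noteq> t. limit_corr lam {0, t - s}) / real k ^ CARD('n)"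
    unfolding cc using k by (simp add: add_divide_distrib)
  then show ?thesis unfolding semi_invariant_eq_cumulant cumulant_pair EY by simp
qed

text \<open>
  Pairs of points of a block are sorted by their difference. Only differences in \<open>cube (2 * n)\<close> matter,
  which makes the sum over differences finite.
\<close>
lemma sum_pairs_limit_coef:
  fixes \<tau> :: "int ^ 'n::finite"
  assumes k: "0 < k"
  shows "(\<Sum>(s, t) | s \<in> G k -` {\<tau>} \<and> t \<in> G k -` {\<tau>} \<and> s \<noteq> t. limit_coef {0, t - s} n) / of_real (real k ^ CARD('n)) = smeared k \<tau> n"
proof -
  let ?B = "G k -` {\<tau>}" and ?c = "cube (2 * n) - {0 :: int ^ 'n}"
  let ?P = "{(s, t). s \<in> ?B \<and> t \<in> ?B \<and> s \<noteq> t}" and ?P' = "{(s, t). s \<in> ?B \<and> t \<in> ?B \<and> t - s \<in> ?c}"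
  have finP: "finite ?P" by (rule finite_subset[of _ "?B \<times> ?B"]) (use finite_block[OF k, of \<tau>] in auto)
  define f where "f p = limit_coef {0, snd p - fst p :: int ^ 'n} n" for p
  have "(\<Sum>(s, t)\<in>?P. limit_coef {0, t - s} n) = (\<Sum>p\<in>?P. f p)"
    by (simp add: f_def case_prod_unfold)
  also have "\<dots> = (\<Sum>p\<in>?P'. f p)"
    by (rule sum.mono_neutral_right[OF finP]) (auto simp: f_def intro: limit_coef_far)
  also have "\<dots> = (\<Sum>u\<in>?c. \<Sum>p | p \<in> ?P' \<and> snd p - fst p = u. f p)"
  proof (rule sum.group[symmetric])
    show "finite ?P'" by (rule finite_subset[OF _ finP]) auto
    show "finite ?c" using finite_cube by blast
  qed auto
  also have "\<dots> = (\<Sum>u\<in>?c. limit_coef {0, u} n * of_nat (card {s \<in> ?B. s + u \<in> ?B}))"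
  proof (rule sum.cong[OF refl])
    fix u assume u: "u \<in> ?c"
    have "(\<Sum>p | p \<in> ?P' \<and> snd p - fst p = u. f p) = (\<Sum>s | s \<in> ?B \<and> s + u \<in> ?B. limit_coef {0, u} n)"
      by (rule sum.reindex_bij_witness[where i = "\<lambda>s. (s, s + u)" and j = fst]) (use u in \<open>auto simp: f_def\<close>)
    then show "(\<Sum>p | p \<in> ?P' \<and> snd p - fst p = u. f p) = limit_coef {0, u} n * of_nat (card {s \<in> ?B. s + u \<in> ?B})"
      by simp
  qed
  finally show ?thesis unfolding smeared_def overlap_def by (simp add: sum_divide_distrib)
qed

lemma variance_series:
  fixes \<tau> :: "int ^ 'n::finite"
  assumes lam: "\<bar>lam\<bar> < corr_radius CARD('n)" and k: "0 < k"
  shows "of_real (semi_invariant (limit_gibbs lam) [Y k \<tau>, Y k \<tau>]) =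
    1 + (\<Sum>n. smeared k \<tau> n * of_real lam ^ n)"
proof -
  let ?P = "{(s, t). s \<in> G k -` {\<tau>} \<and> t \<in> G k -` {\<tau>} \<and> s \<noteq> t}"
  have z: "norm (complex_of_real lam) < corr_radius CARD('n)" using lam by simp
  have sm: "summable (\<lambda>n. limit_coef {0, u} n * complex_of_real lam ^ n)" for u :: "int ^ 'n"
    by (rule summable_norm_cancel[OF volume_corr_tendsto(1)[OF _ z]]) simp
  have "complex_of_real (\<Sum>(s, t)\<in>?P. limit_corr lam {0, t - s}) =
    (\<Sum>p\<in>?P. \<Sum>n. limit_coef {0, snd p - fst p} n * of_real lam ^ n)"
    unfolding of_real_sum case_prod_beta by (intro sum.cong refl gibbs_cube_tendsto(1)[OF _ lam]) simp
  also have "\<dots> = (\<Sum>n. \<Sum>p\<in>?P. limit_coef {0, snd p - fst p} n * of_real lam ^ n)"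
    by (rule suminf_sum[symmetric]) (rule sm)
  also have "\<dots> = (\<Sum>n. (\<Sum>(s, t)\<in>?P. limit_coef {0, t - s} n) * of_real lam ^ n)"
    by (simp add: sum_distrib_right case_prod_beta)
  finally have eq: "complex_of_real (\<Sum>(s, t)\<in>?P. limit_corr lam {0, t - s}) =
    (\<Sum>n. (\<Sum>(s, t)\<in>?P. limit_coef {0, t - s} n) * of_real lam ^ n)" .
  have "summable (\<lambda>n. \<Sum>p\<in>?P. limit_coef {0, snd p - fst p} n * of_real lam ^ n)"
    by (rule summable_sum) (rule sm)
  then have "summable (\<lambda>n. (\<Sum>(s, t)\<in>?P. limit_coef {0, t - s} n) * of_real lam ^ n)"
    by (simp add: sum_distrib_right case_prod_beta)
  from suminf_divide[OF this, of "of_real (real k ^ CARD('n))"]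
  have "complex_of_real (\<Sum>(s, t)\<in>?P. limit_corr lam {0, t - s}) / of_real (real k ^ CARD('n)) =
    (\<Sum>n. smeared k \<tau> n * of_real lam ^ n)"
    unfolding eq sum_pairs_limit_coef[OF k, symmetric] by simp
  then show ?thesis unfolding variance_block_spin[OF lam k] by simp
qed

text \<open>
  The admitted couplings are far smaller than required: \<open>C3 \<nu> \<ge> 15 ^ \<nu>\<close> already gives
  \<open>C \<nu> \<le> 1 / (32 * 15 ^ \<nu>)\<close>, while \<open>5 ^ \<nu> / corr_radius \<nu> = 16 * 15 ^ \<nu>\<close>.
\<close>
lemma coupling_small:
  assumes "\<bar>lam\<bar> < C \<nu>" "1 \<le> \<nu>"
  shows "5 ^ \<nu> / corr_radius \<nu> * \<bar>lam\<bar> < 1/2" and "\<bar>lam\<bar> < corr_radius \<nu>"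
proof -
  have L: "L \<nu> \<ge> 5" using assms(2) by (simp add: L_def)
  have "(15::real) ^ \<nu> \<le> exp 4 ^ \<nu>"
  proof (rule power_mono)
    have "(2::real) ^ 4 \<le> exp 1 ^ 4" using exp_ge_add_one_self[of "1::real"] by (intro power_mono) auto
    also have "\<dots> = exp 4" by (simp flip: exp_of_nat_mult)
    finally show "(15::real) \<le> exp 4" by simp
  qed simp
  also have "\<dots> = exp (4 * real \<nu>)" by (simp add: exp_of_nat_mult[symmetric] mult.commute)
  also have "\<dots> \<le> exp (L \<nu> ^ 2 + 1)"
  proof -
    have "L \<nu> * 1 \<le> L \<nu> * L \<nu>" using L by (intro mult_left_mono) auto
    moreover have "4 * real \<nu> \<le> L \<nu>" by (simp add: L_def)
    ultimately show ?thesis unfolding power2_eq_square exp_le_cancel_iff by linarith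
  qed
  also have "\<dots> \<le> 3 * L \<nu> * exp (L \<nu> ^ 2 + 1)"
    using L mult_right_mono[of 1 "3 * L \<nu>" "exp (L \<nu> ^ 2 + 1)"] by simp
  finally have C3: "15 ^ \<nu> \<le> C3 \<nu>" by (simp add: C3_def)
  have C31: "1 \<le> C3 \<nu>" using C3 one_le_power[of "15::real" \<nu>] by linarith
  have "C3 \<nu> \<le> C3 \<nu> ^ 3" using power_increasing[of 1 3 "C3 \<nu>"] C31 by simp
  then have "15 ^ \<nu> \<le> C3 \<nu> ^ 3" using C3 by linarith
  moreover have "4 \<le> C2 \<nu>" using assms(2) one_le_power[of "real \<nu>" 2] by (simp add: C2_def)
  ultimately have "32 * 15 ^ \<nu> \<le> 8 * C2 \<nu> * C3 \<nu> ^ 3"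
    using mult_mono[of 4 "C2 \<nu>" "15 ^ \<nu>" "C3 \<nu> ^ 3"] by simp
  then have "1 / (8 * C2 \<nu> * C3 \<nu> ^ 3) \<le> 1 / (32 * 15 ^ \<nu>)"
    by (intro frac_le) simp_all
  then have lam: "\<bar>lam\<bar> < 1 / (32 * 15 ^ \<nu>)" using assms(1) unfolding C_def by simp
  have "5 ^ \<nu> / corr_radius \<nu> * \<bar>lam\<bar> = 16 * 15 ^ \<nu> * \<bar>lam\<bar>"
    by (simp add: corr_radius_def power_mult_distrib[symmetric])
  also have "\<dots> < 16 * 15 ^ \<nu> * (1 / (32 * 15 ^ \<nu>))"
    by (rule mult_strict_left_mono[OF lam]) simp
  finally show small: "5 ^ \<nu> / corr_radius \<nu> * \<bar>lam\<bar> < 1/2" by simp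
  have "\<bar>lam\<bar> \<le> 5 ^ \<nu> * \<bar>lam\<bar>" using mult_right_mono[of 1 "5 ^ \<nu>" "\<bar>lam\<bar>"] by simp
  also have "\<dots> < corr_radius \<nu>" using small corr_radius_pos[of \<nu>] by (simp add: field_simps)
  finally show "\<bar>lam\<bar> < corr_radius \<nu>" .
qed

text \<open>
  The last bound leaves room for positivity: the series is smaller than the leading term \<open>1\<close>.
\<close>
lemma variance_limit:
  fixes \<tau> :: "int ^ 'n::finite"
  assumes "\<bar>lam\<bar> < C CARD('n)"
  shows "summable (\<lambda>n. lam ^ Suc n * V TYPE('n) (Suc n))"
    and "(\<lambda>k. semi_invariant (limit_gibbs lam) [Y k \<tau>, Y k \<tau>])
         \<longlonglongrightarrow> 1 + (\<Sum>n. lam ^ Suc n * V TYPE('n) (Suc n))"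
    and "\<bar>\<Sum>n. lam ^ Suc n * V TYPE('n) (Suc n)\<bar> < 1"
proof -
  define x where "x = 5 ^ CARD('n) / corr_radius CARD('n) * \<bar>lam\<bar>"
  note small = coupling_small[OF assms]
  have x: "0 \<le> x" "x < 1/2" "\<bar>lam\<bar> < corr_radius CARD('n)" using small corr_radius_pos[of "CARD('n)"] by (auto simp: x_def)
  let ?f = "\<lambda>n. lam ^ n * V TYPE('n) n"
  have fb: "norm (?f n) \<le> x ^ n" for n
  proof -
    have "norm (?f n) = \<bar>V TYPE('n) n\<bar> * \<bar>lam\<bar> ^ n" by (simp add: abs_mult power_abs)
    also have "\<dots> \<le> (5 ^ CARD('n) / corr_radius CARD('n)) ^ n * \<bar>lam\<bar> ^ n" by (intro mult_right_mono V_bound) auto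
    finally show ?thesis by (simp add: x_def power_mult_distrib power_divide)
  qed
  have geo: "summable (\<lambda>n. x ^ n)" using x by (intro summable_geometric) auto
  have sumf: "summable ?f" by (rule summable_comparison_test'[OF geo fb])
  then show summ: "summable (\<lambda>n. lam ^ Suc n * V TYPE('n) (Suc n))" by (rule summable_Suc_iff[THEN iffD2])
  have shift: "(\<Sum>n. lam ^ Suc n * V TYPE('n) (Suc n)) = suminf ?f"
    using suminf_split_head[OF sumf] by (simp add: V_0)
  have "(\<lambda>k. \<Sum>n. smeared k \<tau> n * complex_of_real lam ^ n) \<longlonglongrightarrow> (\<Sum>n. complex_of_real (V TYPE('n) n) * of_real lam ^ n)"
  proof (rule tannerys_theorem[THEN conjunct2, THEN conjunct2, OF _ _ geo])
    show "(\<lambda>k. smeared k \<tau> n * complex_of_real lam ^ n) \<longlonglongrightarrow> complex_of_real (V TYPE('n) n) * of_real lam ^ n" for n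
      by (intro tendsto_mult tendsto_const smeared_tendsto)
    have "norm (smeared k \<tau> n * complex_of_real lam ^ n) \<le> x ^ n" for k n
    proof -
      have "norm (smeared k \<tau> n * complex_of_real lam ^ n) \<le> (5 ^ CARD('n) / corr_radius CARD('n)) ^ n * \<bar>lam\<bar> ^ n"
        unfolding norm_mult norm_power smeared_def
        by (intro mult_mono norm_sum_limit_coef_bound)
           (use corr_radius_pos[of "CARD('n)"] in \<open>auto simp: abs_of_nonneg overlap_bounds\<close>)
      then show ?thesis by (simp add: x_def power_mult_distrib power_divide)
    qed
    then show "\<forall>\<^sub>F (n, k) in at_top \<times>\<^sub>F sequentially. norm (smeared k \<tau> n * complex_of_real lam ^ n) \<le> x ^ n"
      by (intro always_eventually) auto
  qed simp
  then have "(\<lambda>k. 1 + (\<Sum>n. smeared k \<tau> n * complex_of_real lam ^ n)) \<longlonglongrightarrow> 1 + (\<Sum>n. complex_of_real (V TYPE('n) n) * of_real lam ^ n)"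
    by (intro tendsto_intros)
  moreover have "\<forall>\<^sub>F k in sequentially. 1 + (\<Sum>n. smeared k \<tau> n * complex_of_real lam ^ n) =
      complex_of_real (semi_invariant (limit_gibbs lam) [Y k \<tau>, Y k \<tau>])"
    using eventually_gt_at_top[of 0] by (rule eventually_mono) (rule variance_series[OF x(3), symmetric])
  ultimately have "(\<lambda>k. complex_of_real (semi_invariant (limit_gibbs lam) [Y k \<tau>, Y k \<tau>])) \<longlonglongrightarrow>
      1 + (\<Sum>n. complex_of_real (V TYPE('n) n) * of_real lam ^ n)"
    by (rule Lim_transform_eventually)
  moreover have "(\<Sum>n. complex_of_real (V TYPE('n) n) * of_real lam ^ n) = of_real (suminf ?f)"
    using suminf_of_real[OF sumf, where 'a = complex] by (simp add: mult.commute)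
  ultimately have "(\<lambda>k. complex_of_real (semi_invariant (limit_gibbs lam) [Y k \<tau>, Y k \<tau>])) \<longlonglongrightarrow> of_real (1 + suminf ?f)"
    by simp
  then show "(\<lambda>k. semi_invariant (limit_gibbs lam) [Y k \<tau>, Y k \<tau>])
         \<longlonglongrightarrow> 1 + (\<Sum>n. lam ^ Suc n * V TYPE('n) (Suc n))"
    unfolding shift tendsto_of_real_iff .
  have "\<bar>\<Sum>n. lam ^ Suc n * V TYPE('n) (Suc n)\<bar> \<le> (\<Sum>n. x ^ Suc n)"
  proof -
    have "norm (\<Sum>n. lam ^ Suc n * V TYPE('n) (Suc n)) \<le> (\<Sum>n. x ^ Suc n)"
    proof (rule norm_suminf_le)
      show "norm (lam ^ Suc n * V TYPE('n) (Suc n)) \<le> x ^ Suc n" for n by (rule fb)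
      show "summable (\<lambda>n. x ^ Suc n)" using geo by (rule summable_Suc_iff[THEN iffD2])
    qed
    then show ?thesis by simp
  qed
  also have "(\<Sum>n. x ^ Suc n) = 1 / (1 - x) - 1"
    using suminf_split_head[OF geo] suminf_geometric[of x] x by simp
  also have "\<dots> < 1" using x by (simp add: field_simps)
  finally show "\<bar>\<Sum>n. lam ^ Suc n * V TYPE('n) (Suc n)\<bar> < 1" .
qed

theorem theorem5p1:
  fixes lam :: real
  assumes "\<bar>lam\<bar> < C CARD('n::finite)"
  shows "summable (\<lambda>n. lam ^ Suc n * V TYPE('n) (Suc n)) \<and>
    (\<forall>\<tau> :: int ^ 'n.
       (\<lambda>k. semi_invariant (limit_gibbs lam) [Y k \<tau>, Y k \<tau>])
         \<longlonglongrightarrow> 1 + (\<Sum>n. lam ^ Suc n * V TYPE('n) (Suc n))) \<and>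
    (\<forall>\<tau> :: int ^ 'n.
       0 < lim (\<lambda>k. semi_invariant (limit_gibbs lam) [Y k \<tau>, Y k \<tau>])) \<and>
    (\<forall>(\<tau> :: int ^ 'n) (\<tau>' :: int ^ 'n).
       lim (\<lambda>k. semi_invariant (limit_gibbs lam) [Y k \<tau>, Y k \<tau>]) =
       lim (\<lambda>k. semi_invariant (limit_gibbs lam) [Y k \<tau>', Y k \<tau>']))"
proof -
  have l: "lim (\<lambda>k. semi_invariant (limit_gibbs lam) [Y k \<tau>, Y k \<tau>]) =
      1 + (\<Sum>n. lam ^ Suc n * V TYPE('n) (Suc n))" for \<tau> :: "int ^ 'n"
    by (rule limI[OF variance_limit(2)[OF assms]])
  have "0 < 1 + (\<Sum>n. lam ^ Suc n * V TYPE('n) (Suc n))"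
    using variance_limit(3)[OF assms] by linarith
  then show ?thesis
    unfolding l using variance_limit(1,2)[OF assms] by blast
qed

end
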